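(* Let $G$ be a symmetry group of a discrete Lagrange--D'Alembert--Poincaré system $\mathcal{M}=(E,L_d,\mathcal{D}_d,\mathcal{D},\mathcal{P})$ over a fiber bundle $\phi:E\to M$, and let $\mathcal{A}_d$ be a discrete connection on the principal $G$-bundle $\pi^{M,G}:M\to M/G$. Let $(v_\cdot,r_\cdot)=((v_0,r_1),\ldots,(v_{N-1},r_N))$ be a trajectory of the reduced system $\mathcal{M}/(G,\mathcal{A}_d)$ and let $(\tilde\epsilon_0,\tilde m_1)\in\mathcal{D}_d$ be such that $\Upsilon_{\mathcal{A}_d}(\tilde\epsilon_0,\tilde m_1)=(v_0,r_1)$. Then there exists a unique trajectory $(\epsilon_\cdot,m_\cdot)$ of $\mathcal{M}$ such that $(\epsilon_0,m_1)=(\tilde\epsilon_0,\tilde m_1)$ and $\Upsilon_{\mathcal{A}_d}(\epsilon_k,m_{k+1})=(v_k,r_{k+1})$ for all $k$.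
   Context: All manifolds, maps and actions are smooth; $p_j$ denotes projection onto the $j$-th factor of a product. DLDPS. For a fiber bundle $\phi:E\to M$ put $C'(E):=E\times M$ and $C''(E):=\{((\epsilon_0,m_1),(\epsilon_1,m_2))\in C'(E)\times C'(E):\phi(\epsilon_1)=m_1\}$, with $\tilde p_{34}:C''(E)\to C'(E)$, $\tilde p_{34}((\epsilon_0,m_1),(\epsilon_1,m_2))=(\epsilon_1,m_2)$. $p_1^*TE\subset T(C'(E))$ is the subbundle of vectors $(\delta\epsilon,0)$. A discrete Lagrange--D'Alembert--Poincaré system (DLDPS) over $E$ is $\mathcal{M}=(E,L_d,\mathcal{D}_d,\mathcal{D},\mathcal{P})$ where $L_d:C'(E)\to\mathbb{R}$ is smooth, $\mathcal{D}_d\subset C'(E)$ is a regular (embedded) submanifold, $\mathcal{D}\subset p_1^*TE$ is a vector subbundle, and $\mathcal{P}:\tilde p_{34}^*\mathcal{D}\to\ker(d\phi)\subset TE$ is a vector bundle homomorphism over $((\epsilon_0,m_1),(\epsilon_1,m_2))\mapsto\epsilon_0$; i.e. $\mathcal{P}((\epsilon_0,m_1),(\epsilon_1,m_2)):\mathcal{D}_{(\epsilon_1,m_2)}\to\ker d\phi(\epsilon_0)$ is linear and depends smoothly on the base point. Trajectories. A discrete path in $C'(E)$ is $(\epsilon_\cdot,m_\cdot)=((\epsilon_0,m_1),\ldots,(\epsilon_{N-1},m_N))\in C'(E)^N$ ($N\ge 2$) with $\phi(\epsilon_k)=m_k$ for $k=1,\ldots,N-1$. A nonholonomic infinitesimal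 variation with fixed endpoints over it is a tangent vector $(\delta\epsilon_\cdot,\delta m_\cdot)=((\delta\epsilon_0,\delta m_1),\ldots,(\delta\epsilon_{N-1},\delta m_N))\in T_{(\epsilon_\cdot,m_\cdot)}(C'(E)^N)$ such that $\delta m_k=d\phi(\epsilon_k)(\delta\epsilon_k)$ for $k=1,\ldots,N-1$, $\delta m_N=0$, and, for some $(\widetilde{\delta\epsilon_k},0)\in\mathcal{D}_{(\epsilon_k,m_{k+1})}$, $k=1,\ldots,N-1$: $\delta\epsilon_{N-1}=\widetilde{\delta\epsilon_{N-1}}$; $\delta\epsilon_k=\widetilde{\delta\epsilon_k}+\mathcal{P}((\epsilon_k,m_{k+1}),(\epsilon_{k+1},m_{k+2}))(\widetilde{\delta\epsilon_{k+1}},0)$ for $k=1,\ldots,N-2$; $\delta\epsilon_0=\mathcal{P}((\epsilon_0,m_1),(\epsilon_1,m_2))(\widetilde{\delta\epsilon_1},0)$. With $S_d(\epsilon_\cdot,m_\cdot):=\sum_{k=0}^{N-1}L_d(\epsilon_k,m_{k+1})$, a trajectory of $\mathcal{M}$ is a discrete path with $(\epsilon_k,m_{k+1})\in\mathcal{D}_d$ for $k=0,\ldots,N-1$ and $dS_d(\epsilon_\cdot,m_\cdot)(\delta\epsilon_\cdot,\delta m_\cdot)=0$ for all such variations. Group actions. A Lie group $G$ acts on the fiber bundle $\phi:E\to M$ with fiber $F_0$ if there are free left $G$-actions on $E$ and $M$ and a right $G$-action on $F_0$ such that $\pi^{M,G}:M\to M/G$ is a principal $G$-bundle, $\phi$ is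 $G$-equivariant, and every $m\in M$ has a $G$-invariant open neighborhood $U$ with a trivialization $\Phi_U:\phi^{-1}(U)\to U\times F_0$ that is equivariant for $g\cdot(m,f)=(g\cdot m,f\cdot g^{-1})$. $G$ acts diagonally on $C'(E)$ and on $C''(E)$. For a left action of $G$ on $X$, $\pi^{X,G}:X\to X/G$ is the quotient map. $G$ is a symmetry group of the DLDPS $\mathcal{M}$ if $G$ acts on the fiber bundle $\phi$, $L_d$ and $\mathcal{D}_d$ are invariant under the diagonal action, $\mathcal{D}$ is invariant under the lifted (differential) action, and $\mathcal{P}$ is equivariant for the induced actions on $\tilde p_{34}^*\mathcal{D}$ and on $\ker d\phi\subset TE$. Discrete connections. An (affine) discrete connection $\mathcal{A}_d$ on a principal $G$-bundle $\pi^{M,G}:M\to M/G$ is given by a submanifold $Hor\subset M\times M$, invariant under the diagonal $G$-action and containing $\{(m,\gamma(m)\cdot m):m\in M\}$ for some smooth $\gamma:M\to G$ with $\gamma(g\cdot m)=g\gamma(m)g^{-1}$, such that $(id_M\times\pi^{M,G})|_{Hor}:Hor\to M\times(M/G)$ is an injective local diffeomorphism. Its domain is $\{(m_0,g\cdot m_1):(m_0,m_1)\in Hor,\ g\in G\}$, and for $(m_0,m_1)$ in the domain $\mathcal{A}_d(m_0,m_1)\in G$ is the unique $g$ with $(m_0,g^{-1}\cdot m_1)\in Hor$; it is smooth and $\mathcal{A}_d(g_0\cdot m_0,g_1\cdot m_1)=g_1\mathcal{A}_d(m_0,m_1)g_0^{-1}$. Convention: the domain is all of $M\times M$. Reduction.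 Let $\widetilde{G}_E:=(E\times G)/G$ for the action $g\cdot(\epsilon,w)=(g\cdot\epsilon,gwg^{-1})$, a fiber bundle over $M/G$ via $p^{M/G}(\pi^{E\times G,G}(\epsilon,w)):=\pi^{M,G}(\phi(\epsilon))$. Define $\Upsilon_{\mathcal{A}_d}:C'(E)\to C'(\widetilde{G}_E)=\widetilde{G}_E\times(M/G)$ by $\Upsilon_{\mathcal{A}_d}(\epsilon,m):=(\pi^{E\times G,G}(\epsilon,\mathcal{A}_d(\phi(\epsilon),m)),\pi^{M,G}(m))$; it is a principal $G$-bundle for the diagonal action. The reduced system $\mathcal{M}/(G,\mathcal{A}_d)=(\widetilde{G}_E,\check L_d,\check{\mathcal{D}}_d,\check{\mathcal{D}},\check{\mathcal{P}})$ is the DLDPS over $p^{M/G}$ with $\check L_d\circ\Upsilon_{\mathcal{A}_d}=L_d$, $\check{\mathcal{D}}_d:=\Upsilon_{\mathcal{A}_d}(\mathcal{D}_d)$, $\check{\mathcal{D}}:=d\Upsilon_{\mathcal{A}_d}(\mathcal{D})$ and $\check{\mathcal{P}}((v_0,r_1),(v_1,r_2))(\delta v_1,0):=d(p_1\circ\Upsilon_{\mathcal{A}_d})(\epsilon_0,m_1)\big(\mathcal{P}((\epsilon_0,m_1),(\epsilon_1,m_2))(\delta\epsilon_1,0),d\phi(\epsilon_1)(\delta\epsilon_1)\big)$, for any $((\epsilon_0,m_1),(\epsilon_1,m_2))\in C''(E)$ with $\Upsilon_{\mathcal{A}_d}(\epsilon_0,m_1)=(v_0,r_1)$, $\Upsilon_{\mathcal{A}_d}(\epsilon_1,m_2)=(v_1,r_2)$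 and the unique $(\delta\epsilon_1,0)\in\mathcal{D}_{(\epsilon_1,m_2)}$ with $d\Upsilon_{\mathcal{A}_d}(\epsilon_1,m_2)(\delta\epsilon_1,0)=(\delta v_1,0)$ (this is well defined). *)

theory Defs
  imports "HOL-Analysis.Analysis" "HOL-Algebra.Group_Action"
begin

section \<open>Model spaces\<close>

text \<open>The class \<^class>\<open>euclidean_space\<close> excludes the zero-dimensional space. It occurs here as model space
  of a discrete group, of the base \<open>M/G\<close> when \<open>M\<close> is a single orbit, and of the fibre of an identity
  map \<open>E = M\<close>, so the following class drops the nonemptiness of the basis.\<close>

class fd_inner = real_inner +
  assumes orthonormal_basis_ex:
    "\<exists>B. finite B \<and> (\<forall>u\<in>B. \<forall>v\<in>B. inner u v = (if u = v then 1 else 0)) \<and>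
         (\<forall>x. (\<forall>u\<in>B. inner x u = 0) \<longleftrightarrow> x = 0)"

subclass (in euclidean_space) fd_inner
proof
  show "\<exists>B. finite B \<and> (\<forall>u\<in>B. \<forall>v\<in>B. inner u v = (if u = v then 1 else 0)) \<and>
         (\<forall>x. (\<forall>u\<in>B. inner x u = 0) \<longleftrightarrow> x = 0)"
    by (intro exI[of _ Basis]) (simp add: inner_Basis euclidean_all_zero_iff)
qed

instantiation unit :: fd_inner
begin
definition zero_unit :: unit where "zero_unit = ()"
definition plus_unit :: "unit \<Rightarrow> unit \<Rightarrow> unit" where "plus_unit x y = ()"
definition scaleR_unit :: "real \<Rightarrow> unit \<Rightarrow> unit" where "scaleR_unit r x = ()"
definition inner_unit :: "unit \<Rightarrow> unit \<Rightarrow> real" where "inner_unit x y = 0"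
definition norm_unit :: "unit \<Rightarrow> real" where "norm_unit x = 0"
definition dist_unit :: "unit \<Rightarrow> unit \<Rightarrow> real" where "dist_unit x y = 0"
definition sgn_unit :: "unit \<Rightarrow> unit" where "sgn_unit x = ()"
definition uniformity_unit :: "(unit \<times> unit) filter" where
  "uniformity_unit = (INF e\<in>{0<..}. principal {(x, y). dist x y < e})"
definition open_unit :: "unit set \<Rightarrow> bool" where
  "open_unit U = (\<forall>x\<in>U. eventually (\<lambda>(x', y). x' = x \<longrightarrow> y \<in> U) uniformity)"
instance
proof
  show "\<exists>B::unit set. finite B \<and> (\<forall>u\<in>B. \<forall>v\<in>B. inner u v = (if u = v then 1 else 0)) \<and>
         (\<forall>x. (\<forall>u\<in>B. inner x u = 0) \<longleftrightarrow> x = 0)"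
    by (intro exI[of _ "{}"]) simp
qed (simp_all add: inner_unit_def norm_unit_def dist_unit_def uniformity_unit_def open_unit_def)
end

instance prod :: (fd_inner, fd_inner) fd_inner
proof
  obtain B :: "'a set" where B: "finite B"
      "\<And>u v. u \<in> B \<Longrightarrow> v \<in> B \<Longrightarrow> inner u v = (if u = v then 1 else 0)"
      "\<And>x. (\<forall>u\<in>B. inner x u = 0) \<longleftrightarrow> x = 0"
    using orthonormal_basis_ex[where 'a='a] by auto
  obtain C :: "'b set" where C: "finite C"
      "\<And>u v. u \<in> C \<Longrightarrow> v \<in> C \<Longrightarrow> inner u v = (if u = v then 1 else 0)"
      "\<And>x. (\<forall>u\<in>C. inner x u = 0) \<longleftrightarrow> x = 0"
    using orthonormal_basis_ex[where 'a='b] by auto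
  have nz: "0 \<notin> B" "0 \<notin> C" using B(2)[of 0 0] C(2)[of 0 0] by auto
  let ?D = "(\<lambda>u. (u, 0)) ` B \<union> (\<lambda>v. (0, v)) ` C"
  show "\<exists>D::('a \<times> 'b) set. finite D \<and> (\<forall>u\<in>D. \<forall>v\<in>D. inner u v = (if u = v then 1 else 0)) \<and>
         (\<forall>x. (\<forall>u\<in>D. inner x u = 0) \<longleftrightarrow> x = 0)"
  proof (intro exI[of _ ?D] conjI)
    show "\<forall>u\<in>?D. \<forall>v\<in>?D. inner u v = (if u = v then 1 else 0)"
      using B(2) C(2) nz by (auto simp: inner_prod_def split: if_splits)
    show "\<forall>x. (\<forall>u\<in>?D. inner x u = 0) \<longleftrightarrow> x = 0"
      using B(3) C(3) by (auto simp: inner_prod_def ball_Un prod_eq_iff)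
  qed (use B C in auto)
qed


section \<open>Smooth manifolds\<close>

text \<open>A function on an open set is \<open>C\<^sup>k\<^sup>+\<^sup>1\<close> iff it is differentiable and all its directional derivatives
  are \<open>C\<^sup>k\<close> (the model spaces are finite-dimensional).\<close>

primrec Ck_on :: "nat \<Rightarrow> 'v::fd_inner set \<Rightarrow> ('v \<Rightarrow> 'w::fd_inner) \<Rightarrow> bool" where
  "Ck_on 0 S f \<longleftrightarrow> continuous_on S f"
| "Ck_on (Suc k) S f \<longleftrightarrow>
     (\<forall>x\<in>S. f differentiable (at x)) \<and> (\<forall>v. Ck_on k S (\<lambda>x. frechet_derivative f (at x) v))"

definition Cinf_on :: "'v::fd_inner set \<Rightarrow> ('v \<Rightarrow> 'w::fd_inner) \<Rightarrow> bool" where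
  "Cinf_on S f \<longleftrightarrow> (\<forall>k. Ck_on k S f)"

text \<open>A chart is a pair of its domain and a coordinate map (only the values on the domain matter).
  Atlases are not assumed to be maximal.\<close>

type_synonym ('p, 'v) chart = "'p set \<times> ('p \<Rightarrow> 'v)"
type_synonym ('p, 'v) atlas = "('p, 'v) chart set"

definition pts :: "('p, 'v) atlas \<Rightarrow> 'p set" where
  "pts A = (\<Union>(U, c)\<in>A. U)"

definition smooth_atlas :: "('p, 'v::fd_inner) atlas \<Rightarrow> bool" where
  "smooth_atlas A \<longleftrightarrow>
     (\<forall>(U, c)\<in>A. inj_on c U \<and> open (c ` U)) \<and>
     (\<forall>(U, c)\<in>A. \<forall>(V, d)\<in>A. open (c ` (U \<inter> V)) \<and> Cinf_on (c ` (U \<inter> V)) (d \<circ> inv_into U c))"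

definition mtop :: "('p, 'v::fd_inner) atlas \<Rightarrow> 'p topology" where
  "mtop A = topology (\<lambda>W. W \<subseteq> pts A \<and> (\<forall>(U, c)\<in>A. open (c ` (U \<inter> W))))"

definition manifold :: "('p, 'v::fd_inner) atlas \<Rightarrow> bool" where
  "manifold A \<longleftrightarrow> smooth_atlas A \<and> Hausdorff_space (mtop A) \<and> second_countable (mtop A)"

definition maximal_atlas :: "('p, 'v::fd_inner) atlas \<Rightarrow> ('p, 'v) atlas" where
  "maximal_atlas A = {(U, c). U \<subseteq> pts A \<and> smooth_atlas (insert (U, c) A)}"

definition vec_atlas :: "('v::fd_inner, 'v) atlas" where
  "vec_atlas = {(UNIV, id)}"

definition prod_atlas :: "('p, 'v) atlas \<Rightarrow> ('q, 'w) atlas \<Rightarrow> ('p \<times> 'q, 'v \<times> 'w) atlas" where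
  "prod_atlas A B = {(U \<times> V, map_prod c d) | U c V d. (U, c) \<in> A \<and> (V, d) \<in> B}"

definition open_sub :: "('p, 'v) atlas \<Rightarrow> 'p set \<Rightarrow> ('p, 'v) atlas" where
  "open_sub A W = {(U \<inter> W, c) | U c. (U, c) \<in> A}"

text \<open>Openness of the sets \<open>c ` (U \<inter> f -` V)\<close> expresses continuity; it has to be stated since the given
  atlases need not contain restrictions of their charts.\<close>

definition smooth_map ::
  "('p, 'v::fd_inner) atlas \<Rightarrow> ('q, 'w::fd_inner) atlas \<Rightarrow> ('p \<Rightarrow> 'q) \<Rightarrow> bool" where
  "smooth_map A B f \<longleftrightarrow> f ` pts A \<subseteq> pts B \<and>
     (\<forall>(U, c)\<in>A. \<forall>(V, d)\<in>B. open (c ` (U \<inter> f -` V)) \<and>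
        Cinf_on (c ` (U \<inter> f -` V)) (d \<circ> f \<circ> inv_into U c))"

definition diffeo ::
  "('p, 'v::fd_inner) atlas \<Rightarrow> ('q, 'w::fd_inner) atlas \<Rightarrow> ('p \<Rightarrow> 'q) \<Rightarrow> bool" where
  "diffeo A B f \<longleftrightarrow> bij_betw f (pts A) (pts B) \<and> smooth_map A B f \<and>
     smooth_map B A (inv_into (pts A) f)"

text \<open>Submersions are the smooth maps with a smooth local section through every point of the domain; by the
  rank theorem this amounts to surjectivity of the differentials.\<close>

definition submersion ::
  "('p, 'v::fd_inner) atlas \<Rightarrow> ('q, 'w::fd_inner) atlas \<Rightarrow> ('p \<Rightarrow> 'q) \<Rightarrow> bool" where
  "submersion A B f \<longleftrightarrow> smooth_map A B f \<and>
     (\<forall>x\<in>pts A. \<exists>W s. openin (mtop B) W \<and> f x \<in> W \<and> smooth_map (open_sub B W) A s \<and>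
        s (f x) = x \<and> (\<forall>y\<in>W. f (s y) = y))"

definition embedded_submanifold :: "('p, 'v::fd_inner) atlas \<Rightarrow> 'p set \<Rightarrow> bool" where
  "embedded_submanifold A S \<longleftrightarrow> S \<subseteq> pts A \<and>
     (\<forall>p\<in>S. \<exists>(U, c)\<in>maximal_atlas A. \<exists>L. p \<in> U \<and> subspace L \<and> c ` (U \<inter> S) = c ` U \<inter> L)"

text \<open>Smoothness of a map defined on an embedded submanifold \<open>S\<close>, by local smooth extension.\<close>

definition smooth_on_sub ::
  "('p, 'v::fd_inner) atlas \<Rightarrow> 'p set \<Rightarrow> ('q, 'w::fd_inner) atlas \<Rightarrow> ('p \<Rightarrow> 'q) \<Rightarrow> bool" where
  "smooth_on_sub A S B f \<longleftrightarrow>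
     (\<forall>p\<in>S. \<exists>W h. openin (mtop A) W \<and> p \<in> W \<and> smooth_map (open_sub A W) B h \<and>
        (\<forall>x\<in>S \<inter> W. h x = f x))"

text \<open>For an embedded submanifold \<open>S\<close> of \<open>A\<close>, a map into \<open>S\<close> is smooth iff it is smooth into \<open>A\<close>.\<close>

definition local_diffeo_on_sub ::
  "('p, 'v::fd_inner) atlas \<Rightarrow> 'p set \<Rightarrow> ('q, 'w::fd_inner) atlas \<Rightarrow> ('p \<Rightarrow> 'q) \<Rightarrow> bool" where
  "local_diffeo_on_sub A S B f \<longleftrightarrow> smooth_on_sub A S B f \<and>
     (\<forall>x\<in>S. \<exists>W. openin (mtop A) W \<and> x \<in> W \<and> inj_on f (S \<inter> W) \<and> openin (mtop B) (f ` (S \<inter> W)) \<and>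
        smooth_map (open_sub B (f ` (S \<inter> W))) A (inv_into (S \<inter> W) f))"


section \<open>Tangent vectors\<close>

text \<open>A tangent vector at \<open>p\<close> is the operator \<open>f \<mapsto> (f \<circ> \<gamma>)'(0)\<close> on smooth functions given by a smooth curve
  \<open>\<gamma>\<close> through \<open>p\<close>; it is set to \<open>0\<close> on functions that are not smooth, so that the operators have a
  unique representation. On a manifold (Hausdorff, second countable) the globally defined smooth
  functions separate the velocities of curves. The vector space operations are pointwise.\<close>

type_synonym 'p tvec = "('p \<Rightarrow> real) \<Rightarrow> real"

definition Cinf :: "('p, 'v::fd_inner) atlas \<Rightarrow> ('p \<Rightarrow> real) set" where
  "Cinf A = {f. smooth_map A (vec_atlas :: (real, real) atlas) f}"

definition tangent :: "('p, 'v::fd_inner) atlas \<Rightarrow> 'p \<Rightarrow> 'p tvec set" where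
  "tangent A p = {X. \<exists>\<gamma> a. 0 < a \<and>
     smooth_map (open_sub (vec_atlas :: (real, real) atlas) {-a<..<a}) A \<gamma> \<and> \<gamma> 0 = p \<and>
     X = (\<lambda>f. if f \<in> Cinf A then deriv (\<lambda>s. f (\<gamma> s)) 0 else 0)}"

definition tzero :: "'p tvec" where
  "tzero = (\<lambda>f. 0)"

definition tadd :: "'p tvec \<Rightarrow> 'p tvec \<Rightarrow> 'p tvec" where
  "tadd X Y = (\<lambda>f. X f + Y f)"

definition tscale :: "real \<Rightarrow> 'p tvec \<Rightarrow> 'p tvec" where
  "tscale a X = (\<lambda>f. a * X f)"

text \<open>The differential of a smooth map from a manifold to the manifold \<open>B\<close>.\<close>

definition tmap :: "('q, 'w::fd_inner) atlas \<Rightarrow> ('p \<Rightarrow> 'q) \<Rightarrow> 'p tvec \<Rightarrow> 'q tvec" where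
  "tmap B F X = (\<lambda>f. if f \<in> Cinf B then X (f \<circ> F) else 0)"

text \<open>The tangent vector \<open>(X, Y)\<close> of the product \<open>A \<times> B\<close> at the point \<open>(p, q)\<close>.\<close>

definition tpair :: "('p, 'v::fd_inner) atlas \<Rightarrow> ('q, 'w::fd_inner) atlas \<Rightarrow> 'p \<times> 'q \<Rightarrow>
    'p tvec \<Rightarrow> 'q tvec \<Rightarrow> ('p \<times> 'q) tvec" where
  "tpair A B z X Y = (\<lambda>f. if f \<in> Cinf (prod_atlas A B)
     then X (\<lambda>x. f (x, snd z)) + Y (\<lambda>y. f (fst z, y)) else 0)"


section \<open>Fiber bundles and discrete Lagrange--D'Alembert--Poincare systems\<close>

record ('e, 'ev, 'm, 'mv, 'f, 'fv) fbundle =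
  tot_atlas :: "('e, 'ev) atlas"
  base_atlas :: "('m, 'mv) atlas"
  fib_atlas :: "('f, 'fv) atlas"
  bproj :: "'e \<Rightarrow> 'm"

definition local_trivialization ::
  "('e, 'ev::fd_inner, 'm, 'mv::fd_inner, 'f, 'fv::fd_inner, 'z) fbundle_scheme \<Rightarrow>
     'm set \<Rightarrow> ('e \<Rightarrow> 'm \<times> 'f) \<Rightarrow> bool" where
  "local_trivialization S U \<Phi> \<longleftrightarrow> openin (mtop (base_atlas S)) U \<and>
     diffeo (open_sub (tot_atlas S) (bproj S -` U))
       (prod_atlas (open_sub (base_atlas S) U) (fib_atlas S)) \<Phi> \<and>
     (\<forall>x\<in>pts (tot_atlas S). bproj S x \<in> U \<longrightarrow> fst (\<Phi> x) = bproj S x)"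

definition fiber_bundle ::
  "('e, 'ev::fd_inner, 'm, 'mv::fd_inner, 'f, 'fv::fd_inner, 'z) fbundle_scheme \<Rightarrow> bool" where
  "fiber_bundle S \<longleftrightarrow> manifold (tot_atlas S) \<and> manifold (base_atlas S) \<and> manifold (fib_atlas S) \<and>
     smooth_map (tot_atlas S) (base_atlas S) (bproj S) \<and>
     bproj S ` pts (tot_atlas S) = pts (base_atlas S) \<and>
     (\<forall>m\<in>pts (base_atlas S). \<exists>U \<Phi>. m \<in> U \<and> local_trivialization S U \<Phi>)"

definition C1_atlas ::
  "('e, 'ev, 'm, 'mv, 'f, 'fv, 'z) fbundle_scheme \<Rightarrow> ('e \<times> 'm, 'ev \<times> 'mv) atlas" where
  "C1_atlas S = prod_atlas (tot_atlas S) (base_atlas S)"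

definition C2_set ::
  "('e, 'ev, 'm, 'mv, 'f, 'fv, 'z) fbundle_scheme \<Rightarrow> (('e \<times> 'm) \<times> ('e \<times> 'm)) set" where
  "C2_set S = {(x, y). x \<in> pts (C1_atlas S) \<and> y \<in> pts (C1_atlas S) \<and> bproj S (fst y) = snd x}"

abbreviation C1_pair ::
  "('e, 'ev::fd_inner, 'm, 'mv::fd_inner, 'f, 'fv, 'z) fbundle_scheme \<Rightarrow> 'e \<times> 'm \<Rightarrow>
     'e tvec \<Rightarrow> 'm tvec \<Rightarrow> ('e \<times> 'm) tvec" where
  "C1_pair S \<equiv> tpair (tot_atlas S) (base_atlas S)"

text \<open>The fibre of \<open>p\<^sub>1\<^sup>* TE\<close> at \<open>(\<epsilon>, m)\<close> is identified with the tangent space of \<open>E\<close> at \<open>\<epsilon>\<close>: the vector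
  \<open>(\<delta>\<epsilon>, 0)\<close> is represented by \<open>\<delta>\<epsilon>\<close>, in the fields \<open>var\<close> (the subbundle \<open>\<D>\<close>) and \<open>corr\<close>
  (the homomorphism \<open>\<P>\<close>).\<close>

record ('e, 'ev, 'm, 'mv, 'f, 'fv) dldps = "('e, 'ev, 'm, 'mv, 'f, 'fv) fbundle" +
  lagr :: "'e \<times> 'm \<Rightarrow> real"
  kin :: "('e \<times> 'm) set"
  var :: "'e \<times> 'm \<Rightarrow> 'e tvec set"
  corr :: "'e \<times> 'm \<Rightarrow> 'e \<times> 'm \<Rightarrow> 'e tvec \<Rightarrow> 'e tvec"

definition smooth_section_pTE ::
  "('e, 'ev::fd_inner, 'm, 'mv::fd_inner, 'f, 'fv, 'z) fbundle_scheme \<Rightarrow> ('e \<times> 'm) set \<Rightarrow>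
     ('e \<times> 'm \<Rightarrow> 'e tvec) \<Rightarrow> bool" where
  "smooth_section_pTE S W X \<longleftrightarrow>
     (\<forall>x\<in>W. X x \<in> tangent (tot_atlas S) (fst x)) \<and>
     (\<forall>f\<in>Cinf (tot_atlas S).
        smooth_map (open_sub (C1_atlas S) W) (vec_atlas :: (real, real) atlas) (\<lambda>x. X x f))"

definition vector_subbundle_pTE ::
  "('e, 'ev::fd_inner, 'm, 'mv::fd_inner, 'f, 'fv, 'z) fbundle_scheme \<Rightarrow>
     ('e \<times> 'm \<Rightarrow> 'e tvec set) \<Rightarrow> bool" where
  "vector_subbundle_pTE S D \<longleftrightarrow>
     (\<forall>z\<in>pts (C1_atlas S). \<exists>W r X. openin (mtop (C1_atlas S)) W \<and> z \<in> W \<and>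
        (\<forall>i<(r::nat). smooth_section_pTE S W (X i)) \<and>
        (\<forall>x\<in>W. D x = {\<lambda>f. \<Sum>i<r. a i * X i x f | a. True} \<and>
           (\<forall>a. (\<lambda>f. \<Sum>i<r. a i * X i x f) = tzero \<longrightarrow> (\<forall>i<r. a i = 0))))"

text \<open>Smoothness of \<open>\<P>\<close> is expressed by its action on smooth local sections \<open>X\<close> of \<open>\<D>\<close>: the section
  \<open>(x, y) \<mapsto> \<P>(x, y)(X y)\<close> along \<open>C''(E)\<close> is smooth.\<close>

definition is_dldps ::
  "('e, 'ev::fd_inner, 'm, 'mv::fd_inner, 'f, 'fv::fd_inner) dldps \<Rightarrow> bool" where
  "is_dldps S \<longleftrightarrow> fiber_bundle S \<and>
     smooth_map (C1_atlas S) (vec_atlas :: (real, real) atlas) (lagr S) \<and>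
     embedded_submanifold (C1_atlas S) (kin S) \<and>
     vector_subbundle_pTE S (var S) \<and>
     (\<forall>(x, y)\<in>C2_set S.
        (\<forall>u\<in>var S y. corr S x y u \<in> tangent (tot_atlas S) (fst x) \<and>
           tmap (base_atlas S) (bproj S) (corr S x y u) = tzero) \<and>
        (\<forall>u\<in>var S y. \<forall>w\<in>var S y. \<forall>a b. corr S x y (tadd (tscale a u) (tscale b w)) =
           tadd (tscale a (corr S x y u)) (tscale b (corr S x y w)))) \<and>
     (\<forall>W X. openin (mtop (C1_atlas S)) W \<and> smooth_section_pTE S W X \<and> (\<forall>y\<in>W. X y \<in> var S y) \<longrightarrow>
        (\<forall>f\<in>Cinf (tot_atlas S). smooth_on_sub (prod_atlas (C1_atlas S) (C1_atlas S))
           (C2_set S \<inter> UNIV \<times> W) (vec_atlas :: (real, real) atlas) (\<lambda>(x, y). corr S x y (X y) f)))"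

text \<open>A path \<open>xs\<close> of length \<open>N\<close> is the list of the pairs \<open>xs ! k = (\<epsilon>\<^sub>k, m\<^sub>k\<^sub>+\<^sub>1)\<close>.\<close>

definition discrete_path ::
  "('e, 'ev, 'm, 'mv, 'f, 'fv, 'z) fbundle_scheme \<Rightarrow> ('e \<times> 'm) list \<Rightarrow> bool" where
  "discrete_path S xs \<longleftrightarrow> 2 \<le> length xs \<and> set xs \<subseteq> pts (C1_atlas S) \<and>
     (\<forall>k\<in>{1..<length xs}. bproj S (fst (xs ! k)) = snd (xs ! (k - 1)))"

text \<open>Tangent vectors of \<open>C'(E)\<^sup>N\<close> at \<open>xs\<close> are represented by the components \<open>\<delta>\<epsilon> k\<close>, \<open>k = 0, \<dots>, N - 1\<close>, and
  \<open>\<delta>m k\<close>, \<open>k = 1, \<dots>, N\<close>; the auxiliary vectors \<open>\<eta> k\<close> are those written with a tilde over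
  \<open>\<delta>\<epsilon>\<^sub>k\<close>.\<close>

definition inf_variation ::
  "('e, 'ev::fd_inner, 'm, 'mv::fd_inner, 'f, 'fv) dldps \<Rightarrow> ('e \<times> 'm) list \<Rightarrow>
     (nat \<Rightarrow> 'e tvec) \<Rightarrow> (nat \<Rightarrow> 'm tvec) \<Rightarrow> bool" where
  "inf_variation S xs \<delta>\<epsilon> \<delta>m \<longleftrightarrow> (let N = length xs in
     (\<forall>k<N. \<delta>\<epsilon> k \<in> tangent (tot_atlas S) (fst (xs ! k)) \<and>
            \<delta>m (k + 1) \<in> tangent (base_atlas S) (snd (xs ! k))) \<and>
     (\<forall>k\<in>{1..N - 1}. \<delta>m k = tmap (base_atlas S) (bproj S) (\<delta>\<epsilon> k)) \<and>
     \<delta>m N = tzero \<and>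
     (\<exists>\<eta>. (\<forall>k\<in>{1..N - 1}. \<eta> k \<in> var S (xs ! k)) \<and>
        \<delta>\<epsilon> (N - 1) = \<eta> (N - 1) \<and>
        (\<forall>k\<in>{1..N - 2}. \<delta>\<epsilon> k = tadd (\<eta> k) (corr S (xs ! k) (xs ! (k + 1)) (\<eta> (k + 1)))) \<and>
        \<delta>\<epsilon> 0 = corr S (xs ! 0) (xs ! 1) (\<eta> 1)))"

definition discrete_action ::
  "('e, 'ev, 'm, 'mv, 'f, 'fv) dldps \<Rightarrow> ('e \<times> 'm) list \<Rightarrow> real" where
  "discrete_action S xs = (\<Sum>k<length xs. lagr S (xs ! k))"

text \<open>The differential of the action on \<open>C'(E)\<^sup>N\<close>: under the identification of the tangent space of a
  product with the product of the tangent spaces (as in \<open>tpair\<close>), the \<open>k\<close>-th component of the tangent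
  vector differentiates in the \<open>k\<close>-th argument.\<close>

definition d_action ::
  "('e, 'ev::fd_inner, 'm, 'mv::fd_inner, 'f, 'fv) dldps \<Rightarrow> ('e \<times> 'm) list \<Rightarrow>
     (nat \<Rightarrow> 'e tvec) \<Rightarrow> (nat \<Rightarrow> 'm tvec) \<Rightarrow> real" where
  "d_action S xs \<delta>\<epsilon> \<delta>m = (\<Sum>k<length xs.
     C1_pair S (xs ! k) (\<delta>\<epsilon> k) (\<delta>m (k + 1)) (\<lambda>y. discrete_action S (xs[k := y])))"

definition trajectory ::
  "('e, 'ev::fd_inner, 'm, 'mv::fd_inner, 'f, 'fv) dldps \<Rightarrow> ('e \<times> 'm) list \<Rightarrow> bool" where
  "trajectory S xs \<longleftrightarrow> discrete_path S xs \<and> set xs \<subseteq> kin S \<and>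
     (\<forall>\<delta>\<epsilon> \<delta>m. inf_variation S xs \<delta>\<epsilon> \<delta>m \<longrightarrow> d_action S xs \<delta>\<epsilon> \<delta>m = 0)"


section \<open>Symmetries\<close>

record ('g, 'gv) lie = "'g monoid" +
  grp_atlas :: "('g, 'gv) atlas"

definition lie_group :: "('g, 'gv::fd_inner) lie \<Rightarrow> bool" where
  "lie_group G \<longleftrightarrow> group G \<and> manifold (grp_atlas G) \<and> pts (grp_atlas G) = carrier G \<and>
     smooth_map (prod_atlas (grp_atlas G) (grp_atlas G)) (grp_atlas G) (\<lambda>(g, h). g \<otimes>\<^bsub>G\<^esub> h) \<and>
     smooth_map (grp_atlas G) (grp_atlas G) (\<lambda>g. inv\<^bsub>G\<^esub> g)"

definition left_action ::
  "('g, 'gv::fd_inner) lie \<Rightarrow> ('x, 'v::fd_inner) atlas \<Rightarrow> ('g \<Rightarrow> 'x \<Rightarrow> 'x) \<Rightarrow> bool" where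
  "left_action G X act \<longleftrightarrow>
     smooth_map (prod_atlas (grp_atlas G) X) X (\<lambda>(g, x). act g x) \<and>
     (\<forall>x\<in>pts X. act \<one>\<^bsub>G\<^esub> x = x) \<and>
     (\<forall>g\<in>carrier G. \<forall>h\<in>carrier G. \<forall>x\<in>pts X. act (g \<otimes>\<^bsub>G\<^esub> h) x = act g (act h x))"

definition right_action ::
  "('g, 'gv::fd_inner) lie \<Rightarrow> ('x, 'v::fd_inner) atlas \<Rightarrow> ('x \<Rightarrow> 'g \<Rightarrow> 'x) \<Rightarrow> bool" where
  "right_action G X act \<longleftrightarrow>
     smooth_map (prod_atlas X (grp_atlas G)) X (\<lambda>(x, g). act x g) \<and>
     (\<forall>x\<in>pts X. act x \<one>\<^bsub>G\<^esub> = x) \<and>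
     (\<forall>g\<in>carrier G. \<forall>h\<in>carrier G. \<forall>x\<in>pts X. act x (g \<otimes>\<^bsub>G\<^esub> h) = act (act x g) h)"

definition free_action ::
  "('g, 'gv) lie \<Rightarrow> ('x, 'v) atlas \<Rightarrow> ('g \<Rightarrow> 'x \<Rightarrow> 'x) \<Rightarrow> bool" where
  "free_action G X act \<longleftrightarrow> (\<forall>g\<in>carrier G. \<forall>x\<in>pts X. act g x = x \<longrightarrow> g = \<one>\<^bsub>G\<^esub>)"

text \<open>The quotient \<open>X/G\<close> is the set of orbits, \<^term>\<open>orbit G act\<close> is the quotient map, and \<open>Q\<close> is an
  atlas of the quotient manifold.\<close>

definition principal_bundle ::
  "('g, 'gv::fd_inner) lie \<Rightarrow> ('x, 'v::fd_inner) atlas \<Rightarrow> ('g \<Rightarrow> 'x \<Rightarrow> 'x) \<Rightarrow>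
     ('x set, 'w::fd_inner) atlas \<Rightarrow> bool" where
  "principal_bundle G X act Q \<longleftrightarrow> lie_group G \<and> manifold X \<and> left_action G X act \<and> manifold Q \<and>
     pts Q = orbits G (pts X) act \<and> smooth_map X Q (orbit G act) \<and>
     (\<forall>q\<in>pts Q. \<exists>V \<psi>. openin (mtop Q) V \<and> q \<in> V \<and>
        diffeo (open_sub X (orbit G act -` V)) (prod_atlas (open_sub Q V) (grp_atlas G)) \<psi> \<and>
        (\<forall>x\<in>pts X. orbit G act x \<in> V \<longrightarrow> fst (\<psi> x) = orbit G act x \<and>
           (\<forall>g\<in>carrier G. snd (\<psi> (act g x)) = g \<otimes>\<^bsub>G\<^esub> snd (\<psi> x))))"

text \<open>The maximal atlas of the quotient manifold \<open>X/G\<close>, whose smooth structure is the one making the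
  quotient map a submersion: its charts are the bijections \<open>c\<close> of subsets of \<open>X/G\<close> with open sets for
  which the composition with the quotient map is a submersion.\<close>

definition quotient_atlas ::
  "('g, 'gv::fd_inner) lie \<Rightarrow> ('x, 'v::fd_inner) atlas \<Rightarrow> ('g \<Rightarrow> 'x \<Rightarrow> 'x) \<Rightarrow>
     ('x set, 'w::fd_inner) atlas" where
  "quotient_atlas G X act = {(U, c). U \<subseteq> orbits G (pts X) act \<and> inj_on c U \<and> open (c ` U) \<and>
     openin (mtop X) (pts X \<inter> orbit G act -` U) \<and>
     submersion (open_sub X (orbit G act -` U)) (open_sub vec_atlas (c ` U)) (c \<circ> orbit G act)}"

definition acts_on_bundle ::
  "('g, 'gv::fd_inner) lie \<Rightarrow> ('g \<Rightarrow> 'e \<Rightarrow> 'e) \<Rightarrow> ('g \<Rightarrow> 'm \<Rightarrow> 'm) \<Rightarrow> ('f \<Rightarrow> 'g \<Rightarrow> 'f) \<Rightarrow>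
     ('m set, 'qv::fd_inner) atlas \<Rightarrow>
     ('e, 'ev::fd_inner, 'm, 'mv::fd_inner, 'f, 'fv::fd_inner, 'z) fbundle_scheme \<Rightarrow> bool" where
  "acts_on_bundle G actE actM actF Q S \<longleftrightarrow> lie_group G \<and> fiber_bundle S \<and>
     left_action G (tot_atlas S) actE \<and> free_action G (tot_atlas S) actE \<and>
     left_action G (base_atlas S) actM \<and> free_action G (base_atlas S) actM \<and>
     right_action G (fib_atlas S) actF \<and>
     principal_bundle G (base_atlas S) actM Q \<and>
     (\<forall>g\<in>carrier G. \<forall>x\<in>pts (tot_atlas S). bproj S (actE g x) = actM g (bproj S x)) \<and>
     (\<forall>m\<in>pts (base_atlas S). \<exists>U \<Phi>. m \<in> U \<and> local_trivialization S U \<Phi> \<and>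
        (\<forall>g\<in>carrier G. actM g ` U \<subseteq> U) \<and>
        (\<forall>g\<in>carrier G. \<forall>x\<in>pts (tot_atlas S). bproj S x \<in> U \<longrightarrow>
           \<Phi> (actE g x) = (actM g (fst (\<Phi> x)), actF (snd (\<Phi> x)) (inv\<^bsub>G\<^esub> g))))"

definition diag :: "('g \<Rightarrow> 'x \<Rightarrow> 'x) \<Rightarrow> ('g \<Rightarrow> 'y \<Rightarrow> 'y) \<Rightarrow> 'g \<Rightarrow> 'x \<times> 'y \<Rightarrow> 'x \<times> 'y" where
  "diag actX actY g = map_prod (actX g) (actY g)"

definition symmetry_group ::
  "('g, 'gv::fd_inner) lie \<Rightarrow> ('g \<Rightarrow> 'e \<Rightarrow> 'e) \<Rightarrow> ('g \<Rightarrow> 'm \<Rightarrow> 'm) \<Rightarrow> ('f \<Rightarrow> 'g \<Rightarrow> 'f) \<Rightarrow>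
     ('m set, 'qv::fd_inner) atlas \<Rightarrow>
     ('e, 'ev::fd_inner, 'm, 'mv::fd_inner, 'f, 'fv::fd_inner) dldps \<Rightarrow> bool" where
  "symmetry_group G actE actM actF Q S \<longleftrightarrow> acts_on_bundle G actE actM actF Q S \<and>
     (\<forall>g\<in>carrier G.
        (\<forall>x\<in>pts (C1_atlas S). lagr S (diag actE actM g x) = lagr S x) \<and>
        diag actE actM g ` kin S \<subseteq> kin S \<and>
        (\<forall>x\<in>pts (C1_atlas S).
           tmap (tot_atlas S) (actE g) ` var S x = var S (diag actE actM g x)) \<and>
        (\<forall>(x, y)\<in>C2_set S. \<forall>u\<in>var S y.
           corr S (diag actE actM g x) (diag actE actM g y) (tmap (tot_atlas S) (actE g) u) =
           tmap (tot_atlas S) (actE g) (corr S x y u)))"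


section \<open>Discrete connections\<close>

text \<open>The last condition says that the domain is all of \<open>M \<times> M\<close>.\<close>

definition discrete_connection ::
  "('g, 'gv::fd_inner) lie \<Rightarrow> ('m, 'mv::fd_inner) atlas \<Rightarrow> ('g \<Rightarrow> 'm \<Rightarrow> 'm) \<Rightarrow>
     ('m set, 'qv::fd_inner) atlas \<Rightarrow> ('m \<times> 'm) set \<Rightarrow> bool" where
  "discrete_connection G M actM Q Hor \<longleftrightarrow> principal_bundle G M actM Q \<and>
     embedded_submanifold (prod_atlas M M) Hor \<and>
     (\<forall>g\<in>carrier G. diag actM actM g ` Hor \<subseteq> Hor) \<and>
     (\<exists>\<gamma>. smooth_map M (grp_atlas G) \<gamma> \<and>
        (\<forall>g\<in>carrier G. \<forall>m\<in>pts M. \<gamma> (actM g m) = g \<otimes>\<^bsub>G\<^esub> \<gamma> m \<otimes>\<^bsub>G\<^esub> inv\<^bsub>G\<^esub> g) \<and>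
        (\<forall>m\<in>pts M. (m, actM (\<gamma> m) m) \<in> Hor)) \<and>
     inj_on (map_prod id (orbit G actM)) Hor \<and>
     local_diffeo_on_sub (prod_atlas M M) Hor (prod_atlas M Q) (map_prod id (orbit G actM)) \<and>
     {(m\<^sub>0, actM g m\<^sub>1) | m\<^sub>0 m\<^sub>1 g. (m\<^sub>0, m\<^sub>1) \<in> Hor \<and> g \<in> carrier G} = pts M \<times> pts M"

definition conn_form ::
  "('g, 'gv) lie \<Rightarrow> ('g \<Rightarrow> 'm \<Rightarrow> 'm) \<Rightarrow> ('m \<times> 'm) set \<Rightarrow> 'm \<Rightarrow> 'm \<Rightarrow> 'g" where
  "conn_form G actM Hor m\<^sub>0 m\<^sub>1 = (THE g. g \<in> carrier G \<and> (m\<^sub>0, actM (inv\<^bsub>G\<^esub> g) m\<^sub>1) \<in> Hor)"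


section \<open>The reduced system\<close>

definition EG_action ::
  "('g, 'gv) lie \<Rightarrow> ('g \<Rightarrow> 'e \<Rightarrow> 'e) \<Rightarrow> 'g \<Rightarrow> 'e \<times> 'g \<Rightarrow> 'e \<times> 'g" where
  "EG_action G actE g = (\<lambda>(e, w). (actE g e, g \<otimes>\<^bsub>G\<^esub> w \<otimes>\<^bsub>G\<^esub> inv\<^bsub>G\<^esub> g))"

definition Upsilon ::
  "('g, 'gv) lie \<Rightarrow> ('g \<Rightarrow> 'e \<Rightarrow> 'e) \<Rightarrow> ('g \<Rightarrow> 'm \<Rightarrow> 'm) \<Rightarrow> ('m \<times> 'm) set \<Rightarrow>
     ('e, 'ev, 'm, 'mv, 'f, 'fv, 'z) fbundle_scheme \<Rightarrow> 'e \<times> 'm \<Rightarrow> ('e \<times> 'g) set \<times> 'm set" where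
  "Upsilon G actE actM Hor S = (\<lambda>(e, m).
     (orbit G (EG_action G actE) (e, conn_form G actM Hor (bproj S e) m), orbit G actM m))"

text \<open>The bundle \<open>(E \<times> G)/G\<close> over \<open>M/G\<close> has fibre \<open>F\<^sub>0 \<times> G\<close>, hence the model space of its total space.\<close>

definition reduced_bundle ::
  "('g, 'gv::fd_inner) lie \<Rightarrow> ('g \<Rightarrow> 'e \<Rightarrow> 'e) \<Rightarrow> ('g \<Rightarrow> 'm \<Rightarrow> 'm) \<Rightarrow> ('m set, 'qv::fd_inner) atlas \<Rightarrow>
     ('e, 'ev::fd_inner, 'm, 'mv::fd_inner, 'f, 'fv::fd_inner, 'z) fbundle_scheme \<Rightarrow>
     (('e \<times> 'g) set, 'qv \<times> 'fv \<times> 'gv, 'm set, 'qv, 'f \<times> 'g, 'fv \<times> 'gv) fbundle" where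
  "reduced_bundle G actE actM Q S = \<lparr>
     tot_atlas = quotient_atlas G (prod_atlas (tot_atlas S) (grp_atlas G)) (EG_action G actE),
     base_atlas = Q,
     fib_atlas = prod_atlas (fib_atlas S) (grp_atlas G),
     bproj = (\<lambda>v. the_elem ((\<lambda>(e, w). orbit G actM (bproj S e)) ` v)) \<rparr>"

text \<open>The Lagrangian and the homomorphism of the reduced system are defined by lifting along \<open>\<Upsilon>\<close>; the
  invariance of the data makes this independent of the lifts.\<close>

definition reduced_system ::
  "('g, 'gv::fd_inner) lie \<Rightarrow> ('g \<Rightarrow> 'e \<Rightarrow> 'e) \<Rightarrow> ('g \<Rightarrow> 'm \<Rightarrow> 'm) \<Rightarrow> ('m set, 'qv::fd_inner) atlas \<Rightarrow>
     ('m \<times> 'm) set \<Rightarrow> ('e, 'ev::fd_inner, 'm, 'mv::fd_inner, 'f, 'fv::fd_inner) dldps \<Rightarrow>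
     (('e \<times> 'g) set, 'qv \<times> 'fv \<times> 'gv, 'm set, 'qv, 'f \<times> 'g, 'fv \<times> 'gv) dldps" where
  "reduced_system G actE actM Q Hor S = (let
     R = reduced_bundle G actE actM Q S;
     \<Upsilon> = Upsilon G actE actM Hor S;
     d\<Upsilon> = tmap (C1_atlas R) \<Upsilon>
   in fbundle.extend R \<lparr>
     lagr = (\<lambda>x'. lagr S (inv_into (pts (C1_atlas S)) \<Upsilon> x')),
     kin = \<Upsilon> ` kin S,
     var = (\<lambda>x'. {\<delta>v. \<exists>x\<in>pts (C1_atlas S). \<exists>\<delta>\<epsilon>\<in>var S x. \<Upsilon> x = x' \<and>
        \<delta>v \<in> tangent (tot_atlas R) (fst x') \<and>
        C1_pair R x' \<delta>v tzero = d\<Upsilon> (C1_pair S x \<delta>\<epsilon> tzero)}),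
     corr = (\<lambda>x' y' \<delta>v. THE \<delta>u. \<exists>x y \<delta>\<epsilon>. (x, y) \<in> C2_set S \<and> \<Upsilon> x = x' \<and> \<Upsilon> y = y' \<and>
        \<delta>\<epsilon> \<in> var S y \<and> d\<Upsilon> (C1_pair S y \<delta>\<epsilon> tzero) = C1_pair R y' \<delta>v tzero \<and>
        \<delta>u = tmap (tot_atlas R) (fst \<circ> \<Upsilon>)
               (C1_pair S x (corr S x y \<delta>\<epsilon>) (tmap (base_atlas S) (bproj S) \<delta>\<epsilon>))) \<rparr>)"

end

theory Submission
  imports Defs "HOL-Computational_Algebra.Polynomial"
begin

text \<open>Two points of \<open>C'(E)\<close> have the same image under \<open>\<Upsilon>\<close> iff they lie in one \<open>G\<close>-orbit, and \<open>G\<close> acts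
  freely on \<open>M\<close>; the matching condition \<open>\<phi>(\<epsilon>\<^sub>k) = m\<^sub>k\<close> therefore determines the lift of a path one step
  after the other. The lift is a trajectory because \<open>d\<Upsilon>\<close> maps variations of the lift to variations of
  the reduced path and the reduced action pulls back to the action. The reduced homomorphism is
  defined through lifts of vectors, so this needs the injectivity of \<open>d\<Upsilon>\<close> on the vectors \<open>(\<delta>\<epsilon>, 0)\<close>.
  As tangent vectors are operators on globally defined smooth functions, injectivity amounts to
  extending functions from a slice \<open>E \<times> {m}\<close> to smooth invariant functions on \<open>C'(E)\<close>, and the pullback of
  the action requires that smooth invariant functions descend along \<open>\<Upsilon>\<close>.\<close>

section \<open>Calculus of smooth functions\<close>

text \<open>The total space of the reduced system carries the atlas of all charts of
  \<open>(E \<times> G)/G\<close> for which the projection is a submersion. Compatibility of these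
  charts follows from the definition, but that they cover the quotient does not; around an uncovered
  orbit the smooth functions and tangent vectors of the reduced system would be meaningless. A chart
  around each orbit is therefore constructed: acting by the inverse of the group coordinate \<gamma>
  of a trivialization of \<open>M \<rightarrow> M/G\<close> moves \<open>(e, w)\<close> to the slice
  \<gamma> = 1, where a trivialization of \<open>E\<close> supplies coordinates.

  Smoothness and local sections of \<Upsilon> both rest on the horizontal lift, the inverse of the
  map from \<open>Hor\<close> to \<open>M \<times> M/G\<close>.

  Atlases need not be maximal, so smoothness is handled at points, with neighbourhood filters in
  place of restricted charts. Differentials are computed on velocities, where they become
  compositions with curves; closure of tangent vectors under linear combinations, needed because the
  fibres of \<D> are spans of local sections, is read off in a chart instead.\<close>

lemma fd_basis:
  obtains B :: "'v::fd_inner set" where "finite B" "\<And>x. x = (\<Sum>b\<in>B. inner x b *\<^sub>R b)"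
proof -
  obtain B :: "'v set" where B: "finite B"
      "\<And>u v. u \<in> B \<Longrightarrow> v \<in> B \<Longrightarrow> inner u v = (if u = v then 1 else 0)"
      "\<And>x. (\<forall>u\<in>B. inner x u = 0) \<longleftrightarrow> x = 0"
    using orthonormal_basis_ex[where 'a='v] by auto
  have "x = (\<Sum>b\<in>B. inner x b *\<^sub>R b)" for x
  proof -
    have "inner (x - (\<Sum>b\<in>B. inner x b *\<^sub>R b)) u = 0" if "u \<in> B" for u
    proof -
      have "(\<Sum>b\<in>B. inner x b * inner b u) = (\<Sum>b\<in>B. if b = u then inner x b else 0)"
        using B(2) that by (intro sum.cong) auto
      also have "\<dots> = inner x u" using B(1) that by simp
      finally show ?thesis by (simp add: inner_diff_left inner_sum_left)
    qed
    then have "x - (\<Sum>b\<in>B. inner x b *\<^sub>R b) = 0" using B(3) by blast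
    then show ?thesis by (rule eq_iff_diff_eq_0[THEN iffD2])
  qed
  with B(1) show ?thesis by (rule that)
qed

lemma Ck_on_cong:
  assumes "open S" "\<And>x. x \<in> S \<Longrightarrow> f x = g x"
  shows "Ck_on k S f \<longleftrightarrow> Ck_on k S g"
  using assms
proof (induction k arbitrary: f g)
  case 0
  then show ?case by (simp cong: continuous_on_cong)
next
  case (Suc k)
  have d: "f differentiable (at x) \<longleftrightarrow> g differentiable (at x)" if "x \<in> S" for x
    using Suc.prems that has_derivative_transform_within_open[of f _ x UNIV S g]
      has_derivative_transform_within_open[of g _ x UNIV S f]
    unfolding differentiable_def by auto
  show ?case
  proof (cases "\<forall>x\<in>S. f differentiable (at x)")
    case True
    have "Ck_on k S (\<lambda>x. frechet_derivative f (at x) v) \<longleftrightarrow>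
          Ck_on k S (\<lambda>x. frechet_derivative g (at x) v)" for v
      using True Suc.prems by (intro Suc.IH) (auto intro: frechet_derivative_transform_within_open[THEN fun_cong])
    with True d show ?thesis by simp
  qed (use d in auto)
qed

lemma Ck_on_SucI:
  assumes "open S" "\<And>x. x \<in> S \<Longrightarrow> (f has_derivative f' x) (at x)"
    and "\<And>v. Ck_on k S (\<lambda>x. f' x v)"
  shows "Ck_on (Suc k) S f"
proof -
  have "Ck_on k S (\<lambda>x. frechet_derivative f (at x) v)" for v
    using assms(3)[of v] frechet_derivative_at[OF assms(2)]
    by (subst Ck_on_cong[OF assms(1), where g="\<lambda>x. f' x v"]) auto
  with assms show ?thesis by (auto simp: differentiable_def)
qed

lemma Ck_on_SucD:
  assumes "Ck_on (Suc k) S f"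
  shows "x \<in> S \<Longrightarrow> (f has_derivative frechet_derivative f (at x)) (at x)"
    and "Ck_on k S (\<lambda>x. frechet_derivative f (at x) v)"
  using assms by (auto simp: frechet_derivative_works)

lemma Ck_on_subset: "Ck_on k S f \<Longrightarrow> T \<subseteq> S \<Longrightarrow> Ck_on k T f"
  by (induction k arbitrary: f) (auto intro: continuous_on_subset)

lemma Ck_on_Suc_imp: "Ck_on (Suc k) S f \<Longrightarrow> Ck_on k S f"
proof (induction k arbitrary: f)
  case 0
  then show ?case
    by (auto intro!: continuous_at_imp_continuous_on differentiable_imp_continuous_within)
next
  case (Suc k)
  from Suc.prems have "\<forall>x\<in>S. f differentiable at x"
    and "\<And>v. Ck_on (Suc k) S (\<lambda>x. frechet_derivative f (at x) v)"
    using Ck_on.simps(2) by blast+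
  with Suc.IH show ?case by simp
qed

lemma Ck_on_open_cover:
  assumes "\<And>x. x \<in> S \<Longrightarrow> \<exists>T. open T \<and> x \<in> T \<and> Ck_on k T f"
  shows "Ck_on k S f"
  using assms
proof (induction k arbitrary: f)
  case 0
  show ?case unfolding Ck_on.simps
  proof (rule continuous_at_imp_continuous_on, rule ballI)
    fix x assume "x \<in> S"
    with 0 obtain T where T: "open T" "x \<in> T" "continuous_on T f" unfolding Ck_on.simps by metis
    then show "isCont f x" by (simp add: continuous_on_eq_continuous_at)
  qed
next
  case (Suc k)
  have "f differentiable (at x)" if "x \<in> S" for x
    using Suc.prems[OF that] by auto
  moreover have "Ck_on k S (\<lambda>x. frechet_derivative f (at x) v)" for v
  proof (rule Suc.IH)
    show "\<exists>T. open T \<and> x \<in> T \<and> Ck_on k T (\<lambda>x. frechet_derivative f (at x) v)" if "x \<in> S" for x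
      using Suc.prems[OF that] by auto
  qed
  ultimately show ?case by simp
qed

lemma Ck_on_const: "Ck_on k S (\<lambda>x. c)"
  by (induction k arbitrary: c) auto

lemma Ck_on_bounded_linear:
  assumes "bounded_linear L" "open S" "Ck_on k S f"
  shows "Ck_on k S (\<lambda>x. L (f x))"
  using assms(3)
proof (induction k arbitrary: f)
  case 0
  then show ?case using assms(1) by (simp add: bounded_linear.continuous_on)
next
  case (Suc k)
  show ?case
  proof (rule Ck_on_SucI[OF assms(2)])
    show "((\<lambda>x. L (f x)) has_derivative (\<lambda>v. L (frechet_derivative f (at x) v))) (at x)"
      if "x \<in> S" for x
      using bounded_linear.has_derivative[OF assms(1) Ck_on_SucD(1)[OF Suc.prems that]] .
    show "Ck_on k S (\<lambda>x. L (frechet_derivative f (at x) v))" for v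
      using Suc.IH[OF Ck_on_SucD(2)[OF Suc.prems]] .
  qed
qed

lemma Ck_on_id: "Ck_on k S (\<lambda>x. x)"
proof (cases k)
  case (Suc n)
  then show ?thesis by (simp add: Ck_on_const)
qed simp

lemma Ck_on_Pair:
  assumes "open S" "Ck_on k S f" "Ck_on k S g"
  shows "Ck_on k S (\<lambda>x. (f x, g x))"
  using assms(2,3)
proof (induction k arbitrary: f g)
  case 0
  then show ?case by (simp add: continuous_on_Pair)
next
  case (Suc k)
  show ?case
  proof (rule Ck_on_SucI[OF assms(1)])
    show "((\<lambda>x. (f x, g x)) has_derivative
        (\<lambda>v. (frechet_derivative f (at x) v, frechet_derivative g (at x) v))) (at x)"
      if "x \<in> S" for x
      by (rule has_derivative_Pair[OF Ck_on_SucD(1)[OF Suc.prems(1) that] Ck_on_SucD(1)[OF Suc.prems(2) that]])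
    show "Ck_on k S (\<lambda>x. (frechet_derivative f (at x) v, frechet_derivative g (at x) v))" for v
      by (rule Suc.IH[OF Ck_on_SucD(2)[OF Suc.prems(1)] Ck_on_SucD(2)[OF Suc.prems(2)]])
  qed
qed

lemma Ck_on_add:
  assumes "open S" "Ck_on k S f" "Ck_on k S g"
  shows "Ck_on k S (\<lambda>x. f x + g x)"
  using Ck_on_bounded_linear[OF bounded_linear_add[OF bounded_linear_fst bounded_linear_snd] assms(1)
      Ck_on_Pair[OF assms]] by simp

lemma Ck_on_sum:
  assumes "open S" "\<And>i. i \<in> I \<Longrightarrow> Ck_on k S (f i)"
  shows "Ck_on k S (\<lambda>x. \<Sum>i\<in>I. f i x)"
  using assms(2) by (induction I rule: infinite_finite_induct) (auto simp: Ck_on_const Ck_on_add assms(1))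

lemma Ck_on_bilinear:
  fixes mul :: "'a::fd_inner \<Rightarrow> 'b::fd_inner \<Rightarrow> 'c::fd_inner"
  assumes "bounded_bilinear mul" "open S" "Ck_on k S f" "Ck_on k S g"
  shows "Ck_on k S (\<lambda>x. mul (f x) (g x))"
  using assms(3,4)
proof (induction k arbitrary: f g)
  case 0
  then show ?case by (simp add: bounded_bilinear.continuous_on[OF assms(1)])
next
  case (Suc k)
  show ?case
  proof (rule Ck_on_SucI[OF assms(2)])
    show "((\<lambda>x. mul (f x) (g x)) has_derivative
        (\<lambda>v. mul (f x) (frechet_derivative g (at x) v) + mul (frechet_derivative f (at x) v) (g x))) (at x)"
      if "x \<in> S" for x
      by (rule bounded_bilinear.FDERIV[OF assms(1) Ck_on_SucD(1)[OF Suc.prems(1) that] Ck_on_SucD(1)[OF Suc.prems(2) that]])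
    show "Ck_on k S (\<lambda>x. mul (f x) (frechet_derivative g (at x) v) + mul (frechet_derivative f (at x) v) (g x))" for v
      using Suc.prems by (intro Ck_on_add[OF assms(2)] Suc.IH Ck_on_SucD(2)) (auto intro: Ck_on_Suc_imp simp del: Ck_on.simps)
  qed
qed

text \<open>By the chain rule the derivative is \<open>?g (f x) (?f x v)\<close>, whose direction
  varies with \<open>x\<close>, whereas \<open>Ck_on\<close> controls \<open>?g\<close> only in
  fixed directions. Expanding \<open>?f x v\<close> in the basis \<open>B\<close> of the middle
  space gives a finite sum of products to which the induction hypothesis applies.\<close>

lemma Ck_on_compose:
  assumes "open S" "open T" "f ` S \<subseteq> T" "Ck_on k S f" "Ck_on k T g"
  shows "Ck_on k S (\<lambda>x. g (f x))"
  using assms(4,5)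
proof (induction k arbitrary: g)
  case 0
  then show ?case using assms(3) by (auto intro: continuous_on_compose2)
next
  case (Suc k)
  obtain B :: "'b set" where B: "finite B" "\<And>x. x = (\<Sum>b\<in>B. inner x b *\<^sub>R b)"
    using fd_basis by blast
  let ?f = "\<lambda>x. frechet_derivative f (at x)" and ?g = "\<lambda>y. frechet_derivative g (at y)"
  show ?case
  proof (rule Ck_on_SucI[OF assms(1)])
    show d: "((\<lambda>x. g (f x)) has_derivative (\<lambda>v. \<Sum>b\<in>B. inner (?f x v) b *\<^sub>R ?g (f x) b)) (at x)"
      if "x \<in> S" for x
    proof -
      have g: "(g has_derivative ?g (f x)) (at (f x))"
        using Ck_on_SucD(1)[OF Suc.prems(2)] assms(3) that by blast
      then interpret g: linear "?g (f x)" by (rule has_derivative_linear)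
      have eq: "(\<Sum>b\<in>B. inner (?f x v) b *\<^sub>R ?g (f x) b) = ?g (f x) (?f x v)" for v
        by (subst (3) B(2)) (simp only: g.sum g.scaleR)
      show ?thesis
        unfolding eq using has_derivative_compose[OF Ck_on_SucD(1)[OF Suc.prems(1) that] g] .
    qed
    show "Ck_on k S (\<lambda>x. \<Sum>b\<in>B. inner (?f x v) b *\<^sub>R ?g (f x) b)" for v
    proof (intro Ck_on_sum[OF assms(1)] Ck_on_bilinear[OF bounded_bilinear_scaleR assms(1)])
      fix b
      show "Ck_on k S (\<lambda>x. inner (?f x v) b)"
        by (rule Ck_on_bounded_linear[OF bounded_linear_inner_left assms(1) Ck_on_SucD(2)[OF Suc.prems(1)]])
      show "Ck_on k S (\<lambda>x. ?g (f x) b)"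
        by (rule Suc.IH[OF Ck_on_Suc_imp[OF Suc.prems(1)] Ck_on_SucD(2)[OF Suc.prems(2)]])
    qed
  qed
qed

section \<open>Germs of smooth maps between vector spaces\<close>

definition smooth_near :: "('v::fd_inner \<Rightarrow> 'w::fd_inner) \<Rightarrow> 'v \<Rightarrow> bool" where
  "smooth_near f x \<longleftrightarrow> (\<exists>S. open S \<and> x \<in> S \<and> Cinf_on S f)"

lemma Cinf_on_iff_smooth_near: "open S \<Longrightarrow> Cinf_on S f \<longleftrightarrow> (\<forall>x\<in>S. smooth_near f x)"
  unfolding smooth_near_def Cinf_on_def by (auto intro!: Ck_on_open_cover)

lemma smooth_near_cong:
  assumes "smooth_near f x" "eventually (\<lambda>y. f y = g y) (nhds x)"
  shows "smooth_near g x"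
proof -
  obtain S where "open S" "x \<in> S" "Cinf_on S f"
    using assms(1) unfolding smooth_near_def by blast
  moreover obtain T where "open T" "x \<in> T" "\<forall>y\<in>T. f y = g y"
    using assms(2) unfolding eventually_nhds by blast
  ultimately have "Cinf_on (S \<inter> T) g"
    unfolding Cinf_on_def using Ck_on_cong[of "S \<inter> T" f g] Ck_on_subset[of _ S f "S \<inter> T"] by auto
  with \<open>open S\<close> \<open>open T\<close> \<open>x \<in> S\<close> \<open>x \<in> T\<close> show ?thesis
    unfolding smooth_near_def by (intro exI[of _ "S \<inter> T"]) auto
qed

lemma smooth_near_eventually: "smooth_near f x \<Longrightarrow> eventually (smooth_near f) (nhds x)"
  unfolding smooth_near_def eventually_nhds by blast

lemma smooth_near_isCont: "smooth_near f x \<Longrightarrow> isCont f x"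
  unfolding smooth_near_def Cinf_on_def
  using Ck_on.simps(1)[of _ f] continuous_on_eq_continuous_at by blast

lemma smooth_near_tendsto: "smooth_near f x \<Longrightarrow> filterlim f (nhds (f x)) (nhds x)"
  using smooth_near_isCont by (simp add: isCont_def tendsto_at_iff_tendsto_nhds)

lemma smooth_near_differentiable: "smooth_near f x \<Longrightarrow> f differentiable (at x)"
  unfolding smooth_near_def Cinf_on_def using Ck_on.simps(2)[of 0 _ f] by blast

lemma smooth_near_const: "smooth_near (\<lambda>y. c) x"
  unfolding smooth_near_def Cinf_on_def by (auto intro!: exI[of _ UNIV] Ck_on_const)

lemma smooth_near_id: "smooth_near (\<lambda>y. y) x"
  unfolding smooth_near_def Cinf_on_def by (auto intro!: exI[of _ UNIV] Ck_on_id)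

lemma smooth_near_bounded_linear: "bounded_linear L \<Longrightarrow> smooth_near L x"
  unfolding smooth_near_def Cinf_on_def 
  by (intro exI[of _ UNIV] conjI allI open_UNIV UNIV_I Ck_on_bounded_linear[OF _ open_UNIV Ck_on_id])

lemma smooth_near_Pair:
  assumes "smooth_near f x" "smooth_near g x"
  shows "smooth_near (\<lambda>y. (f y, g y)) x"
proof -
  obtain S where "open S" "x \<in> S" "Cinf_on S f"
    using assms(1) unfolding smooth_near_def by blast
  moreover obtain T where "open T" "x \<in> T" "Cinf_on T g"
    using assms(2) unfolding smooth_near_def by blast
  ultimately have "Cinf_on (S \<inter> T) (\<lambda>y. (f y, g y))"
    unfolding Cinf_on_def using Ck_on_subset[of _ S f "S \<inter> T"] Ck_on_subset[of _ T g "S \<inter> T"]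
    by (auto intro!: Ck_on_Pair)
  with \<open>open S\<close> \<open>open T\<close> \<open>x \<in> S\<close> \<open>x \<in> T\<close> show ?thesis
    unfolding smooth_near_def by (intro exI[of _ "S \<inter> T"]) auto
qed

lemma smooth_near_compose:
  assumes "smooth_near f x" "smooth_near g (f x)"
  shows "smooth_near (\<lambda>y. g (f y)) x"
proof -
  obtain S where S: "open S" "x \<in> S" "Cinf_on S f"
    using assms(1) unfolding smooth_near_def by blast
  obtain T where T: "open T" "f x \<in> T" "Cinf_on T g"
    using assms(2) unfolding smooth_near_def by blast
  have "Ck_on 0 S f" using S(3) unfolding Cinf_on_def by blast
  then have o: "open (S \<inter> f -` T)"
    using continuous_on_open_vimage[OF S(1), of f] T(1) by (simp add: Int_commute)
  have "Ck_on k (S \<inter> f -` T) (\<lambda>y. g (f y))" for k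
    using S(3) T(3) unfolding Cinf_on_def
    by (intro Ck_on_compose[OF o T(1) _ Ck_on_subset[of k S f]]) auto
  with o S T show ?thesis
    unfolding smooth_near_def Cinf_on_def by (intro exI[of _ "S \<inter> f -` T"] conjI allI) auto
qed

lemma smooth_near_bilinear:
  fixes mul :: "'a::fd_inner \<Rightarrow> 'b::fd_inner \<Rightarrow> 'c::fd_inner"
  assumes "bounded_bilinear mul" "smooth_near f x" "smooth_near g x"
  shows "smooth_near (\<lambda>y. mul (f y) (g y)) x"
proof -
  have "smooth_near (\<lambda>z. mul (fst z) (snd z)) (f x, g x)"
    unfolding smooth_near_def Cinf_on_def
    by (intro exI[of _ UNIV] conjI allI open_UNIV UNIV_I Ck_on_bilinear[OF assms(1) open_UNIV]
        Ck_on_bounded_linear[OF bounded_linear_fst open_UNIV Ck_on_id]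
        Ck_on_bounded_linear[OF bounded_linear_snd open_UNIV Ck_on_id])
  with smooth_near_compose[OF smooth_near_Pair[OF assms(2,3)] this] show ?thesis by simp
qed

section \<open>Flat exponentials and bump functions on vector spaces\<close>

text \<open>The polynomial factor makes this family of functions closed under differentiation.\<close>

definition flat_exp :: "real poly \<Rightarrow> real \<Rightarrow> real" where
  "flat_exp p t = (if t \<le> 0 then 0 else poly p (inverse t) * exp (- inverse t))"

lemma poly_exp_tendsto_0: "((\<lambda>x::real. poly p x * exp (- x)) \<longlongrightarrow> 0) at_top"
proof -
  have "((\<lambda>x. \<Sum>i\<le>degree p. coeff p i * (x ^ i / exp x)) \<longlongrightarrow> (\<Sum>i\<le>degree p. coeff p i * 0)) at_top"
    by (intro tendsto_intros tendsto_power_div_exp_0)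
  then show ?thesis
    by (simp add: poly_altdef exp_minus sum_distrib_right divide_inverse mult.assoc)
qed

lemma flat_exp_tendsto_0: "(flat_exp p \<longlongrightarrow> 0) (at 0)"
proof (rule filterlim_split_at)
  show "(flat_exp p \<longlongrightarrow> 0) (at_left 0)"
    by (rule tendsto_eventually) (auto simp: flat_exp_def eventually_at_filter)
  have "((\<lambda>t. poly p (inverse t) * exp (- inverse t)) \<longlongrightarrow> 0) (at_right (0::real))"
    using filterlim_compose[OF poly_exp_tendsto_0 filterlim_inverse_at_top_right] .
  then show "(flat_exp p \<longlongrightarrow> 0) (at_right 0)"
    by (rule Lim_transform_eventually) (auto simp: flat_exp_def eventually_at_filter)
qed

text \<open>With \<open>u = inverse t\<close>, differentiating in \<open>t\<close> is
  \<open>- u^2\<close> times differentiating in \<open>u\<close>, so \<open>p(u) exp (- u)\<close>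
  turns into \<open>u^2 (p(u) - p'(u)) exp (- u)\<close>; hence the polynomial
  \<open>[:0, 0, 1:] * (p - pderiv p)\<close>.\<close>

lemma flat_exp_DERIV:
  "(flat_exp p has_field_derivative flat_exp ([:0, 0, 1:] * (p - pderiv p)) t) (at t)"
proof -
  consider "t < 0" | "t = 0" | "t > 0" by linarith
  then show ?thesis
  proof cases
    case 1
    have "((\<lambda>_. 0) has_field_derivative 0) (at t)" by simp
    then have "(flat_exp p has_field_derivative 0) (at t)"
      by (rule DERIV_cong_ev[THEN iffD1, rotated -1])
        (use 1 in \<open>auto simp: flat_exp_def intro!: eventually_nhds[THEN iffD2] exI[of _ "{..<0}"]\<close>)
    then show ?thesis using 1 by (simp add: flat_exp_def)
  next
    case 2
    \<comment> \<open>The factor \<open>1 / h\<close> of the difference quotient at 0 is absorbed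
      into the polynomial, so the quotient is again a member of the family and tends to 0.\<close>
    have "(\<lambda>h. (flat_exp p (0 + h) - flat_exp p 0) / h) = flat_exp ([:0, 1:] * p)"
      by (auto simp: fun_eq_iff flat_exp_def field_simps)
    then have "(flat_exp p has_field_derivative 0) (at 0)"
      unfolding DERIV_def using flat_exp_tendsto_0 by simp
    with 2 show ?thesis by (simp add: flat_exp_def)
  next
    case 3
    have "((\<lambda>t. poly p (inverse t) * exp (- inverse t)) has_field_derivative
        flat_exp ([:0, 0, 1:] * (p - pderiv p)) t) (at t)"
      using 3 by (auto intro!: derivative_eq_intros simp: flat_exp_def algebra_simps power2_eq_square)
    then show ?thesis
      by (rule DERIV_cong_ev[THEN iffD1, rotated -1])
        (use 3 in \<open>auto simp: flat_exp_def intro!: eventually_nhds[THEN iffD2] exI[of _ "{0<..}"]\<close>)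
  qed
qed

lemma Ck_on_flat_exp: "Ck_on k UNIV (flat_exp p)"
proof (induction k arbitrary: p)
  case 0
  show ?case using flat_exp_DERIV by (auto intro!: continuous_at_imp_continuous_on DERIV_isCont)
next
  case (Suc k)
  show ?case
    by (rule Ck_on_SucI[OF open_UNIV flat_exp_DERIV[THEN has_field_derivative_imp_has_derivative]])
      (rule Ck_on_bilinear[OF bounded_bilinear_mult open_UNIV Suc Ck_on_const])
qed

text \<open>\<open>flat_exp 1\<close> is \<open>exp (- 1 / t)\<close> for positive \<open>t\<close>
  and 0 otherwise. Its argument is \<open>r\<^sup>2\<close> minus the squared distance, which is
  smooth also at \<open>x0\<close>, where the distance itself may fail to be; the factor
  \<open>inverse (?h (r\<^sup>2))\<close> normalizes the value at \<open>x0\<close> to 1.\<close>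

lemma fd_bump:
  fixes x0 :: "'v::fd_inner"
  assumes "0 < r"
  obtains b :: "'v \<Rightarrow> real"
    where "\<And>x. smooth_near b x" "b x0 = 1" "\<And>x. x \<notin> cball x0 r \<Longrightarrow> b x = 0"
proof
  let ?h = "flat_exp 1" and ?d = "\<lambda>x. r\<^sup>2 - inner (x - x0) (x - x0)"
  define b where "b = (\<lambda>x. inverse (?h (r\<^sup>2)) * ?h (?d x))"
  have h: "smooth_near ?h t" for t
    unfolding smooth_near_def Cinf_on_def using Ck_on_flat_exp by auto
  have s: "smooth_near (\<lambda>x. x - x0) x" for x
    using smooth_near_compose[OF smooth_near_Pair[OF smooth_near_id smooth_near_const]
        smooth_near_bounded_linear[OF bounded_linear_sub[OF bounded_linear_fst bounded_linear_snd]]]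
    by simp
  have "smooth_near (\<lambda>x. inner (x - x0) (x - x0)) x" for x
    using smooth_near_bilinear[OF bounded_bilinear_inner s s] .
  then have d: "smooth_near ?d x" for x
    using smooth_near_compose[OF smooth_near_Pair[OF smooth_near_const]
        smooth_near_bounded_linear[OF bounded_linear_sub[OF bounded_linear_fst bounded_linear_snd]]]
    by fastforce
  show "smooth_near b x" for x
    unfolding b_def
    by (rule smooth_near_bilinear[OF bounded_bilinear_mult smooth_near_const
          smooth_near_compose[of ?d, OF d h]])
  show "b x0 = 1" using assms by (simp add: b_def flat_exp_def)
  show "b x = 0" if "x \<notin> cball x0 r" for x
  proof -
    have "r \<le> norm (x - x0)" using that by (simp add: dist_norm norm_minus_commute)
    then have "r\<^sup>2 \<le> inner (x - x0) (x - x0)"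
      using assms by (simp add: dot_square_norm power_mono)
    then show ?thesis by (simp add: b_def flat_exp_def)
  qed
qed

text \<open>The class provides a finite orthonormal basis, so compactness is obtained from boxes of
  coefficients: \<open>?K C\<close> grows by one basis vector at a time as the continuous image of
  an interval times a smaller box, and the ball is a closed part of \<open>?K B\<close>.\<close>

lemma fd_compact_cball: "compact (cball (x0::'v::fd_inner) r)"
proof -
  obtain B :: "'v set" where B: "finite B" "\<And>x. x = (\<Sum>b\<in>B. inner x b *\<^sub>R b)"
    using fd_basis by blast
  \<comment> \<open>\<open>fd_basis\<close> exports the expansion but not the unit length of the
    basis vectors, so the Cauchy-Schwarz bound on the coefficients has to include a bound on all
    \<open>norm b\<close>.\<close>
  define R where "R = (norm x0 + \<bar>r\<bar>) * (1 + (\<Sum>b\<in>B. norm b))"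
  let ?K = "\<lambda>C. {\<Sum>b\<in>C. a b *\<^sub>R b | a. \<forall>b\<in>C. \<bar>a b\<bar> \<le> R}"
  have "compact (?K C)" if "finite C" for C :: "'v set"
    using that
  proof (induction C rule: finite_induct)
    case (insert c C)
    have "compact ((\<lambda>(t, x). t *\<^sub>R c + x) ` ({-R..R} \<times> ?K C))"
      by (rule compact_continuous_image)
        (auto intro!: continuous_intros compact_Times insert.IH simp: case_prod_beta)
    moreover have "(\<lambda>(t, x). t *\<^sub>R c + x) ` ({-R..R} \<times> ?K C) = ?K (insert c C)"
    proof (intro equalityI subsetI)
      fix y assume "y \<in> (\<lambda>(t, x). t *\<^sub>R c + x) ` ({-R..R} \<times> ?K C)"
      then obtain z where z: "z \<in> {-R..R} \<times> ?K C" "y = (\<lambda>(t, x). t *\<^sub>R c + x) z" by (rule imageE)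
      obtain t x where zz: "z = (t, x)" by (cases z)
      from z have t: "t \<in> {-R..R}" and x: "x \<in> ?K C" and y': "y = t *\<^sub>R c + x"
        unfolding zz by (simp_all only: mem_Sigma_iff prod.case)
      from x obtain a where a: "\<forall>b\<in>C. \<bar>a b\<bar> \<le> R" and y: "y = t *\<^sub>R c + (\<Sum>b\<in>C. a b *\<^sub>R b)"
        unfolding y' by auto
      have "(\<Sum>b\<in>C. a b *\<^sub>R b) = (\<Sum>b\<in>C. (a(c := t)) b *\<^sub>R b)"
        using insert.hyps by (intro sum.cong) auto
      then have "y = (\<Sum>b\<in>insert c C. (a(c := t)) b *\<^sub>R b)"
        unfolding y using insert.hyps by simp
      moreover have "\<forall>b\<in>insert c C. \<bar>(a(c := t)) b\<bar> \<le> R" using t a by (auto simp: abs_le_iff)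
      ultimately show "y \<in> ?K (insert c C)" by blast
    next
      fix y assume "y \<in> ?K (insert c C)"
      then obtain a where a: "\<forall>b\<in>insert c C. \<bar>a b\<bar> \<le> R" and y: "y = (\<Sum>b\<in>insert c C. a b *\<^sub>R b)"
        by blast
      have "y = (\<lambda>(t, x). t *\<^sub>R c + x) (a c, \<Sum>b\<in>C. a b *\<^sub>R b)"
        unfolding y using insert.hyps by simp
      moreover have "(a c, \<Sum>b\<in>C. a b *\<^sub>R b) \<in> {-R..R} \<times> ?K C"
        using a by (auto simp: abs_le_iff)
      ultimately show "y \<in> (\<lambda>(t, x). t *\<^sub>R c + x) ` ({-R..R} \<times> ?K C)" by (rule image_eqI)
    qed
    ultimately show ?case by simp
  qed simp
  then have K: "compact (?K B)" using B(1) .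
  have "cball x0 r \<subseteq> ?K B"
  proof
    fix x assume x: "x \<in> cball x0 r"
    have nx: "norm x \<le> norm x0 + \<bar>r\<bar>"
      using x norm_triangle_sub[of x x0] by (simp add: dist_norm norm_minus_commute)
    have "\<bar>inner x b\<bar> \<le> R" if "b \<in> B" for b
    proof -
      have "norm b \<le> 1 + (\<Sum>b\<in>B. norm b)"
        using member_le_sum[OF that, of norm] B(1) by auto
      then show ?thesis
        unfolding R_def by (intro order_trans[OF Cauchy_Schwarz_ineq2] mult_mono nx) auto
    qed
    then show "x \<in> ?K B" by (intro CollectI exI[of _ "inner x"] conjI B(2) ballI)
  qed
  then have "cball x0 r = ?K B \<inter> cball x0 r" by blast
  then show ?thesis using compact_Int_closed[OF K closed_cball, of x0 r] by simp
qed

section \<open>Smooth maps between manifolds\<close>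

lemma smooth_atlasD:
  assumes "smooth_atlas A" "(U, c) \<in> A"
  shows "inj_on c U" "open (c ` U)"
  using assms unfolding smooth_atlas_def by auto

lemma smooth_atlas_transition:
  assumes "smooth_atlas A" "(U, c) \<in> A" "(V, d) \<in> A"
  shows "open (c ` (U \<inter> V))" "Cinf_on (c ` (U \<inter> V)) (d \<circ> inv_into U c)"
  using assms unfolding smooth_atlas_def by fast+

lemma chart_transition_near:
  assumes "smooth_atlas A" "(U, c) \<in> A" "(V, d) \<in> A" "p \<in> U" "p \<in> V"
  shows "smooth_near (d \<circ> inv_into U c) (c p)"
  using smooth_atlas_transition[OF assms(1-3)] assms(4,5) unfolding smooth_near_def by blast

lemma smooth_atlasI:
  assumes "\<And>U c. (U, c) \<in> A \<Longrightarrow> inj_on c U" "\<And>U c. (U, c) \<in> A \<Longrightarrow> open (c ` U)"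
    and "\<And>U c V d. (U, c) \<in> A \<Longrightarrow> (V, d) \<in> A \<Longrightarrow> open (c ` (U \<inter> V))"
    and "\<And>U c V d. (U, c) \<in> A \<Longrightarrow> (V, d) \<in> A \<Longrightarrow> Cinf_on (c ` (U \<inter> V)) (d \<circ> inv_into U c)"
  shows "smooth_atlas A"
  using assms unfolding smooth_atlas_def by auto

lemma pts_iff: "p \<in> pts A \<longleftrightarrow> (\<exists>U c. (U, c) \<in> A \<and> p \<in> U)"
  unfolding pts_def by auto

text \<open>\<open>topology\<close> has the intended open sets once the predicate is shown to be a
  topology; closure under intersections rests on the injectivity of the charts.\<close>

lemma openin_mtop:
  assumes "smooth_atlas A"
  shows "openin (mtop A) W \<longleftrightarrow> W \<subseteq> pts A \<and> (\<forall>(U, c)\<in>A. open (c ` (U \<inter> W)))"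
proof -
  let ?P = "\<lambda>W. W \<subseteq> pts A \<and> (\<forall>(U, c)\<in>A. open (c ` (U \<inter> W)))"
  have "istopology ?P"
    unfolding istopology_def
  proof (intro conjI allI impI)
    fix S T assume S: "?P S" and T: "?P T"
    show "S \<inter> T \<subseteq> pts A" using S by blast
    show "\<forall>(U, c)\<in>A. open (c ` (U \<inter> (S \<inter> T)))"
    proof clarify
      fix U c assume U: "(U, c) \<in> A"
      have "c ` (U \<inter> (S \<inter> T)) = c ` (U \<inter> S) \<inter> c ` (U \<inter> T)"
        using smooth_atlasD(1)[OF assms U] by (auto simp: inj_on_def)
      then show "open (c ` (U \<inter> (S \<inter> T)))" using S T U by auto
    qed
  next
    fix K assume K: "\<forall>W\<in>K. ?P W"
    show "\<Union>K \<subseteq> pts A" using K by blast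
    show "\<forall>(U, c)\<in>A. open (c ` (U \<inter> \<Union>K))"
    proof clarify
      fix U c assume U: "(U, c) \<in> A"
      have "c ` (U \<inter> \<Union>K) = (\<Union>W\<in>K. c ` (U \<inter> W))" by blast
      moreover have "\<forall>W\<in>K. open (c ` (U \<inter> W))" using K U by fast
      ultimately show "open (c ` (U \<inter> \<Union>K))" by auto
    qed
  qed
  then show ?thesis unfolding mtop_def by (simp add: topology_inverse')
qed

lemma topspace_mtop:
  assumes "smooth_atlas A"
  shows "topspace (mtop A) = pts A"
proof -
  have "open (c ` (U \<inter> pts A))" if "(U, c) \<in> A" for U c
  proof -
    have "U \<inter> pts A = U" using that unfolding pts_def by blast
    then show ?thesis using smooth_atlasD(2)[OF assms that] by simp
  qed
  then have "openin (mtop A) (pts A)" by (auto simp: openin_mtop[OF assms])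
  then show ?thesis
    using openin_mtop[OF assms] openin_subset[of "mtop A"] by (meson openin_topspace subset_antisym)
qed

text \<open>Seen in another chart, the set is the preimage of \<open>T\<close> under a transition
  map, which is continuous. With \<open>T = UNIV\<close> it follows that chart domains are
  open.\<close>

lemma openin_chart_preimage:
  assumes "smooth_atlas A" "(U, c) \<in> A" "open T"
  shows "openin (mtop A) {x \<in> U. c x \<in> T}"
  unfolding openin_mtop[OF assms(1)]
proof (intro conjI ballI, goal_cases)
  case 1
  then show ?case using assms(2) unfolding pts_def by blast
next
  case (2 z)
  obtain V d where z: "z = (V, d)" by (cases z)
  with 2 have V: "(V, d) \<in> A" by simp
  note tr = smooth_atlas_transition[OF assms(1) V assms(2)]
  have "Ck_on 0 (d ` (V \<inter> U)) (c \<circ> inv_into V d)" using tr(2) unfolding Cinf_on_def by blast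
  then have "open (d ` (V \<inter> U) \<inter> (c \<circ> inv_into V d) -` T)"
    using continuous_on_open_vimage[OF tr(1), THEN iffD1] assms(3)
    unfolding Ck_on.simps(1) Int_commute[of "d ` (V \<inter> U)"] by blast
  moreover have "d ` (V \<inter> U) \<inter> (c \<circ> inv_into V d) -` T = d ` (V \<inter> {x \<in> U. c x \<in> T})"
    using smooth_atlasD(1)[OF assms(1) V] by auto
  ultimately show ?case by (simp add: z)
qed

lemma eventually_nhdsin_mtop:
  assumes "smooth_atlas A" "p \<in> pts A"
  shows "eventually P (nhdsin (mtop A) p) \<longleftrightarrow> (\<exists>S. openin (mtop A) S \<and> p \<in> S \<and> (\<forall>x\<in>S. P x))"
  using assms by (simp add: eventually_nhdsin topspace_mtop)

text \<open>Moves statements about all nearby points between the manifold and the model space; this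
  is what allows local arguments to run on filters, without naming open sets.\<close>

lemma eventually_chart:
  assumes "smooth_atlas A" "(U, c) \<in> A" "p \<in> U"
  shows "eventually P (nhdsin (mtop A) p) \<longleftrightarrow> eventually (\<lambda>y. P (inv_into U c y)) (nhds (c p))"
proof
  have p: "p \<in> pts A" using assms by (auto simp: pts_iff)
  note inj = smooth_atlasD(1)[OF assms(1,2)]
  show "eventually (\<lambda>y. P (inv_into U c y)) (nhds (c p))" if ev: "eventually P (nhdsin (mtop A) p)"
  proof -
    obtain S where S: "openin (mtop A) S" "p \<in> S" "\<And>x. x \<in> S \<Longrightarrow> P x"
      using ev unfolding eventually_nhdsin_mtop[OF assms(1) p] by blast
    then have "open (c ` (U \<inter> S))" using assms(1,2) by (auto simp: openin_mtop)
    moreover have "c p \<in> c ` (U \<inter> S)" using S(2) assms(3) by blast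
    moreover have "P (inv_into U c y)" if "y \<in> c ` (U \<inter> S)" for y
      using that S(3) inj by auto
    ultimately show ?thesis unfolding eventually_nhds by blast
  qed
  show "eventually P (nhdsin (mtop A) p)" if ev: "eventually (\<lambda>y. P (inv_into U c y)) (nhds (c p))"
  proof -
    obtain T where T: "open T" "c p \<in> T" "\<And>y. y \<in> T \<Longrightarrow> P (inv_into U c y)"
      using ev unfolding eventually_nhds by blast
    have "\<And>x. x \<in> {x \<in> U. c x \<in> T} \<Longrightarrow> P x"
      using T(3) inj by (metis (mono_tags, lifting) inv_into_f_f mem_Collect_eq)
    moreover have "p \<in> {x \<in> U. c x \<in> T}" using T(2) assms(3) by blast
    ultimately show ?thesis
      unfolding eventually_nhdsin_mtop[OF assms(1) p]
      using openin_chart_preimage[OF assms(1,2) T(1)] by blast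
  qed
qed

lemma eventually_nhdsin_self:
  assumes "smooth_atlas A" "p \<in> pts A" "eventually P (nhdsin (mtop A) p)"
  shows "P p"
  using assms by (auto simp: eventually_nhdsin_mtop)

lemma eventually_in_open:
  assumes "openin (mtop A) W" "p \<in> W"
  shows "eventually (\<lambda>x. x \<in> W) (nhdsin (mtop A) p)"
  using assms by (auto simp: eventually_nhdsin)

lemma openin_chart_dom: "smooth_atlas A \<Longrightarrow> (U, c) \<in> A \<Longrightarrow> openin (mtop A) U"
  using openin_chart_preimage[of A U c UNIV] by simp

lemma openin_mtop_eventually:
  assumes "smooth_atlas A" "W \<subseteq> pts A" "\<And>p. p \<in> W \<Longrightarrow> eventually (\<lambda>x. x \<in> W) (nhdsin (mtop A) p)"
  shows "openin (mtop A) W"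
proof (subst openin_subopen, intro ballI)
  fix p assume "p \<in> W"
  then show "\<exists>T. openin (mtop A) T \<and> p \<in> T \<and> T \<subseteq> W"
    using assms(3)[of p] assms(2) unfolding eventually_nhdsin topspace_mtop[OF assms(1)] by blast
qed

section \<open>Smoothness at a point of a manifold\<close>

definition smooth_at ::
  "('p, 'v::fd_inner) atlas \<Rightarrow> ('q, 'w::fd_inner) atlas \<Rightarrow> ('p \<Rightarrow> 'q) \<Rightarrow> 'p \<Rightarrow> bool" where
  "smooth_at A B f p \<longleftrightarrow> smooth_atlas A \<and> smooth_atlas B \<and>
     (\<exists>U c V d. (U, c) \<in> A \<and> (V, d) \<in> B \<and> p \<in> U \<and> f p \<in> V \<and>
        eventually (\<lambda>x. f x \<in> V) (nhdsin (mtop A) p) \<and> smooth_near (d \<circ> f \<circ> inv_into U c) (c p))"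

lemma smooth_at_atlas:
  assumes "smooth_at A B f p"
  shows "smooth_atlas A" "smooth_atlas B" "p \<in> pts A" "f p \<in> pts B"
  using assms unfolding smooth_at_def pts_iff by blast+

text \<open>This is continuity at \<open>p\<close>. The coordinate expression controls only
  \<open>d (f x)\<close>; that nearby \<open>f x\<close> lie in \<open>V\<close>, as
  \<open>smooth_at\<close> demands, allows the chart \<open>d\<close> to be inverted.\<close>

lemma smooth_at_eventually:
  assumes "smooth_at A B f p" "eventually P (nhdsin (mtop B) (f p))"
  shows "eventually (\<lambda>x. P (f x)) (nhdsin (mtop A) p)"
proof -
  obtain U c V d where A: "smooth_atlas A" "(U, c) \<in> A" "p \<in> U" and B: "smooth_atlas B" "(V, d) \<in> B" "f p \<in> V"
    and ev: "eventually (\<lambda>x. f x \<in> V) (nhdsin (mtop A) p)"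
    and sm: "smooth_near (d \<circ> f \<circ> inv_into U c) (c p)"
    using assms(1) unfolding smooth_at_def by blast
  have e1: "eventually (\<lambda>z. P (inv_into V d z)) (nhds (d (f p)))"
    using assms(2) eventually_chart[OF B] by blast
  have "filterlim (d \<circ> f \<circ> inv_into U c) (nhds (d (f p))) (nhds (c p))"
    using smooth_near_tendsto[OF sm] inv_into_f_f[OF smooth_atlasD(1)[OF A(1,2)] A(3)] by simp
  then have "eventually (\<lambda>y. P (inv_into V d ((d \<circ> f \<circ> inv_into U c) y))) (nhds (c p))"
    using e1 unfolding filterlim_iff by blast
  then have "eventually (\<lambda>x. P (inv_into V d (d (f x)))) (nhdsin (mtop A) p)"
    using eventually_chart[OF A] by simp
  with ev show ?thesis
    by eventually_elim (simp add: inv_into_f_f[OF smooth_atlasD(1)[OF B(1,2)]])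
qed

text \<open>Independence of the charts: near \<open>c p\<close> the new coordinate expression is the
  old one between two transition maps.\<close>

lemma smooth_atD:
  assumes "smooth_at A B f p" "(U, c) \<in> A" "(V, d) \<in> B" "p \<in> U" "f p \<in> V"
  shows "smooth_near (d \<circ> f \<circ> inv_into U c) (c p)"
proof -
  obtain U' c' V' d' where A: "smooth_atlas A" "(U', c') \<in> A" "p \<in> U'"
    and B: "smooth_atlas B" "(V', d') \<in> B" "f p \<in> V'"
    and ev: "eventually (\<lambda>x. f x \<in> V') (nhdsin (mtop A) p)"
    and sm: "smooth_near (d' \<circ> f \<circ> inv_into U' c') (c' p)"
    using assms(1) unfolding smooth_at_def by blast
  have ip: "inv_into U c (c p) = p" "inv_into U' c' (c' p) = p"
    using inv_into_f_f smooth_atlasD(1)[OF A(1)] A assms by metis+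
  let ?h1 = "c' \<circ> inv_into U c" and ?h2 = "d' \<circ> f \<circ> inv_into U' c'" and ?h3 = "d \<circ> inv_into V' d'"
  have h1: "smooth_near ?h1 (c p)" "?h1 (c p) = c' p"
    using chart_transition_near[OF A(1) assms(2) A(2) assms(4) A(3)] ip by simp_all
  have h3: "smooth_near ?h3 (d' (f p))"
    by (rule chart_transition_near[OF B(1,2) assms(3) B(3) assms(5)])
  have h2: "smooth_near (\<lambda>y. ?h2 (?h1 y)) (c p)" "?h2 (?h1 (c p)) = d' (f p)"
    using smooth_near_compose[OF h1(1), of ?h2] sm h1(2) ip by simp_all
  have h: "smooth_near (\<lambda>y. ?h3 (?h2 (?h1 y))) (c p)"
    using smooth_near_compose[OF h2(1), of ?h3] h3 h2(2) by simp
  have "eventually (\<lambda>x. d (inv_into V' d' (d' (f (inv_into U' c' (c' x))))) = d (f x)) (nhdsin (mtop A) p)"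
    using ev eventually_in_open[OF openin_chart_dom[OF A(1,2)] A(3)]
    by eventually_elim (simp add: inv_into_f_f[OF smooth_atlasD(1)[OF A(1,2)]]
        inv_into_f_f[OF smooth_atlasD(1)[OF B(1,2)]])
  then have "eventually (\<lambda>y. ?h3 (?h2 (?h1 y)) = (d \<circ> f \<circ> inv_into U c) y) (nhds (c p))"
    unfolding eventually_chart[OF A(1) assms(2,4)] by simp
  with h show ?thesis by (rule smooth_near_cong)
qed

lemma smooth_atI:
  assumes "smooth_atlas A" "smooth_atlas B" "(U, c) \<in> A" "(V, d) \<in> B" "p \<in> U"
    "eventually (\<lambda>x. f x \<in> V) (nhdsin (mtop A) p)" "smooth_near (d \<circ> f \<circ> inv_into U c) (c p)"
  shows "smooth_at A B f p"
proof -
  have "f p \<in> V" using eventually_nhdsin_self[OF assms(1) _ assms(6)] assms(3,5) by (auto simp: pts_iff)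
  then show ?thesis using assms unfolding smooth_at_def by blast
qed

lemma smooth_at_compose:
  assumes "smooth_at A B f p" "smooth_at B C g (f p)"
  shows "smooth_at A C (\<lambda>x. g (f x)) p"
proof -
  obtain U c V d where A: "smooth_atlas A" "(U, c) \<in> A" "p \<in> U"
    and B: "smooth_atlas B" "(V, d) \<in> B" "f p \<in> V"
    and ev: "eventually (\<lambda>x. f x \<in> V) (nhdsin (mtop A) p)"
    and sm: "smooth_near (d \<circ> f \<circ> inv_into U c) (c p)"
    using assms(1) unfolding smooth_at_def by blast
  obtain W e where C: "smooth_atlas C" "(W, e) \<in> C" "g (f p) \<in> W"
    using smooth_at_atlas[OF assms(2)] unfolding pts_iff by blast
  have ip: "inv_into U c (c p) = p"
    using inv_into_f_f smooth_atlasD(1)[OF A(1)] A by metis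
  let ?h = "\<lambda>y. (e \<circ> g \<circ> inv_into V d) ((d \<circ> f \<circ> inv_into U c) y)"
  have "smooth_near (e \<circ> g \<circ> inv_into V d) ((d \<circ> f \<circ> inv_into U c) (c p))"
    using smooth_atD[OF assms(2) B(2) C(2) B(3) C(3)] ip by (simp add: comp_def)
  then have h: "smooth_near ?h (c p)" by (rule smooth_near_compose[OF sm])
  have "eventually (\<lambda>x. e (g (inv_into V d (d (f x)))) = e (g (f x))) (nhdsin (mtop A) p)"
    using ev by eventually_elim (simp add: inv_into_f_f[OF smooth_atlasD(1)[OF B(1,2)]])
  then have "eventually (\<lambda>y. ?h y = (e \<circ> (\<lambda>x. g (f x)) \<circ> inv_into U c) y) (nhds (c p))"
    unfolding eventually_chart[OF A] by simp
  with h have s: "smooth_near (e \<circ> (\<lambda>x. g (f x)) \<circ> inv_into U c) (c p)"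
    by (rule smooth_near_cong)
  have "eventually (\<lambda>x. g (f x) \<in> W) (nhdsin (mtop A) p)"
    using smooth_at_eventually[OF assms(1) smooth_at_eventually[OF assms(2)
          eventually_in_open[OF openin_chart_dom[OF C(1,2)] C(3)]]] .
  then show ?thesis by (rule smooth_atI[OF A(1) C(1) A(2) C(2) A(3) _ s])
qed

lemma smooth_at_cong:
  assumes "smooth_at A B f p" "eventually (\<lambda>x. f x = g x) (nhdsin (mtop A) p)"
  shows "smooth_at A B g p"
proof -
  obtain U c V d where A: "smooth_atlas A" "(U, c) \<in> A" "p \<in> U"
    and B: "smooth_atlas B" "(V, d) \<in> B"
    and ev: "eventually (\<lambda>x. f x \<in> V) (nhdsin (mtop A) p)"
    and sm: "smooth_near (d \<circ> f \<circ> inv_into U c) (c p)"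
    using assms(1) unfolding smooth_at_def by blast
  have ev': "eventually (\<lambda>x. g x \<in> V) (nhdsin (mtop A) p)"
    using ev assms(2) by eventually_elim simp
  have "smooth_near (d \<circ> g \<circ> inv_into U c) (c p)"
    using assms(2) unfolding eventually_chart[OF A]
    by (intro smooth_near_cong[OF sm]) (auto elim: eventually_mono)
  then show ?thesis using smooth_atI[OF A(1) B(1) A(2) B(2) A(3) ev'] by blast
qed

text \<open>\<open>smooth_near\<close> speaks of an open set, so smoothness at a point spreads to a
  neighbourhood. This gives the interval around 0 in \<open>tangent_iff\<close> and the open domain
  of the section in \<open>pts_quotientI\<close>.\<close>

lemma smooth_at_near:
  assumes "smooth_at A B f p"
  shows "eventually (smooth_at A B f) (nhdsin (mtop A) p)"
proof -
  obtain U c V d where A: "smooth_atlas A" "(U, c) \<in> A" "p \<in> U"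
    and B: "smooth_atlas B" "(V, d) \<in> B"
    and ev: "eventually (\<lambda>x. f x \<in> V) (nhdsin (mtop A) p)"
    and sm: "smooth_near (d \<circ> f \<circ> inv_into U c) (c p)"
    using assms(1) unfolding smooth_at_def by blast
  have p: "p \<in> pts A" using A by (auto simp: pts_iff)
  obtain S where S: "openin (mtop A) S" "p \<in> S" "\<forall>x\<in>S. f x \<in> V"
    using ev unfolding eventually_nhdsin_mtop[OF A(1) p] by blast
  have "eventually (\<lambda>y. smooth_near (d \<circ> f \<circ> inv_into U c) (c (inv_into U c y))) (nhds (c p))"
  proof -
    have "eventually (\<lambda>y. y \<in> c ` U) (nhds (c p))"
      using smooth_atlasD(2)[OF A(1,2)] A(3) by (auto simp: eventually_nhds)
    with smooth_near_eventually[OF sm] show ?thesis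
      by eventually_elim (simp add: f_inv_into_f)
  qed
  then have "eventually (\<lambda>x. smooth_near (d \<circ> f \<circ> inv_into U c) (c x)) (nhdsin (mtop A) p)"
    using eventually_chart[OF A, of "\<lambda>x. smooth_near (d \<circ> f \<circ> inv_into U c) (c x)"] by simp
  with eventually_in_open[OF S(1,2)] eventually_in_open[OF openin_chart_dom[OF A(1,2)] A(3)]
  show ?thesis
  proof eventually_elim
    case (elim x)
    have "eventually (\<lambda>x. f x \<in> V) (nhdsin (mtop A) x)"
      using eventually_in_open[OF S(1) elim(1)] S(3) by (auto elim: eventually_mono)
    then show ?case using smooth_atI[OF A(1) B(1) A(2) B(2) elim(2) _ elim(3)] by blast
  qed
qed

lemma smooth_at_id:
  assumes "smooth_atlas A" "p \<in> pts A"
  shows "smooth_at A A (\<lambda>x. x) p"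
proof -
  obtain U c where U: "(U, c) \<in> A" "p \<in> U" using assms(2) by (auto simp: pts_iff)
  have "smooth_near (c \<circ> (\<lambda>x. x) \<circ> inv_into U c) (c p)"
    using chart_transition_near[OF assms(1) U(1) U(1) U(2) U(2)] by (simp add: comp_def)
  then show ?thesis
    by (rule smooth_atI[OF assms(1) assms(1) U(1) U(1) U(2)
        eventually_in_open[OF openin_chart_dom[OF assms(1) U(1)] U(2)]])
qed

lemma smooth_at_const:
  assumes "smooth_atlas A" "smooth_atlas B" "p \<in> pts A" "q \<in> pts B"
  shows "smooth_at A B (\<lambda>x. q) p"
proof -
  obtain U c where U: "(U, c) \<in> A" "p \<in> U" using assms(3) by (auto simp: pts_iff)
  obtain V d where V: "(V, d) \<in> B" "q \<in> V" using assms(4) by (auto simp: pts_iff)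
  show ?thesis
    using V(2) smooth_near_const[of "d q"]
    by (intro smooth_atI[OF assms(1,2) U(1) V(1) U(2)]) (simp_all add: comp_def)
qed

section \<open>Open submanifolds, and smooth maps as maps smooth at every point\<close>

lemma open_sub_UNIV: "open_sub A UNIV = A"
  by (auto simp: open_sub_def)

lemma open_sub_image: "open_sub A W = (\<lambda>(U, c). (U \<inter> W, c)) ` A"
  unfolding open_sub_def by force

lemma open_sub_open_sub: "open_sub (open_sub A W) W' = open_sub A (W \<inter> W')"
  unfolding open_sub_image image_image by (simp add: case_prod_beta Int_assoc)

lemma pts_open_sub: "pts (open_sub A W) = pts A \<inter> W"
  by (auto simp: pts_def open_sub_def)

text \<open>The third claim, that \<open>W\<close> is a neighbourhood of \<open>p\<close>, comes
  from the openness of coordinate preimages built into \<open>smooth_map\<close>.\<close>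

lemma smooth_map_open_subD:
  assumes "smooth_atlas A" "smooth_atlas B" "smooth_map (open_sub A W) (open_sub B W') f"
    "p \<in> pts A" "p \<in> W"
  shows "f p \<in> W'" "smooth_at A B f p" "eventually (\<lambda>x. x \<in> W) (nhdsin (mtop A) p)"
proof -
  have fp: "f p \<in> pts B \<inter> W'"
    using assms(3-5) unfolding smooth_map_def pts_open_sub by blast
  then show "f p \<in> W'" by blast
  obtain U c where U: "(U, c) \<in> A" "p \<in> U" using assms(4) by (auto simp: pts_iff)
  obtain V d where V: "(V, d) \<in> B" "f p \<in> V" using fp by (auto simp: pts_iff)
  let ?O = "c ` (U \<inter> W \<inter> f -` (V \<inter> W'))"
  note inj = smooth_atlasD(1)[OF assms(1) U(1)]
  have "(U \<inter> W, c) \<in> open_sub A W" "(V \<inter> W', d) \<in> open_sub B W'"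
    using U V by (auto simp: open_sub_def)
  then have o: "open ?O" and sm: "Cinf_on ?O (d \<circ> f \<circ> inv_into (U \<inter> W) c)"
    using assms(3) unfolding smooth_map_def by fast+
  have p: "c p \<in> ?O" using U V fp assms(5) by blast
  \<comment> \<open>The restricted chart has its own \<open>inv_into\<close>, which is tied to that
    of the full chart only on the coordinate image of the smaller set.\<close>
  have eq: "inv_into (U \<inter> W) c y = inv_into U c y" if "y \<in> ?O" for y
    using that inj inj_on_subset[OF inj, of "U \<inter> W"] by auto
  have O: "eventually (\<lambda>y. y \<in> ?O) (nhds (c p))"
    using o p unfolding eventually_nhds by blast
  have "smooth_near (d \<circ> f \<circ> inv_into (U \<inter> W) c) (c p)"
    using sm o p unfolding smooth_near_def by blast
  moreover have "eventually (\<lambda>y. (d \<circ> f \<circ> inv_into (U \<inter> W) c) y = (d \<circ> f \<circ> inv_into U c) y) (nhds (c p))"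
    using O by eventually_elim (simp add: eq)
  ultimately have sm': "smooth_near (d \<circ> f \<circ> inv_into U c) (c p)" by (rule smooth_near_cong)
  have in_O: "f (inv_into U c y) \<in> V \<and> inv_into U c y \<in> W" if "y \<in> ?O" for y
    using that inj by auto
  then show "eventually (\<lambda>x. x \<in> W) (nhdsin (mtop A) p)"
    unfolding eventually_chart[OF assms(1) U] using O by (auto elim: eventually_mono)
  have "eventually (\<lambda>x. f x \<in> V) (nhdsin (mtop A) p)"
    unfolding eventually_chart[OF assms(1) U] using O in_O by (auto elim: eventually_mono)
  then show "smooth_at A B f p" by (rule smooth_atI[OF assms(1,2) U(1) V(1) U(2) _ sm'])
qed

lemma smooth_mapI:
  assumes "f ` pts A \<subseteq> pts B"
    and "\<And>U c V d. (U, c) \<in> A \<Longrightarrow> (V, d) \<in> B \<Longrightarrow> open (c ` (U \<inter> f -` V))"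
    and "\<And>U c V d. (U, c) \<in> A \<Longrightarrow> (V, d) \<in> B \<Longrightarrow> Cinf_on (c ` (U \<inter> f -` V)) (d \<circ> f \<circ> inv_into U c)"
  shows "smooth_map A B f"
  using assms unfolding smooth_map_def by auto

text \<open>Continuity of \<open>f\<close> puts a whole neighbourhood of each point of
  \<open>?O\<close> into \<open>?O\<close>; openness and smoothness on \<open>?O\<close> are then
  checked point by point.\<close>

lemma smooth_map_open_subI:
  assumes "openin (mtop A) (pts A \<inter> W)" "smooth_atlas A"
    and f: "\<And>p. p \<in> pts A \<Longrightarrow> p \<in> W \<Longrightarrow> f p \<in> W'" "\<And>p. p \<in> pts A \<Longrightarrow> p \<in> W \<Longrightarrow> smooth_at A B f p"
  shows "smooth_map (open_sub A W) (open_sub B W') f"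
proof (rule smooth_mapI)
  show "f ` pts (open_sub A W) \<subseteq> pts (open_sub B W')"
    using f(1) smooth_at_atlas(4)[OF f(2)] unfolding pts_open_sub by blast
  fix T c T' d assume "(T, c) \<in> open_sub A W" "(T', d) \<in> open_sub B W'"
  then obtain U V where z: "T = U \<inter> W" "T' = V \<inter> W'" and U: "(U, c) \<in> A" and V: "(V, d) \<in> B"
    unfolding open_sub_def by blast
  let ?O = "c ` (U \<inter> W \<inter> f -` (V \<inter> W'))"
  note inj = smooth_atlasD(1)[OF assms(2) U]
  have eq: "inv_into (U \<inter> W) c y = inv_into U c y" if "y \<in> ?O" for y
    using that inj inj_on_subset[OF inj, of "U \<inter> W"] by auto
  have ev: "eventually (\<lambda>y. y \<in> ?O) (nhds y)" if y: "y \<in> ?O" for y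
  proof -
    obtain p where p: "p \<in> U" "p \<in> W" "f p \<in> V" "y = c p" using y by blast
    then have pA: "p \<in> pts A" using U by (auto simp: pts_iff)
    note s = f(2)[OF pA p(2)]
    have "eventually (\<lambda>x. f x \<in> V) (nhdsin (mtop A) p)"
      by (rule smooth_at_eventually[OF s eventually_in_open[OF openin_chart_dom[OF smooth_at_atlas(2)[OF s] V] p(3)]])
    moreover have "eventually (\<lambda>x. x \<in> pts A \<inter> W) (nhdsin (mtop A) p)"
      using eventually_in_open[OF assms(1)] pA p(2) by blast
    ultimately have "eventually (\<lambda>x. x \<in> W \<inter> f -` (V \<inter> W')) (nhdsin (mtop A) p)"
      by eventually_elim (use f(1) in auto)
    then have "eventually (\<lambda>y. inv_into U c y \<in> W \<inter> f -` (V \<inter> W')) (nhds y)"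
      unfolding eventually_chart[OF assms(2) U p(1)] p(4) .
    moreover have "eventually (\<lambda>y. y \<in> c ` U) (nhds y)"
      using smooth_atlasD(2)[OF assms(2) U] p by (auto simp: eventually_nhds)
    ultimately show ?thesis
    proof eventually_elim
      case (elim y)
      then have "inv_into U c y \<in> U \<inter> W \<inter> f -` (V \<inter> W')" using inv_into_into[OF elim(2)] by blast
      then have "c (inv_into U c y) \<in> ?O" by blast
      then show ?case using elim(2) by (simp add: f_inv_into_f)
    qed
  qed
  have o: "open ?O"
  proof (subst open_subopen, intro ballI)
    fix y assume "y \<in> ?O"
    from ev[OF this] show "\<exists>T. open T \<and> y \<in> T \<and> T \<subseteq> ?O"
      unfolding eventually_nhds by (auto simp only: subset_iff)
  qed
  have "smooth_near (d \<circ> f \<circ> inv_into (U \<inter> W) c) y" if y: "y \<in> ?O" for y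
  proof -
    obtain p where p: "p \<in> U" "p \<in> W" "f p \<in> V" "y = c p" using y by blast
    then have pA: "p \<in> pts A" using U by (auto simp: pts_iff)
    have "smooth_near (d \<circ> f \<circ> inv_into U c) y"
      using smooth_atD[OF f(2)[OF pA p(2)] U V p(1,3)] p(4) by simp
    moreover have "eventually (\<lambda>y. (d \<circ> f \<circ> inv_into U c) y = (d \<circ> f \<circ> inv_into (U \<inter> W) c) y) (nhds y)"
      using ev[OF y] by eventually_elim (simp add: eq)
    ultimately show ?thesis by (rule smooth_near_cong)
  qed
  then have "Cinf_on ?O (d \<circ> f \<circ> inv_into (U \<inter> W) c)" by (intro Cinf_on_iff_smooth_near[OF o, THEN iffD2] ballI)
  with o show "open (c ` (T \<inter> f -` T'))" "Cinf_on (c ` (T \<inter> f -` T')) (d \<circ> f \<circ> inv_into T c)"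
    unfolding z by blast+
qed

lemma smooth_map_iff:
  assumes "smooth_atlas A" "smooth_atlas B"
  shows "smooth_map A B f \<longleftrightarrow> (\<forall>p\<in>pts A. smooth_at A B f p)"
proof -
  have "openin (mtop A) (pts A \<inter> UNIV)" using openin_topspace[of "mtop A"] topspace_mtop[OF assms(1)] by simp
  then show ?thesis
    using smooth_map_open_subD(2)[OF assms, of UNIV UNIV f] smooth_map_open_subI[OF _ assms(1), of UNIV f UNIV B]
    by (auto simp: open_sub_UNIV)
qed

lemma smooth_map_cong:
  assumes "smooth_map A B f" "smooth_atlas A" "smooth_atlas B" "\<And>x. x \<in> pts A \<Longrightarrow> f x = g x"
  shows "smooth_map A B g"
proof -
  have "smooth_at A B g p" if "p \<in> pts A" for p
  proof (rule smooth_at_cong)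
    show "smooth_at A B f p" using assms that by (simp add: smooth_map_iff)
    show "eventually (\<lambda>x. f x = g x) (nhdsin (mtop A) p)"
      unfolding eventually_nhdsin_mtop[OF assms(2) that]
      using assms(4) that openin_topspace[of "mtop A"] topspace_mtop[OF assms(2)] by (intro exI[of _ "pts A"]) auto
  qed
  then show ?thesis using assms by (simp add: smooth_map_iff)
qed

lemma eventually_pts:
  assumes "smooth_atlas A"
  shows "eventually (\<lambda>x. x \<in> pts A) (nhdsin (mtop A) p)"
  unfolding eventually_nhdsin topspace_mtop[OF assms]
  using openin_topspace[of "mtop A"] topspace_mtop[OF assms] by auto

subsection \<open>Products\<close>

lemma pts_prod_atlas: "pts (prod_atlas A B) = pts A \<times> pts B"
proof -
  have "(p, q) \<in> pts (prod_atlas A B) \<longleftrightarrow> p \<in> pts A \<and> q \<in> pts B" for p q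
  proof
    assume "(p, q) \<in> pts (prod_atlas A B)"
    then obtain U c V d where "(U, c) \<in> A" "(V, d) \<in> B" "(p, q) \<in> U \<times> V"
      unfolding pts_iff prod_atlas_def by blast
    then show "p \<in> pts A \<and> q \<in> pts B" unfolding pts_iff by blast
  next
    assume "p \<in> pts A \<and> q \<in> pts B"
    then obtain U c V d where "(U, c) \<in> A" "(V, d) \<in> B" "(p, q) \<in> U \<times> V"
      unfolding pts_iff by blast
    moreover from this have "(U \<times> V, map_prod c d) \<in> prod_atlas A B" unfolding prod_atlas_def by blast
    ultimately show "(p, q) \<in> pts (prod_atlas A B)" unfolding pts_iff by blast
  qed
  then show ?thesis by auto
qed

lemma inv_into_map_prod:
  assumes "inj_on c U" "inj_on d V" "y \<in> c ` U" "z \<in> d ` V"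
  shows "inv_into (U \<times> V) (map_prod c d) (y, z) = (inv_into U c y, inv_into V d z)"
proof -
  have "inj_on (map_prod c d) (U \<times> V)" using assms by (simp add: map_prod_inj_on)
  then show ?thesis using assms by (intro inv_into_f_eq) (auto simp: inv_into_into f_inv_into_f)
qed

lemma smooth_atlas_prod:
  assumes A: "smooth_atlas A" and B: "smooth_atlas B"
  shows "smooth_atlas (prod_atlas A B)"
proof (rule smooth_atlasI)
  fix T t assume "(T, t) \<in> prod_atlas A B"
  then obtain U c V d where z: "T = U \<times> V" "t = map_prod c d" and U: "(U, c) \<in> A" and V: "(V, d) \<in> B"
    unfolding prod_atlas_def by blast
  note cd = smooth_atlasD[OF A U] smooth_atlasD[OF B V]
  show "inj_on t T" "open (t ` T)"
    using cd by (simp_all add: z map_prod_inj_on map_prod_surj_on[OF refl refl] open_Times)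
  fix T' t' assume "(T', t') \<in> prod_atlas A B"
  then obtain U' c' V' d' where z': "T' = U' \<times> V'" "t' = map_prod c' d'" and U': "(U', c') \<in> A" and V': "(V', d') \<in> B"
    unfolding prod_atlas_def by blast
  have im: "map_prod c d ` ((U \<times> V) \<inter> (U' \<times> V')) = c ` (U \<inter> U') \<times> d ` (V \<inter> V')"
    by (simp add: Times_Int_Times map_prod_surj_on[OF refl refl])
  have o: "open (c ` (U \<inter> U') \<times> d ` (V \<inter> V'))"
    by (intro open_Times smooth_atlas_transition(1)[OF A U U'] smooth_atlas_transition(1)[OF B V V'])
  have "smooth_near (map_prod c' d' \<circ> inv_into (U \<times> V) (map_prod c d)) y"
    if y: "y \<in> c ` (U \<inter> U') \<times> d ` (V \<inter> V')" for y
  proof -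
    have "smooth_near (c' \<circ> inv_into U c) (fst y)" "smooth_near (d' \<circ> inv_into V d) (snd y)"
      using y chart_transition_near[OF A U U'] chart_transition_near[OF B V V'] by auto
    then have "smooth_near (\<lambda>y. ((c' \<circ> inv_into U c) (fst y), (d' \<circ> inv_into V d) (snd y))) y"
      by (intro smooth_near_Pair smooth_near_compose[OF smooth_near_bounded_linear[OF bounded_linear_fst]]
          smooth_near_compose[OF smooth_near_bounded_linear[OF bounded_linear_snd]])
    then show ?thesis
    proof (rule smooth_near_cong)
      show "eventually (\<lambda>y. ((c' \<circ> inv_into U c) (fst y), (d' \<circ> inv_into V d) (snd y)) =
          (map_prod c' d' \<circ> inv_into (U \<times> V) (map_prod c d)) y) (nhds y)"
        unfolding eventually_nhds
        by (rule exI[of _ "c ` (U \<inter> U') \<times> d ` (V \<inter> V')"])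
          (use o y cd in \<open>auto simp: inv_into_map_prod\<close>)
    qed
  qed
  with o show "open (t ` (T \<inter> T'))" "Cinf_on (t ` (T \<inter> T')) (t' \<circ> inv_into T t)"
    by (simp_all add: z z' im Cinf_on_iff_smooth_near)
qed

lemma smooth_at_fst_snd:
  assumes A: "smooth_atlas A" and B: "smooth_atlas B" and p: "p \<in> pts A" "q \<in> pts B"
  shows "smooth_at (prod_atlas A B) A fst (p, q)" "smooth_at (prod_atlas A B) B snd (p, q)"
proof -
  obtain U c where U: "(U, c) \<in> A" "p \<in> U" using p by (auto simp: pts_iff)
  obtain V d where V: "(V, d) \<in> B" "q \<in> V" using p by (auto simp: pts_iff)
  note P = smooth_atlas_prod[OF A B]
  note cd = smooth_atlasD[OF A U(1)] smooth_atlasD[OF B V(1)]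
  have UV: "(U \<times> V, map_prod c d) \<in> prod_atlas A B" "(p, q) \<in> U \<times> V"
    using U V by (auto simp: prod_atlas_def)
  have ev: "eventually (\<lambda>z. z \<in> U \<times> V) (nhdsin (mtop (prod_atlas A B)) (p, q))"
    by (rule eventually_in_open[OF openin_chart_dom[OF P UV(1)] UV(2)])
  have ev': "eventually (\<lambda>y. y \<in> c ` U \<times> d ` V) (nhds (c p, d q))"
    unfolding eventually_nhds
    by (rule exI[of _ "c ` U \<times> d ` V"]) (use cd U V in \<open>auto intro: open_Times\<close>)
  have "smooth_near (c \<circ> fst \<circ> inv_into (U \<times> V) (map_prod c d)) (c p, d q)"
    by (rule smooth_near_cong[OF smooth_near_bounded_linear[OF bounded_linear_fst]])
      (use ev' cd in \<open>auto elim!: eventually_mono simp: inv_into_map_prod f_inv_into_f\<close>)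
  with ev show "smooth_at (prod_atlas A B) A fst (p, q)"
    by (intro smooth_atI[OF P A UV(1) U(1) UV(2)]) (auto elim: eventually_mono)
  have "smooth_near (d \<circ> snd \<circ> inv_into (U \<times> V) (map_prod c d)) (c p, d q)"
    by (rule smooth_near_cong[OF smooth_near_bounded_linear[OF bounded_linear_snd]])
      (use ev' cd in \<open>auto elim!: eventually_mono simp: inv_into_map_prod f_inv_into_f\<close>)
  with ev show "smooth_at (prod_atlas A B) B snd (p, q)"
    by (intro smooth_atI[OF P B UV(1) V(1) UV(2)]) (auto elim: eventually_mono)
qed

lemma smooth_at_fst:
  assumes "smooth_atlas A" "smooth_atlas B" "z \<in> pts (prod_atlas A B)"
  shows "smooth_at (prod_atlas A B) A fst z"
  using smooth_at_fst_snd(1)[OF assms(1,2)] assms(3) by (cases z) (auto simp: pts_prod_atlas)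

lemma smooth_at_snd:
  assumes "smooth_atlas A" "smooth_atlas B" "z \<in> pts (prod_atlas A B)"
  shows "smooth_at (prod_atlas A B) B snd z"
  using smooth_at_fst_snd(2)[OF assms(1,2)] assms(3) by (cases z) (auto simp: pts_prod_atlas)

lemma smooth_at_Pair:
  assumes f: "smooth_at A B f p" and g: "smooth_at A C g p"
  shows "smooth_at A (prod_atlas B C) (\<lambda>x. (f x, g x)) p"
proof -
  note at = smooth_at_atlas[OF f] smooth_at_atlas[OF g]
  obtain U c where U: "(U, c) \<in> A" "p \<in> U" using at by (auto simp: pts_iff)
  obtain V d where V: "(V, d) \<in> B" "f p \<in> V" using at by (auto simp: pts_iff)
  obtain W e where W: "(W, e) \<in> C" "g p \<in> W" using at by (auto simp: pts_iff)
  have VW: "(V \<times> W, map_prod d e) \<in> prod_atlas B C" using V W by (auto simp: prod_atlas_def)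
  have ev: "eventually (\<lambda>x. (f x, g x) \<in> V \<times> W) (nhdsin (mtop A) p)"
    using smooth_at_eventually[OF f eventually_in_open[OF openin_chart_dom[OF at(2) V(1)] V(2)]]
      smooth_at_eventually[OF g eventually_in_open[OF openin_chart_dom[OF at(6) W(1)] W(2)]]
    by eventually_elim simp
  have "smooth_near (map_prod d e \<circ> (\<lambda>x. (f x, g x)) \<circ> inv_into U c) (c p)"
    using smooth_near_Pair[OF smooth_atD[OF f U(1) V(1) U(2) V(2)] smooth_atD[OF g U(1) W(1) U(2) W(2)]]
    by (simp add: comp_def)
  then show ?thesis by (rule smooth_atI[OF at(1) smooth_atlas_prod[OF at(2,6)] U(1) VW U(2) ev])
qed

text \<open>The target of a trivialization is a product with a restricted base. Rewritten as an open
  part of the full product, it has the form that \<open>smooth_map_open_subD\<close>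
  accepts.\<close>

lemma prod_atlas_open_sub: "prod_atlas (open_sub A V) B = open_sub (prod_atlas A B) (V \<times> UNIV)"
proof -
  let ?f = "\<lambda>((U, c), (W, d)). (U \<times> W, map_prod c d)"
  have prod: "prod_atlas C B = ?f ` (C \<times> B)" for C
    unfolding prod_atlas_def by force
  have "open_sub A V \<times> B = map_prod (\<lambda>(U, c). (U \<inter> V, c)) id ` (A \<times> B)"
    unfolding open_sub_image by (rule map_prod_surj_on[OF refl, symmetric]) simp
  then have "prod_atlas (open_sub A V) B = (\<lambda>z. ?f (map_prod (\<lambda>(U, c). (U \<inter> V, c)) id z)) ` (A \<times> B)"
    unfolding prod by (simp only: image_image)
  also have "\<dots> = (\<lambda>z. (\<lambda>(U, c). (U \<inter> (V \<times> UNIV), c)) (?f z)) ` (A \<times> B)"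
    by (rule image_cong) auto
  also have "\<dots> = open_sub (prod_atlas A B) (V \<times> UNIV)"
    unfolding prod open_sub_image by (simp only: image_image)
  finally show ?thesis .
qed

subsection \<open>Vector spaces\<close>

lemma vec_atlas_smooth: "smooth_atlas vec_atlas"
  unfolding smooth_atlas_def vec_atlas_def
  by (simp add: inv_id Cinf_on_iff_smooth_near smooth_near_id id_def comp_def)

lemma pts_vec_atlas [simp]: "pts vec_atlas = UNIV"
  by (simp add: pts_def vec_atlas_def)

lemma eventually_vec: "eventually P (nhdsin (mtop vec_atlas) x) \<longleftrightarrow> eventually P (nhds x)"
  using eventually_chart[OF vec_atlas_smooth, of UNIV id x P] by (simp add: vec_atlas_def inv_id)

lemma openin_vec: "openin (mtop vec_atlas) W \<longleftrightarrow> open W"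
  by (simp add: openin_mtop[OF vec_atlas_smooth]) (simp add: vec_atlas_def)

lemma smooth_at_vec: "smooth_at vec_atlas vec_atlas f x \<longleftrightarrow> smooth_near f x"
proof
  have v: "(UNIV, id) \<in> vec_atlas" by (simp add: vec_atlas_def)
  show "smooth_near f x" if "smooth_at vec_atlas vec_atlas f x"
    using smooth_atD[OF that v v] by (simp add: inv_id)
  show "smooth_at vec_atlas vec_atlas f x" if "smooth_near f x"
    using that by (intro smooth_atI[OF vec_atlas_smooth vec_atlas_smooth v v]) (simp_all add: inv_id)
qed

lemma prod_vec_atlas: "prod_atlas vec_atlas vec_atlas = vec_atlas"
  by (simp add: prod_atlas_def vec_atlas_def prod.map_id0)

lemma smooth_at_vec_compose:
  assumes "smooth_at A vec_atlas f p" "smooth_near g (f p)"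
  shows "smooth_at A vec_atlas (\<lambda>x. g (f x)) p"
  by (rule smooth_at_compose[OF assms(1) smooth_at_vec[THEN iffD2, OF assms(2)]])

lemma smooth_at_times:
  fixes f g :: "'p \<Rightarrow> real"
  assumes "smooth_at A vec_atlas f p" "smooth_at A vec_atlas g p"
  shows "smooth_at A vec_atlas (\<lambda>x. f x * g x) p"
  using smooth_at_vec_compose[OF smooth_at_Pair[OF assms, unfolded prod_vec_atlas]
      smooth_near_bilinear[OF bounded_bilinear_mult smooth_near_bounded_linear[OF bounded_linear_fst]
        smooth_near_bounded_linear[OF bounded_linear_snd]]]
  by simp

lemma smooth_at_add:
  assumes "smooth_at A vec_atlas f p" "smooth_at A vec_atlas g p"
  shows "smooth_at A vec_atlas (\<lambda>x. f x + g x) p"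
  using smooth_at_vec_compose[OF smooth_at_Pair[OF assms, unfolded prod_vec_atlas]
      smooth_near_bounded_linear[OF bounded_linear_add[OF bounded_linear_fst bounded_linear_snd]]]
  by simp

lemma smooth_at_chart:
  assumes "smooth_atlas A" "(U, c) \<in> A" "p \<in> U"
  shows "smooth_at A vec_atlas c p" "smooth_at vec_atlas A (inv_into U c) (c p)"
proof -
  have v: "(UNIV, id) \<in> vec_atlas" by (simp add: vec_atlas_def)
  note near = chart_transition_near[OF assms(1,2,2,3,3)]
  show "smooth_at A vec_atlas c p"
    using near by (intro smooth_atI[OF assms(1) vec_atlas_smooth assms(2) v assms(3)]) simp_all
  have "eventually (\<lambda>y. y \<in> c ` U) (nhds (c p))"
    using smooth_atlasD(2)[OF assms(1,2)] assms(3) by (auto simp: eventually_nhds)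
  then have "eventually (\<lambda>y. inv_into U c y \<in> U) (nhds (c p))"
    by eventually_elim (rule inv_into_into)
  with near show "smooth_at vec_atlas A (inv_into U c) (c p)"
    by (intro smooth_atI[OF vec_atlas_smooth assms(1) v assms(2)])
      (simp_all add: eventually_vec inv_id)
qed

section \<open>Tangent vectors as velocities\<close>

lemma Cinf_iff:
  fixes f :: "'p \<Rightarrow> real"
  assumes "smooth_atlas A"
  shows "f \<in> Cinf A \<longleftrightarrow> (\<forall>p\<in>pts A. smooth_at A vec_atlas f p)"
  by (simp add: Cinf_def smooth_map_iff[OF assms vec_atlas_smooth])

lemma Cinf_compose:
  assumes "f \<in> Cinf B" "smooth_map A B F" "smooth_atlas A" "smooth_atlas B"
  shows "(\<lambda>x. f (F x)) \<in> Cinf A"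
  unfolding Cinf_iff[OF assms(3)]
proof
  fix p assume "p \<in> pts A"
  then have s: "smooth_at A B F p" using assms by (simp add: smooth_map_iff)
  then have "smooth_at B vec_atlas f (F p)"
    using assms(1) smooth_at_atlas(4)[OF s] by (simp add: Cinf_iff[OF assms(4)])
  with s show "smooth_at A vec_atlas (\<lambda>x. f (F x)) p" by (rule smooth_at_compose)
qed

lemma Cinf_cong:
  assumes "smooth_atlas A" "\<And>x. x \<in> pts A \<Longrightarrow> f x = g x"
  shows "f \<in> Cinf A \<longleftrightarrow> g \<in> Cinf A"
  using smooth_map_cong[of A vec_atlas f g] smooth_map_cong[of A vec_atlas g f] assms vec_atlas_smooth
  unfolding Cinf_def by auto

lemma Cinf_slices:
  assumes "f \<in> Cinf (prod_atlas A B)" "smooth_atlas A" "smooth_atlas B"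
  shows "q \<in> pts B \<Longrightarrow> (\<lambda>x. f (x, q)) \<in> Cinf A" "p \<in> pts A \<Longrightarrow> (\<lambda>y. f (p, y)) \<in> Cinf B"
proof -
  note P = smooth_atlas_prod[OF assms(2,3)]
  show "(\<lambda>x. f (x, q)) \<in> Cinf A" if "q \<in> pts B"
    by (rule Cinf_compose[OF assms(1) _ assms(2) P])
      (use that in \<open>auto simp: smooth_map_iff[OF assms(2) P] intro!: smooth_at_Pair smooth_at_id smooth_at_const assms\<close>)
  show "(\<lambda>y. f (p, y)) \<in> Cinf B" if "p \<in> pts A"
    by (rule Cinf_compose[OF assms(1) _ assms(3) P])
      (use that in \<open>auto simp: smooth_map_iff[OF assms(3) P] intro!: smooth_at_Pair smooth_at_id smooth_at_const assms\<close>)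
qed

definition velocity :: "('p, 'v::fd_inner) atlas \<Rightarrow> (real \<Rightarrow> 'p) \<Rightarrow> 'p tvec" where
  "velocity A \<gamma> = (\<lambda>f. if f \<in> Cinf A then deriv (\<lambda>s. f (\<gamma> s)) 0 else 0)"

text \<open>A curve that is smooth at 0 is smooth on some symmetric interval, so germs of curves
  suffice and no interval has to be carried along.\<close>

lemma tangent_iff:
  assumes "smooth_atlas A"
  shows "X \<in> tangent A p \<longleftrightarrow>
    (\<exists>\<gamma>. smooth_at (vec_atlas :: (real, real) atlas) A \<gamma> 0 \<and> \<gamma> 0 = p \<and> X = velocity A \<gamma>)"
proof
  assume "X \<in> tangent A p"
  then obtain \<gamma> a where a: "0 < (a::real)"
    and s: "smooth_map (open_sub (vec_atlas :: (real, real) atlas) {-a<..<a}) A \<gamma>"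
    and "\<gamma> 0 = p" "X = velocity A \<gamma>"
    unfolding tangent_def velocity_def by blast
  moreover have "smooth_at vec_atlas A \<gamma> 0"
    using smooth_map_open_subD(2)[OF vec_atlas_smooth assms, of "{-a<..<a}" UNIV \<gamma> 0] s a
    by (simp add: open_sub_UNIV)
  ultimately show "\<exists>\<gamma>. smooth_at (vec_atlas :: (real, real) atlas) A \<gamma> 0 \<and> \<gamma> 0 = p \<and> X = velocity A \<gamma>"
    by blast
next
  assume "\<exists>\<gamma>. smooth_at (vec_atlas :: (real, real) atlas) A \<gamma> 0 \<and> \<gamma> 0 = p \<and> X = velocity A \<gamma>"
  then obtain \<gamma> where g: "smooth_at (vec_atlas :: (real, real) atlas) A \<gamma> 0" "\<gamma> 0 = p" "X = velocity A \<gamma>"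
    by blast
  have "eventually (smooth_at vec_atlas A \<gamma>) (nhds (0::real))"
    using smooth_at_near[OF g(1)] by (simp only: eventually_vec)
  then obtain a where a: "0 < a" "\<And>s. dist s 0 < a \<Longrightarrow> smooth_at vec_atlas A \<gamma> (s::real)"
    unfolding eventually_nhds_metric by blast
  have "smooth_map (open_sub (vec_atlas :: (real, real) atlas) {-a<..<a}) (open_sub A UNIV) \<gamma>"
    by (rule smooth_map_open_subI) (auto simp: openin_vec vec_atlas_smooth intro!: a(2))
  then have "smooth_map (open_sub (vec_atlas :: (real, real) atlas) {-a<..<a}) A \<gamma>"
    unfolding open_sub_UNIV .
  with a(1) g(2,3) show "X \<in> tangent A p"
    unfolding tangent_def velocity_def by blast
qed

lemma Cinf_curve:
  assumes "smooth_at (vec_atlas :: (real, real) atlas) A \<gamma> 0" "f \<in> Cinf A"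
  shows "smooth_near (\<lambda>s. f (\<gamma> s)) 0"
proof -
  note at = smooth_at_atlas[OF assms(1)]
  have "smooth_at A vec_atlas f (\<gamma> 0)" using assms(2) at by (simp add: Cinf_iff)
  from smooth_at_compose[OF assms(1) this] show ?thesis by (simp add: smooth_at_vec)
qed

text \<open>The chain rule here is associativity of composition, once \<open>f \<circ> F\<close> is
  known to be smooth. Together with \<open>tpair_velocity\<close> it turns the later identities
  between differentials into identities between curves near 0.\<close>

lemma tmap_velocity:
  assumes "smooth_map A B F" "smooth_atlas A" "smooth_atlas B"
  shows "tmap B F (velocity A \<gamma>) = velocity B (\<lambda>s. F (\<gamma> s))"
  using Cinf_compose[OF _ assms] by (auto simp: tmap_def velocity_def fun_eq_iff comp_def)

lemma velocity_const: "velocity A (\<lambda>s. p) = tzero"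
  by (simp add: velocity_def tzero_def fun_eq_iff)

lemma tzero_tangent:
  assumes "smooth_atlas A" "p \<in> pts A"
  shows "tzero \<in> tangent A p"
  unfolding tangent_iff[OF assms(1)]
  by (intro exI[of _ "\<lambda>s. p"] conjI refl smooth_at_const[OF vec_atlas_smooth assms(1) _ assms(2)])
    (simp_all add: velocity_const)

lemma tmap_tangent:
  assumes "smooth_map A B F" "smooth_atlas A" "smooth_atlas B" "X \<in> tangent A p"
  shows "tmap B F X \<in> tangent B (F p)"
proof -
  obtain \<gamma> where g: "smooth_at (vec_atlas :: (real, real) atlas) A \<gamma> 0" "\<gamma> 0 = p" "X = velocity A \<gamma>"
    using assms(4) unfolding tangent_iff[OF assms(2)] by blast
  have "smooth_at A B F (\<gamma> 0)"
    using assms(1) smooth_at_atlas(4)[OF g(1)] by (simp add: smooth_map_iff[OF assms(2,3)])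
  from smooth_at_compose[OF g(1) this] show ?thesis
    unfolding tangent_iff[OF assms(3)] g(3) tmap_velocity[OF assms(1-3)] using g(2) by blast
qed

lemma deriv_along_diagonal:
  fixes F :: "real \<times> real \<Rightarrow> real"
  assumes "F differentiable (at (0, 0))"
  shows "deriv (\<lambda>s. F (s, s)) 0 = deriv (\<lambda>s. F (s, 0)) 0 + deriv (\<lambda>s. F (0, s)) 0"
proof -
  obtain F' where F: "(F has_derivative F') (at (0, 0))"
    using assms unfolding differentiable_def by blast
  then interpret F': linear F' by (rule has_derivative_linear)
  have d: "deriv (\<lambda>s. F (s * a, s * b)) 0 = F' (a, b)" for a b
  proof -
    have c: "((\<lambda>s. (s * a, s * b)) has_derivative (\<lambda>h. (h * a, h * b))) (at 0)"
      by (auto intro!: derivative_eq_intros)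
    have "((\<lambda>s. F (s * a, s * b)) has_derivative (\<lambda>h. F' (h * a, h * b))) (at 0)"
      using has_derivative_compose[OF c, of F F'] F by simp
    moreover have "F' (h * a, h * b) = F' (a, b) * h" for h
      using F'.scaleR[of h "(a, b)"] by (simp add: mult.commute)
    ultimately have "((\<lambda>s. F (s * a, s * b)) has_field_derivative F' (a, b)) (at 0)"
      unfolding has_field_derivative_def by simp
    then show ?thesis by (rule DERIV_imp_deriv)
  qed
  have "F' (1, 1) = F' (1, 0) + F' (0, 1)" using F'.add[of "(1, 0)" "(0, 1)"] by simp
  with d[of 1 1] d[of 1 0] d[of 0 1] show ?thesis by simp
qed

text \<open>The function of two real variables obtained from \<open>f\<close> is differentiated
  along the diagonal, which gives the sum of its partial derivatives. The slices of \<open>f\<close>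
  are smooth, so neither summand falls back to the default value 0 of
  \<open>velocity\<close>.\<close>

lemma tpair_velocity:
  assumes g: "smooth_at (vec_atlas :: (real, real) atlas) A \<gamma> 0"
    and d: "smooth_at (vec_atlas :: (real, real) atlas) B \<delta> 0"
  shows "tpair A B (\<gamma> 0, \<delta> 0) (velocity A \<gamma>) (velocity B \<delta>) = velocity (prod_atlas A B) (\<lambda>s. (\<gamma> s, \<delta> s))"
proof (rule ext)
  fix f
  note at = smooth_at_atlas[OF g] smooth_at_atlas[OF d]
  note P = smooth_atlas_prod[OF at(2,6)]
  show "tpair A B (\<gamma> 0, \<delta> 0) (velocity A \<gamma>) (velocity B \<delta>) f = velocity (prod_atlas A B) (\<lambda>s. (\<gamma> s, \<delta> s)) f"
  proof (cases "f \<in> Cinf (prod_atlas A B)")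
    case True
    let ?F = "\<lambda>z. f (\<gamma> (fst z), \<delta> (snd z))"
    have fst: "smooth_at (vec_atlas :: (real \<times> real, _) atlas) vec_atlas fst (0, 0)"
      and snd: "smooth_at (vec_atlas :: (real \<times> real, _) atlas) vec_atlas snd (0, 0)"
      by (simp_all add: smooth_at_vec smooth_near_bounded_linear bounded_linear_fst bounded_linear_snd)
    have "smooth_at vec_atlas (prod_atlas A B) (\<lambda>z. (\<gamma> (fst z), \<delta> (snd z))) (0, 0)"
      using smooth_at_compose[OF fst, of A \<gamma>] smooth_at_compose[OF snd, of B \<delta>] g d
      by (intro smooth_at_Pair) simp_all
    moreover have "smooth_at (prod_atlas A B) vec_atlas f (\<gamma> 0, \<delta> 0)"
      using True at by (simp add: Cinf_iff[OF P] pts_prod_atlas)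
    ultimately have "smooth_at vec_atlas vec_atlas ?F (0, 0)"
      using smooth_at_compose[of vec_atlas "prod_atlas A B" "\<lambda>z. (\<gamma> (fst z), \<delta> (snd z))" "(0, 0)" vec_atlas f]
      by simp
    then have "?F differentiable (at (0, 0))"
      by (simp add: smooth_at_vec smooth_near_differentiable)
    from deriv_along_diagonal[OF this]
    show ?thesis using True Cinf_slices[OF True at(2,6)] at(4,8)
      by (simp add: tpair_def velocity_def)
  qed (simp add: tpair_def velocity_def)
qed

lemma tpair_tangent:
  assumes "smooth_atlas A" "smooth_atlas B" "X \<in> tangent A (fst z)" "Y \<in> tangent B (snd z)"
  shows "tpair A B z X Y \<in> tangent (prod_atlas A B) z"
proof -
  obtain \<gamma> where g: "smooth_at (vec_atlas :: (real, real) atlas) A \<gamma> 0" "\<gamma> 0 = fst z" "X = velocity A \<gamma>"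
    using assms(3) unfolding tangent_iff[OF assms(1)] by blast
  obtain \<delta> where d: "smooth_at (vec_atlas :: (real, real) atlas) B \<delta> 0" "\<delta> 0 = snd z" "Y = velocity B \<delta>"
    using assms(4) unfolding tangent_iff[OF assms(2)] by blast
  have "z = (\<gamma> 0, \<delta> 0)" using g d by simp
  then show ?thesis
    unfolding tangent_iff[OF smooth_atlas_prod[OF assms(1,2)]]
    using smooth_at_Pair[OF g(1) d(1)] tpair_velocity[OF g(1) d(1)] g(3) d(3) by auto
qed

lemma tangent_not_Cinf: "X \<in> tangent A p \<Longrightarrow> f \<notin> Cinf A \<Longrightarrow> X f = 0"
  unfolding tangent_def by auto

lemma tangent_cong_near:
  assumes "smooth_atlas A" "X \<in> tangent A p" "f \<in> Cinf A" "g \<in> Cinf A"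
    and "eventually (\<lambda>x. f x = g x) (nhdsin (mtop A) p)"
  shows "X f = X g"
proof -
  obtain \<gamma> where g: "smooth_at (vec_atlas :: (real, real) atlas) A \<gamma> 0" "\<gamma> 0 = p" "X = velocity A \<gamma>"
    using assms(2) unfolding tangent_iff[OF assms(1)] by blast
  have "eventually (\<lambda>s. f (\<gamma> s) = g (\<gamma> s)) (nhds 0)"
    using smooth_at_eventually[OF g(1), of "\<lambda>x. f x = g x"] assms(5) g(2) by (simp add: eventually_vec)
  then have "deriv (\<lambda>s. f (\<gamma> s)) 0 = deriv (\<lambda>s. g (\<gamma> s)) 0" by (rule deriv_cong_ev) simp
  with assms(3,4) g(3) show ?thesis by (simp add: velocity_def)
qed

lemma tangent_cong:
  assumes "smooth_atlas A" "X \<in> tangent A p" "\<And>x. x \<in> pts A \<Longrightarrow> f x = g x"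
  shows "X f = X g"
proof (cases "f \<in> Cinf A")
  case True
  moreover have "g \<in> Cinf A" using True Cinf_cong[OF assms(1), of f g] assms(3) by blast
  moreover have "eventually (\<lambda>x. f x = g x) (nhdsin (mtop A) p)"
    using eventually_pts[OF assms(1)] by eventually_elim (rule assms(3))
  ultimately show ?thesis using tangent_cong_near[OF assms(1,2)] by blast
next
  case False
  moreover have "g \<notin> Cinf A" using False Cinf_cong[OF assms(1), of f g] assms(3) by blast
  ultimately show ?thesis using tangent_not_Cinf[OF assms(2)] by metis
qed

lemma tangent_add_const:
  assumes "smooth_atlas A" "X \<in> tangent A p" "f \<in> Cinf A"
  shows "X (\<lambda>x. a + f x) = X f" "(\<lambda>x. a + f x) \<in> Cinf A"
proof -
  show C: "(\<lambda>x. a + f x) \<in> Cinf A"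
    unfolding Cinf_iff[OF assms(1)]
  proof
    fix p assume p: "p \<in> pts A"
    show "smooth_at A vec_atlas (\<lambda>x. a + f x) p"
      using assms(3) p by (intro smooth_at_add smooth_at_const assms(1) vec_atlas_smooth) (auto simp: Cinf_iff[OF assms(1)])
  qed
  obtain \<gamma> where g: "smooth_at (vec_atlas :: (real, real) atlas) A \<gamma> 0" "\<gamma> 0 = p" "X = velocity A \<gamma>"
    using assms(2) unfolding tangent_iff[OF assms(1)] by blast
  have "(\<lambda>s. f (\<gamma> s)) differentiable (at 0)"
    using Cinf_curve[OF g(1) assms(3)] by (rule smooth_near_differentiable)
  then have "((\<lambda>s. f (\<gamma> s)) has_field_derivative deriv (\<lambda>s. f (\<gamma> s)) 0) (at 0)"
    by (simp add: DERIV_deriv_iff_real_differentiable)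
  then have "((\<lambda>s. a + f (\<gamma> s)) has_field_derivative deriv (\<lambda>s. f (\<gamma> s)) 0) (at 0)"
    by (auto intro!: derivative_eq_intros)
  then have "deriv (\<lambda>s. a + f (\<gamma> s)) 0 = deriv (\<lambda>s. f (\<gamma> s)) 0" by (rule DERIV_imp_deriv)
  with C assms(3) g(3) show "X (\<lambda>x. a + f x) = X f" by (simp add: velocity_def)
qed

text \<open>In one direction \<open>v\<close> is the derivative at 0 of the curve in coordinates, in
  the other the curve is a straight line through \<open>c p\<close>. The linear dependence on
  \<open>v\<close> exhibits the vector space structure, which is hidden in the description by
  curves.\<close>

lemma tangent_chart:
  assumes "smooth_atlas A" "(U, c) \<in> A" "p \<in> U"
  shows "X \<in> tangent A p \<longleftrightarrow>
    (\<exists>v. X = (\<lambda>f. if f \<in> Cinf A then frechet_derivative (f \<circ> inv_into U c) (at (c p)) v else 0))"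
proof -
  have p: "p \<in> pts A" using assms by (auto simp: pts_iff)
  have ip: "inv_into U c (c p) = p" using smooth_atlasD(1)[OF assms(1,2)] assms(3) by simp
  have fd: "((f \<circ> inv_into U c) has_derivative frechet_derivative (f \<circ> inv_into U c) (at (c p))) (at (c p))"
    if f: "f \<in> Cinf A" for f
  proof -
    have "smooth_at A vec_atlas f (inv_into U c (c p))" using f p ip by (simp add: Cinf_iff[OF assms(1)])
    then have "smooth_near (f \<circ> inv_into U c) (c p)"
      using smooth_at_compose[OF smooth_at_chart(2)[OF assms], of vec_atlas f] by (simp add: smooth_at_vec comp_def)
    then show ?thesis
      using smooth_near_differentiable frechet_derivative_works by blast
  qed
  show ?thesis
  proof
    assume "X \<in> tangent A p"
    then obtain \<gamma> where g: "smooth_at (vec_atlas :: (real, real) atlas) A \<gamma> 0" "\<gamma> 0 = p" "X = velocity A \<gamma>"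
      unfolding tangent_iff[OF assms(1)] by blast
    have "smooth_near (\<lambda>s. c (\<gamma> s)) 0"
      using smooth_at_compose[OF g(1), of vec_atlas c] smooth_at_chart(1)[OF assms] g(2) by (simp add: smooth_at_vec)
    then obtain D where D: "((\<lambda>s. c (\<gamma> s)) has_derivative D) (at 0)"
      using smooth_near_differentiable differentiable_def by blast
    then interpret D: linear D by (rule has_derivative_linear)
    have "velocity A \<gamma> f = frechet_derivative (f \<circ> inv_into U c) (at (c p)) (D 1)" if f: "f \<in> Cinf A" for f
    proof -
      let ?L = "frechet_derivative (f \<circ> inv_into U c) (at (c p))"
      interpret L: linear ?L by (rule has_derivative_linear[OF fd[OF f]])
      have "((\<lambda>s. (f \<circ> inv_into U c) (c (\<gamma> s))) has_derivative (\<lambda>h. ?L (D h))) (at 0)"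
        using has_derivative_compose[OF D, of "f \<circ> inv_into U c" ?L] fd[OF f] g(2) by simp
      moreover have "(\<lambda>h. ?L (D h)) = (*) (?L (D 1))"
      proof
        fix h
        show "?L (D h) = ?L (D 1) * h" using D.scaleR[of h 1] L.scaleR[of h "D 1"] by simp
      qed
      ultimately have "((\<lambda>s. (f \<circ> inv_into U c) (c (\<gamma> s))) has_field_derivative ?L (D 1)) (at 0)"
        unfolding has_field_derivative_def by simp
      then have "deriv (\<lambda>s. (f \<circ> inv_into U c) (c (\<gamma> s))) 0 = ?L (D 1)" by (rule DERIV_imp_deriv)
      moreover have "eventually (\<lambda>s. (f \<circ> inv_into U c) (c (\<gamma> s)) = f (\<gamma> s)) (nhds 0)"
      proof -
        have "eventually (\<lambda>s. \<gamma> s \<in> U) (nhds 0)"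
          using smooth_at_eventually[OF g(1), of "\<lambda>x. x \<in> U"]
            eventually_in_open[OF openin_chart_dom[OF assms(1,2)] assms(3)] g(2)
          by (simp add: eventually_vec)
        then show ?thesis
          by eventually_elim (simp add: inv_into_f_f[OF smooth_atlasD(1)[OF assms(1,2)]])
      qed
      then have "deriv (\<lambda>s. (f \<circ> inv_into U c) (c (\<gamma> s))) 0 = deriv (\<lambda>s. f (\<gamma> s)) 0"
        by (rule deriv_cong_ev) simp
      ultimately show ?thesis using f by (simp add: velocity_def)
    qed
    then show "\<exists>v. X = (\<lambda>f. if f \<in> Cinf A then frechet_derivative (f \<circ> inv_into U c) (at (c p)) v else 0)"
      unfolding g(3) by (intro exI[of _ "D 1"]) (auto simp: velocity_def)
  next
    assume "\<exists>v. X = (\<lambda>f. if f \<in> Cinf A then frechet_derivative (f \<circ> inv_into U c) (at (c p)) v else 0)"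
    then obtain v where X: "X = (\<lambda>f. if f \<in> Cinf A then frechet_derivative (f \<circ> inv_into U c) (at (c p)) v else 0)"
      by blast
    let ?\<gamma> = "\<lambda>s::real. inv_into U c (c p + s *\<^sub>R v)"
    have l: "smooth_near (\<lambda>s. c p + s *\<^sub>R v) 0"
      using smooth_near_compose[OF smooth_near_Pair[OF smooth_near_const smooth_near_bounded_linear[OF bounded_linear_scaleR_left]]
        smooth_near_bounded_linear[OF bounded_linear_add[OF bounded_linear_fst bounded_linear_snd]], of "c p" v 0]
      by simp
    then have "smooth_at vec_atlas A ?\<gamma> 0"
      using smooth_at_compose[of vec_atlas vec_atlas "\<lambda>s. c p + s *\<^sub>R v" 0 A "inv_into U c"]
        smooth_at_chart(2)[OF assms] by (simp add: smooth_at_vec)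
    moreover have "?\<gamma> 0 = p" using ip by simp
    moreover have "X = velocity A ?\<gamma>"
    proof -
      have "deriv (\<lambda>s. f (?\<gamma> s)) 0 = frechet_derivative (f \<circ> inv_into U c) (at (c p)) v" if f: "f \<in> Cinf A" for f
      proof -
        let ?L = "frechet_derivative (f \<circ> inv_into U c) (at (c p))"
        interpret L: linear ?L by (rule has_derivative_linear[OF fd[OF f]])
        have c: "((\<lambda>s. c p + s *\<^sub>R v) has_derivative (\<lambda>h. h *\<^sub>R v)) (at 0)"
          by (auto intro!: derivative_eq_intros)
        have "((\<lambda>s. (f \<circ> inv_into U c) (c p + s *\<^sub>R v)) has_derivative (\<lambda>h. ?L (h *\<^sub>R v))) (at 0)"
          using has_derivative_compose[OF c, of "f \<circ> inv_into U c" ?L] fd[OF f] by simp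
        moreover have "(\<lambda>h. ?L (h *\<^sub>R v)) = (*) (?L v)"
          by (simp add: fun_eq_iff L.scaleR)
        ultimately have "((\<lambda>s. f (?\<gamma> s)) has_field_derivative ?L v) (at 0)"
          unfolding has_field_derivative_def by simp
        then show ?thesis by (rule DERIV_imp_deriv)
      qed
      then show ?thesis by (auto simp: X velocity_def)
    qed
    ultimately show "X \<in> tangent A p" unfolding tangent_iff[OF assms(1)] by blast
  qed
qed

text \<open>Linear combinations of vectors correspond to linear combinations of their directions in
  one chart. The elements of the variation subbundle are given as such combinations.\<close>

lemma tangent_sum:
  assumes "smooth_atlas A" "p \<in> pts A" "\<And>i. i < (r::nat) \<Longrightarrow> X i \<in> tangent A p"
  shows "(\<lambda>f. \<Sum>i<r. a i * X i f) \<in> tangent A p"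
proof -
  obtain U c where U: "(U, c) \<in> A" "p \<in> U" using assms(2) by (auto simp: pts_iff)
  let ?L = "\<lambda>f. frechet_derivative (f \<circ> inv_into U c) (at (c p))"
  have "\<forall>i\<in>{..<r}. \<exists>v. X i = (\<lambda>f. if f \<in> Cinf A then ?L f v else 0)"
    using assms(3) tangent_chart[OF assms(1) U] by simp
  then obtain v where v: "\<And>i. i < r \<Longrightarrow> X i = (\<lambda>f. if f \<in> Cinf A then ?L f (v i) else 0)"
    unfolding bchoice_iff by auto
  have "(\<Sum>i<r. a i * X i f) = (if f \<in> Cinf A then ?L f (\<Sum>i<r. a i *\<^sub>R v i) else 0)" for f
  proof (cases "f \<in> Cinf A")
    case True
    have "smooth_at A vec_atlas f (inv_into U c (c p))"
      using True assms(2) U smooth_atlasD(1)[OF assms(1) U(1)] by (simp add: Cinf_iff[OF assms(1)])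
    then have "smooth_near (f \<circ> inv_into U c) (c p)"
      using smooth_at_compose[OF smooth_at_chart(2)[OF assms(1) U], of vec_atlas f] by (simp add: smooth_at_vec comp_def)
    then interpret L: linear "?L f"
      by (intro linear_frechet_derivative smooth_near_differentiable)
    show ?thesis using True v by (simp add: L.sum L.scaleR)
  qed (use v in simp)
  then show ?thesis unfolding tangent_chart[OF assms(1) U] by blast
qed

lemma velocity_cong:
  fixes \<gamma> \<delta> :: "real \<Rightarrow> 'p"
  assumes "eventually (\<lambda>s. \<gamma> s = \<delta> s) (nhds 0)"
  shows "velocity A \<gamma> = velocity A \<delta>"
proof -
  have d: "deriv (\<lambda>s. f (\<gamma> s)) 0 = deriv (\<lambda>s. f (\<delta> s)) 0" for f :: "'p \<Rightarrow> real"
    using assms by (intro deriv_cong_ev) (auto elim: eventually_mono)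
  show ?thesis unfolding velocity_def by (intro ext if_cong refl d)
qed

lemma tmap_tzero: "tmap B F tzero = tzero"
  unfolding tmap_def tzero_def by simp

lemma tmap_tadd: "tmap B F (tadd X Y) = tadd (tmap B F X) (tmap B F Y)"
  unfolding tmap_def tadd_def by auto

lemma tpair_tadd: "tpair A B z (tadd X X') Y = tadd (tpair A B z X tzero) (tpair A B z X' Y)"
  unfolding tpair_def tadd_def tzero_def by auto

lemma tadd_tzero: "tadd X tzero = X"
  unfolding tadd_def tzero_def by simp

section \<open>Bump functions on manifolds\<close>

text \<open>A bump function in a chart is extended by 0. It stays smooth at the points outside the
  chart because its support lies in the image \<open>K\<close> of a closed ball, and
  \<open>K\<close>, being compact in a Hausdorff space, is closed in the whole manifold.\<close>

lemma manifold_bump: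
  fixes A :: "('p, 'v::fd_inner) atlas"
  assumes "manifold A" "openin (mtop A) V" "p \<in> V"
  obtains b :: "'p \<Rightarrow> real" and K where "b \<in> Cinf A" "b p = 1" "closedin (mtop A) K" "K \<subseteq> V"
    "\<And>x. x \<in> pts A \<Longrightarrow> x \<notin> K \<Longrightarrow> b x = 0"
proof -
  have A: "smooth_atlas A" and haus: "Hausdorff_space (mtop A)" using assms(1) unfolding manifold_def by auto
  have p: "p \<in> pts A" using assms(2,3) openin_subset topspace_mtop[OF A] by blast
  obtain U c where U: "(U, c) \<in> A" "p \<in> U" using p by (auto simp: pts_iff)
  note inj = smooth_atlasD(1)[OF A U(1)]
  have o: "open (c ` (U \<inter> V))" using assms(2) U unfolding openin_mtop[OF A] by fast
  moreover have "c p \<in> c ` (U \<inter> V)" using U assms(3) by blast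
  ultimately obtain r where r: "0 < r" "cball (c p) r \<subseteq> c ` (U \<inter> V)"
    using open_contains_cball_eq by blast
  obtain b :: "'v \<Rightarrow> real" where b: "\<And>x. smooth_near b x" "b (c p) = 1" "\<And>x. x \<notin> cball (c p) r \<Longrightarrow> b x = 0"
    by (rule fd_bump[OF r(1), of "c p"]) (rule that, assumption+)
  define K where "K = inv_into U c ` cball (c p) r"
  have KU: "K \<subseteq> U \<inter> V"
  proof
    fix x assume "x \<in> K"
    then obtain y where "y \<in> cball (c p) r" "x = inv_into U c y" unfolding K_def by blast
    then obtain z where "z \<in> U \<inter> V" "x = inv_into U c (c z)" using r(2) by blast
    then show "x \<in> U \<inter> V" using inv_into_f_f[OF inj] by auto
  qed
  have "continuous_map (subtopology euclidean (c ` U)) (mtop A) (inv_into U c)"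
    unfolding continuous_map_def topspace_mtop[OF A]
  proof (intro conjI allI impI)
    show "inv_into U c \<in> topspace (subtopology euclidean (c ` U)) \<rightarrow> pts A"
    proof -
      have "U \<subseteq> pts A" using U(1) unfolding pts_def by blast
      then show ?thesis by (auto simp: inv_into_f_f[OF inj])
    qed
    fix W assume W: "openin (mtop A) W"
    have "{x \<in> topspace (subtopology euclidean (c ` U)). inv_into U c x \<in> W} = c ` (U \<inter> W)"
      using inj by (auto simp: image_iff)
    moreover have "open (c ` (U \<inter> W))" using W U unfolding openin_mtop[OF A] by fast
    ultimately show "openin (subtopology euclidean (c ` U)) {x \<in> topspace (subtopology euclidean (c ` U)). inv_into U c x \<in> W}"
      by (simp add: openin_open_eq smooth_atlasD(2)[OF A U(1)] image_mono)
  qed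
  moreover have "compactin (subtopology euclidean (c ` U)) (cball (c p) r)"
    using fd_compact_cball[of "c p" r] r(2) by (auto simp: compactin_subtopology)
  ultimately have "compactin (mtop A) K" unfolding K_def by (rule image_compactin[rotated])
  then have K: "closedin (mtop A) K" by (rule compactin_imp_closedin[OF haus])
  define B :: "'p \<Rightarrow> real" where "B = (\<lambda>x. if x \<in> U then b (c x) else 0)"
  have B0: "B x = 0" if "x \<notin> K" for x
  proof (cases "x \<in> U")
    case True
    then have "c x \<notin> cball (c p) r"
      using that imageI[of "c x" "cball (c p) r" "inv_into U c"] inv_into_f_f[OF inj True] unfolding K_def by auto
    then show ?thesis using b(3) by (simp add: B_def)
  qed (simp add: B_def)
  have "smooth_at A vec_atlas B x" if x: "x \<in> pts A" for x
  proof (cases "x \<in> K")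
    case True
    then have xU: "x \<in> U" using KU by blast
    show ?thesis
    proof (rule smooth_at_cong)
      show "smooth_at A vec_atlas (\<lambda>x. b (c x)) x"
        by (rule smooth_at_vec_compose[OF smooth_at_chart(1)[OF A U(1) xU] b(1)])
      show "eventually (\<lambda>x. b (c x) = B x) (nhdsin (mtop A) x)"
        using eventually_in_open[OF openin_chart_dom[OF A U(1)] xU] by eventually_elim (simp add: B_def)
    qed
  next
    case False
    have "openin (mtop A) (pts A - K)" using K unfolding closedin_def topspace_mtop[OF A] by blast
    then have "eventually (\<lambda>x. x \<in> pts A - K) (nhdsin (mtop A) x)"
      by (rule eventually_in_open) (use False x in blast)
    then have "eventually (\<lambda>x. 0 = B x) (nhdsin (mtop A) x)"
      by eventually_elim (simp add: B0)
    moreover have "smooth_at A vec_atlas (\<lambda>x. 0) x"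
      by (rule smooth_at_const[OF A vec_atlas_smooth x]) simp
    ultimately show ?thesis by (rule smooth_at_cong[rotated])
  qed
  then have "B \<in> Cinf A" by (simp add: Cinf_iff[OF A])
  moreover have "B p = 1" using b(2) U(2) by (simp add: B_def)
  ultimately show ?thesis using that[OF _ _ K] KU B0 by blast
qed

section \<open>Group actions and quotient atlases\<close>

locale orbit_action = group G for G (structure) +
  fixes X :: "'x set" and act :: "'a \<Rightarrow> 'x \<Rightarrow> 'x"
  assumes act_closed: "g \<in> carrier G \<Longrightarrow> x \<in> X \<Longrightarrow> act g x \<in> X"
    and act_one: "x \<in> X \<Longrightarrow> act \<one> x = x"
    and act_mult: "g \<in> carrier G \<Longrightarrow> h \<in> carrier G \<Longrightarrow> x \<in> X \<Longrightarrow> act (g \<otimes> h) x = act g (act h x)"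
begin

lemma act_inv_cancel:
  assumes "g \<in> carrier G" "x \<in> X"
  shows "act (inv g) (act g x) = x" "act g (act (inv g) x) = x"
  using assms act_mult[of "inv g" g x] act_mult[of g "inv g" x] by (simp_all add: act_one)

lemma mem_orbit_iff: "y \<in> orbit G act x \<longleftrightarrow> (\<exists>g\<in>carrier G. y = act g x)"
  unfolding orbit_def by auto

lemma mem_orbit_self: "x \<in> X \<Longrightarrow> x \<in> orbit G act x"
  unfolding mem_orbit_iff by (intro bexI[of _ \<one>]) (simp_all add: act_one)

lemma orbit_act:
  assumes "g \<in> carrier G" "x \<in> X"
  shows "orbit G act (act g x) = orbit G act x"
proof (intro equalityI subsetI)
  fix y assume "y \<in> orbit G act (act g x)"
  then obtain h where h: "h \<in> carrier G" "y = act h (act g x)" unfolding mem_orbit_iff by blast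
  then have "y = act (h \<otimes> g) x" using assms by (simp add: act_mult)
  then show "y \<in> orbit G act x" unfolding mem_orbit_iff using h(1) assms(1) by blast
next
  fix y assume "y \<in> orbit G act x"
  then obtain h where h: "h \<in> carrier G" "y = act h x" unfolding mem_orbit_iff by blast
  then have "y = act (h \<otimes> inv g) (act g x)" using assms by (simp add: act_mult act_closed act_inv_cancel)
  then show "y \<in> orbit G act (act g x)" unfolding mem_orbit_iff using h(1) assms(1) by blast
qed

lemma orbit_eq_iff:
  assumes "x \<in> X" "y \<in> X"
  shows "orbit G act x = orbit G act y \<longleftrightarrow> (\<exists>g\<in>carrier G. y = act g x)"
  using mem_orbit_self[OF assms(2)] orbit_act[OF _ assms(1)] unfolding mem_orbit_iff[symmetric]
  by (metis mem_orbit_iff)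

lemma orbits_iff: "q \<in> orbits G X act \<longleftrightarrow> (\<exists>x\<in>X. q = orbit G act x)"
  unfolding orbits_def by auto

end

lemma smooth_at_app:
  assumes "smooth_map A B f" "smooth_atlas A" "smooth_atlas B" "smooth_at D A g p"
  shows "smooth_at D B (\<lambda>x. f (g x)) p"
  using smooth_at_compose[OF assms(4), of B f] assms(1) smooth_at_atlas(4)[OF assms(4)]
  by (simp add: smooth_map_iff[OF assms(2,3)])

lemma smooth_at_app2:
  assumes "smooth_map (prod_atlas A B) C (\<lambda>(x, y). f x y)" "smooth_atlas C"
    and "smooth_at D A g p" "smooth_at D B h p"
  shows "smooth_at D C (\<lambda>x. f (g x) (h x)) p"
  using smooth_at_app[OF assms(1) smooth_atlas_prod[OF smooth_at_atlas(2)[OF assms(3)] smooth_at_atlas(2)[OF assms(4)]]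
      assms(2) smooth_at_Pair[OF assms(3,4)]] by simp

lemma openin_open_sub_vec:
  fixes T :: "'v::fd_inner set"
  assumes T: "open T" and W: "open W" "W \<subseteq> T"
  shows "openin (mtop (open_sub vec_atlas T)) W"
proof -
  have eq: "open_sub vec_atlas T = {(T, id)}" by (simp add: open_sub_def vec_atlas_def)
  have "smooth_atlas {(T, id :: 'v \<Rightarrow> 'v)}"
  proof (rule smooth_atlasI)
    fix U V and c d :: "'v \<Rightarrow> 'v" assume "(U, c) \<in> {(T, id)}" "(V, d) \<in> {(T, id)}"
    then have U: "U = T" "c = id" "V = T" "d = id" by auto
    have "Ck_on k T (id \<circ> inv_into T id)" for k
      using Ck_on_cong[OF T, of "\<lambda>x. x" "id \<circ> inv_into T id" k]
        Ck_on_id[where k=k and S=T] inv_into_f_f[of id T] by simp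
    then show "Cinf_on (c ` (U \<inter> V)) (d \<circ> inv_into U c)"
      unfolding U Cinf_on_def by simp
  qed (use T in auto)
  then show ?thesis using W by (simp add: eq openin_mtop pts_def Int_absorb1)
qed

locale smooth_action = orbit_action G "pts X" act
  for G :: "('a, 'gv::fd_inner) lie" (structure) and X :: "('x, 'v::fd_inner) atlas" and act +
  assumes atlas: "smooth_atlas X"
begin

abbreviation proj :: "'x \<Rightarrow> 'x set" where
  "proj \<equiv> orbit G act"

lemma quotient_chartD:
  assumes "(U, c) \<in> (quotient_atlas G X act :: ('x set, 'w::fd_inner) atlas)"
  shows "U \<subseteq> orbits G (pts X) act" "inj_on c U" "open (c ` U)" "openin (mtop X) (pts X \<inter> proj -` U)"
    "submersion (open_sub X (proj -` U)) (open_sub vec_atlas (c ` U)) (c \<circ> proj)"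
  using assms unfolding quotient_atlas_def by auto

lemma quotient_chart_near:
  assumes U: "(U, c) \<in> (quotient_atlas G X act :: ('x set, 'w::fd_inner) atlas)" and x: "x \<in> pts X" "proj x \<in> U"
  shows "smooth_at X vec_atlas (\<lambda>x. c (proj x)) x"
    and "eventually (\<lambda>x. x \<in> pts X \<and> proj x \<in> U) (nhdsin (mtop X) x)"
    and "\<exists>s. smooth_at vec_atlas X s (c (proj x)) \<and> s (c (proj x)) = x \<and>
        eventually (\<lambda>y. proj (s y) \<in> U \<and> c (proj (s y)) = y) (nhds (c (proj x)))"
proof -
  note D = quotient_chartD[OF U]
  have sm: "smooth_map (open_sub X (proj -` U)) (open_sub vec_atlas (c ` U)) (c \<circ> proj)"
    using D(5) unfolding submersion_def by blast
  show "smooth_at X vec_atlas (\<lambda>x. c (proj x)) x"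
    using smooth_map_open_subD(2)[OF atlas vec_atlas_smooth sm] x by (simp add: comp_def)
  show ev: "eventually (\<lambda>x. x \<in> pts X \<and> proj x \<in> U) (nhdsin (mtop X) x)"
    using eventually_in_open[OF D(4), of x] x by simp
  have "x \<in> pts (open_sub X (proj -` U))" using x by (simp add: pts_open_sub)
  then obtain W s where s: "smooth_map (open_sub (open_sub vec_atlas (c ` U)) W) (open_sub X (proj -` U)) s"
    "(c \<circ> proj) x \<in> W" "s ((c \<circ> proj) x) = x" "\<forall>y\<in>W. (c \<circ> proj) (s y) = y"
    using D(5) unfolding submersion_def by blast
  have xW: "c (proj x) \<in> pts vec_atlas" "c (proj x) \<in> c ` U \<inter> W" using s(2) x(2) by auto
  note s' = smooth_map_open_subD[OF vec_atlas_smooth atlas s(1)[unfolded open_sub_open_sub]]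
  have "eventually (\<lambda>y. y \<in> c ` U \<inter> W) (nhds (c (proj x)))"
    using s'(3)[OF xW] by (simp only: eventually_vec)
  then have "eventually (\<lambda>y. proj (s y) \<in> U \<and> c (proj (s y)) = y) (nhds (c (proj x)))"
  proof eventually_elim
    case (elim y)
    then show ?case using s'(1)[of y] s(4) by simp
  qed
  then show "\<exists>s. smooth_at vec_atlas X s (c (proj x)) \<and> s (c (proj x)) = x \<and>
        eventually (\<lambda>y. proj (s y) \<in> U \<and> c (proj (s y)) = y) (nhds (c (proj x)))"
    using s'(2)[OF xW] s(3) by (intro exI[of _ s]) simp
qed

text \<open>Near a given point the transition map is \<open>d \<circ> proj \<circ> s\<close> for a
  local section \<open>s\<close> of \<open>c \<circ> proj\<close>. Two charts are compatible because
  both are tested against the same projection.\<close>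

lemma quotient_atlas_smooth: "smooth_atlas (quotient_atlas G X act :: ('x set, 'w::fd_inner) atlas)"
proof (rule smooth_atlasI)
  fix U c assume U: "(U, c) \<in> (quotient_atlas G X act :: ('x set, 'w) atlas)"
  show inj: "inj_on c U" and "open (c ` U)" using quotient_chartD[OF U] by blast+
  fix V d assume V: "(V, d) \<in> (quotient_atlas G X act :: ('x set, 'w) atlas)"
  have near: "smooth_near (d \<circ> inv_into U c) y \<and> eventually (\<lambda>z. z \<in> c ` (U \<inter> V)) (nhds y)"
    if y: "y \<in> c ` (U \<inter> V)" for y
  proof -
    obtain u where u: "u \<in> U" "u \<in> V" "y = c u" using y by blast
    then obtain x where x: "x \<in> pts X" "u = proj x" using quotient_chartD(1)[OF U] orbits_iff by blast
    then obtain s where s: "smooth_at vec_atlas X s y" "s y = x"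
        "eventually (\<lambda>y. proj (s y) \<in> U \<and> c (proj (s y)) = y) (nhds y)"
      using quotient_chart_near(3)[OF U, of x] u by blast
    have "eventually (\<lambda>x. proj x \<in> V) (nhdsin (mtop X) (s y))"
      using quotient_chart_near(2)[OF V, of x] x u s(2) by (auto elim: eventually_mono)
    from smooth_at_eventually[OF s(1) this] have V': "eventually (\<lambda>y. proj (s y) \<in> V) (nhds y)"
      by (simp only: eventually_vec)
    have "smooth_at X vec_atlas (\<lambda>x. d (proj x)) (s y)"
      using quotient_chart_near(1)[OF V, of x] x u s(2) by simp
    then have n: "smooth_near (\<lambda>z. d (proj (s z))) y"
      using smooth_at_compose[OF s(1), of vec_atlas "\<lambda>x. d (proj x)"] by (simp add: smooth_at_vec)
    have "eventually (\<lambda>z. d (proj (s z)) = (d \<circ> inv_into U c) z) (nhds y)"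
      using s(3)
    proof eventually_elim
      case (elim z)
      then have "inv_into U c z = proj (s z)" using inj by (intro inv_into_f_eq) auto
      then show ?case by simp
    qed
    with n have "smooth_near (d \<circ> inv_into U c) y" by (rule smooth_near_cong)
    moreover have "eventually (\<lambda>z. z \<in> c ` (U \<inter> V)) (nhds y)"
      using s(3) V' by eventually_elim (metis IntI imageI)
    ultimately show ?thesis by blast
  qed
  show o: "open (c ` (U \<inter> V))"
  proof (subst open_subopen, intro ballI)
    fix y assume "y \<in> c ` (U \<inter> V)"
    from near[OF this] show "\<exists>T. open T \<and> y \<in> T \<and> T \<subseteq> c ` (U \<inter> V)"
      unfolding eventually_nhds by (auto simp only: subset_iff)
  qed
  show "Cinf_on (c ` (U \<inter> V)) (d \<circ> inv_into U c)"
    using near by (intro Cinf_on_iff_smooth_near[OF o, THEN iffD2]) blast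
qed

lemma pts_quotient_subset: "pts (quotient_atlas G X act :: ('x set, 'w::fd_inner) atlas) \<subseteq> orbits G (pts X) act"
  using quotient_chartD(1) unfolding pts_def by blast

lemma proj_smooth:
  assumes "x \<in> pts X" "proj x \<in> pts (quotient_atlas G X act :: ('x set, 'w::fd_inner) atlas)"
  shows "smooth_at X (quotient_atlas G X act :: ('x set, 'w) atlas) proj x"
proof -
  obtain U c where U: "(U, c) \<in> (quotient_atlas G X act :: ('x set, 'w) atlas)" "proj x \<in> U"
    using assms(2) by (auto simp: pts_iff)
  obtain V d where V: "(V, d) \<in> X" "x \<in> V" using assms(1) by (auto simp: pts_iff)
  have v: "(UNIV, id) \<in> vec_atlas" by (simp add: vec_atlas_def)
  have "smooth_near (c \<circ> proj \<circ> inv_into V d) (d x)"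
    using smooth_atD[OF quotient_chart_near(1)[OF U(1) assms(1) U(2)] V(1) v V(2)] by (simp add: comp_def)
  moreover have "eventually (\<lambda>x. proj x \<in> U) (nhdsin (mtop X) x)"
    using quotient_chart_near(2)[OF U(1) assms(1) U(2)] by (auto elim: eventually_mono)
  ultimately show ?thesis using smooth_atI[OF atlas quotient_atlas_smooth V(1) U(1) V(2)] by blast
qed

text \<open>A section of \<open>c \<circ> proj\<close> composed with the chart \<open>c\<close>;
  injectivity of \<open>c\<close> on its domain turns \<open>c (proj (s (c v))) = c v\<close> into a
  statement about the projection alone.\<close>

lemma quotient_section:
  assumes "x \<in> pts X" "proj x \<in> pts (quotient_atlas G X act :: ('x set, 'w::fd_inner) atlas)"
  obtains \<sigma> where "smooth_at (quotient_atlas G X act :: ('x set, 'w) atlas) X \<sigma> (proj x)" "\<sigma> (proj x) = x"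
    "eventually (\<lambda>v. proj (\<sigma> v) = v) (nhdsin (mtop (quotient_atlas G X act :: ('x set, 'w) atlas)) (proj x))"
proof -
  let ?R = "quotient_atlas G X act :: ('x set, 'w) atlas"
  obtain U c where U: "(U, c) \<in> ?R" "proj x \<in> U" using assms(2) by (auto simp: pts_iff)
  obtain s where s: "smooth_at vec_atlas X s (c (proj x))" "s (c (proj x)) = x"
      "eventually (\<lambda>y. proj (s y) \<in> U \<and> c (proj (s y)) = y) (nhds (c (proj x)))"
    using quotient_chart_near(3)[OF U(1) assms(1) U(2)] by blast
  note c = smooth_at_chart(1)[OF quotient_atlas_smooth U]
  have "smooth_at ?R X (\<lambda>v. s (c v)) (proj x)" by (rule smooth_at_compose[OF c s(1)])
  moreover have "eventually (\<lambda>v. proj (s (c v)) \<in> U \<and> c (proj (s (c v))) = c v) (nhdsin (mtop ?R) (proj x))"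
    by (rule smooth_at_eventually[OF c]) (use s(3) in \<open>simp only: eventually_vec\<close>)
  then have "eventually (\<lambda>v. proj (s (c v)) = v) (nhdsin (mtop ?R) (proj x))"
    using eventually_in_open[OF openin_chart_dom[OF quotient_atlas_smooth U(1)] U(2)]
    by eventually_elim (use quotient_chartD(2)[OF U(1)] in \<open>auto dest: inj_onD\<close>)
  ultimately show ?thesis using that[of "\<lambda>v. s (c v)"] s(2) by blast
qed

text \<open>An invariant map to \<open>B\<close> that separates orbits and has a smooth right inverse turns a chart of \<open>B\<close>
  into a chart of the quotient.\<close>

lemma pts_quotientI:
  fixes B :: "('q, 'w::fd_inner) atlas"
  assumes B: "smooth_atlas B" and x: "x \<in> D" and D: "D \<subseteq> pts X" "openin (mtop X) D"
    "\<And>g y. g \<in> carrier G \<Longrightarrow> y \<in> D \<Longrightarrow> act g y \<in> D"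
    and \<tau>: "\<And>y. y \<in> D \<Longrightarrow> smooth_at X B \<tau> y" "\<And>y g. y \<in> D \<Longrightarrow> g \<in> carrier G \<Longrightarrow> \<tau> (act g y) = \<tau> y"
    and sep: "\<And>y z. y \<in> D \<Longrightarrow> z \<in> D \<Longrightarrow> \<tau> y = \<tau> z \<Longrightarrow> proj y = proj z"
    and \<sigma>: "\<And>y. y \<in> D \<Longrightarrow> smooth_at B X \<sigma> (\<tau> y)" "\<And>y. y \<in> D \<Longrightarrow> \<sigma> (\<tau> y) \<in> D"
      "\<And>y. y \<in> D \<Longrightarrow> eventually (\<lambda>b. \<tau> (\<sigma> b) = b) (nhdsin (mtop B) (\<tau> y))"
    and smooth_act: "\<And>g. g \<in> carrier G \<Longrightarrow> smooth_map X X (act g)"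
  shows "proj x \<in> pts (quotient_atlas G X act :: ('x set, 'w) atlas)"
proof -
  have "\<tau> x \<in> pts B" using smooth_at_atlas(4)[OF \<tau>(1)[OF x]] .
  then obtain V d where V: "(V, d) \<in> B" "\<tau> x \<in> V" by (auto simp: pts_iff)
  note inj = smooth_atlasD(1)[OF B V(1)]
  define D' where "D' = {y \<in> D. \<tau> y \<in> V}"
  define U where "U = proj ` D'"
  \<comment> \<open>\<open>d \<circ> \<tau>\<close> passes to orbits because \<tau> is invariant.
    \<open>SOME\<close> picks a representative, and the fact \<open>c\<close> below shows that the
    choice does not affect the value.\<close>
  define c where "c = (\<lambda>u. d (\<tau> (SOME y. y \<in> D' \<and> proj y = u)))"
  have D'X: "D' \<subseteq> pts X" using D(1) by (auto simp: D'_def)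
  have act_D': "act g y \<in> D'" if "g \<in> carrier G" "y \<in> D'" for g y
    using that D(3) \<tau>(2) by (auto simp: D'_def)
  have proj_D': "y \<in> D' \<longleftrightarrow> proj y \<in> U" if "y \<in> pts X" for y
    using that act_D' D'X orbit_eq_iff[of _ y] unfolding U_def by (auto simp: image_iff) (metis subsetD)
  have \<tau>_eq: "\<tau> y = \<tau> z" if "y \<in> D'" "z \<in> D'" "proj y = proj z" for y z
    using that \<tau>(2) orbit_eq_iff[of y z] D'X unfolding D'_def by (metis (no_types, lifting) mem_Collect_eq subsetD)
  have c: "c (proj y) = d (\<tau> y)" if "y \<in> D'" for y
  proof -
    have "(SOME z. z \<in> D' \<and> proj z = proj y) \<in> D' \<and> proj (SOME z. z \<in> D' \<and> proj z = proj y) = proj y"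
      by (rule someI[of _ y]) (use that in simp)
    then have "\<tau> (SOME z. z \<in> D' \<and> proj z = proj y) = \<tau> y" using \<tau>_eq that by blast
    then show ?thesis by (simp add: c_def)
  qed
  have ev_D: "eventually (\<lambda>z. z \<in> D) (nhdsin (mtop X) y)" if "y \<in> D" for y
    using eventually_in_open[OF D(2) that] .
  have ev_V: "eventually (\<lambda>b. b \<in> V) (nhdsin (mtop B) b)" if "b \<in> V" for b
    using eventually_in_open[OF openin_chart_dom[OF B V(1)] that] .
  have open_D': "openin (mtop X) D'"
  proof (rule openin_mtop_eventually[OF atlas D'X])
    fix y assume y: "y \<in> D'"
    then have "eventually (\<lambda>z. z \<in> D) (nhdsin (mtop X) y)" "eventually (\<lambda>z. \<tau> z \<in> V) (nhdsin (mtop X) y)"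
      using ev_D smooth_at_eventually[OF \<tau>(1) ev_V] unfolding D'_def by blast+
    then show "eventually (\<lambda>z. z \<in> D') (nhdsin (mtop X) y)"
      by eventually_elim (simp add: D'_def)
  qed
  have pre: "pts X \<inter> proj -` U = D'" using proj_D' D'X by blast
  have sec: "smooth_at vec_atlas X (\<lambda>z. \<sigma> (inv_into V d z)) (d (\<tau> y)) \<and>
      eventually (\<lambda>z. \<sigma> (inv_into V d z) \<in> D' \<and> d (\<tau> (\<sigma> (inv_into V d z))) = z) (nhds (d (\<tau> y)))"
    if y: "y \<in> D'" for y
  proof -
    have yD: "y \<in> D" "\<tau> y \<in> V" using y by (auto simp: D'_def)
    have i: "inv_into V d (d (\<tau> y)) = \<tau> y" using inj yD(2) by simp
    have s: "smooth_at vec_atlas X (\<lambda>z. \<sigma> (inv_into V d z)) (d (\<tau> y))"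
      using smooth_at_compose[OF smooth_at_chart(2)[OF B V(1) yD(2)], of X \<sigma>] \<sigma>(1)[OF yD(1)] i by simp
    have "eventually (\<lambda>b. \<sigma> b \<in> D \<and> \<tau> (\<sigma> b) = b \<and> b \<in> V) (nhdsin (mtop B) (\<tau> y))"
      using smooth_at_eventually[OF \<sigma>(1)[OF yD(1)] ev_D[OF \<sigma>(2)[OF yD(1)]]] \<sigma>(3)[OF yD(1)] ev_V[OF yD(2)]
      by eventually_elim simp
    then have "eventually (\<lambda>z. \<sigma> (inv_into V d z) \<in> D \<and> \<tau> (\<sigma> (inv_into V d z)) = inv_into V d z \<and> inv_into V d z \<in> V)
        (nhds (d (\<tau> y)))"
      unfolding eventually_chart[OF B V(1) yD(2)] .
    moreover have "eventually (\<lambda>z. z \<in> d ` V) (nhds (d (\<tau> y)))"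
      using smooth_atlasD(2)[OF B V(1)] yD(2) by (auto simp: eventually_nhds)
    ultimately have "eventually (\<lambda>z. \<sigma> (inv_into V d z) \<in> D' \<and> d (\<tau> (\<sigma> (inv_into V d z))) = z) (nhds (d (\<tau> y)))"
      by eventually_elim (simp add: D'_def f_inv_into_f)
    with s show ?thesis ..
  qed
  have cU: "c ` U = (\<lambda>y. d (\<tau> y)) ` D'" unfolding U_def image_image using c by (auto intro: image_cong)
  have "open (c ` U)"
  proof (subst open_subopen, intro ballI)
    fix z assume "z \<in> c ` U"
    then obtain y where y: "y \<in> D'" "z = d (\<tau> y)" unfolding cU by blast
    have "eventually (\<lambda>z. z \<in> c ` U) (nhds (d (\<tau> y)))"
      using sec[OF y(1), THEN conjunct2] unfolding cU by (auto elim!: eventually_mono intro: rev_image_eqI)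
    then show "\<exists>T. open T \<and> z \<in> T \<and> T \<subseteq> c ` U"
      unfolding eventually_nhds y(2) by (auto simp only: subset_iff)
  qed
  moreover have "inj_on c U"
  proof (rule inj_onI)
    fix u v assume "u \<in> U" "v \<in> U" "c u = c v"
    then obtain y z where "y \<in> D'" "z \<in> D'" "u = proj y" "v = proj z" "d (\<tau> y) = d (\<tau> z)"
      unfolding U_def using c by auto
    then show "u = v" using inj sep[of y z] unfolding D'_def by (auto dest: inj_onD)
  qed
  moreover have "U \<subseteq> orbits G (pts X) act" unfolding U_def orbits_iff subset_iff using D'X by blast
  moreover have "submersion (open_sub X (proj -` U)) (open_sub vec_atlas (c ` U)) (c \<circ> proj)"
    unfolding submersion_def
  proof (intro conjI ballI)
    have cp: "smooth_at X vec_atlas (c \<circ> proj) y" if y: "y \<in> D'" for y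
    proof (rule smooth_at_cong)
      show "smooth_at X vec_atlas (\<lambda>y. d (\<tau> y)) y"
        using y smooth_at_compose[OF \<tau>(1)[of y] smooth_at_chart(1)[OF B V(1)]] by (simp add: D'_def)
      show "eventually (\<lambda>y. d (\<tau> y) = (c \<circ> proj) y) (nhdsin (mtop X) y)"
        using eventually_in_open[OF open_D' y] by eventually_elim (simp add: c)
    qed
    show "smooth_map (open_sub X (proj -` U)) (open_sub vec_atlas (c ` U)) (c \<circ> proj)"
      by (rule smooth_map_open_subI) (use pre open_D' atlas cp proj_D' in auto)
    fix y assume "y \<in> pts (open_sub X (proj -` U))"
    then have y: "y \<in> D'" "y \<in> pts X" using pre by (auto simp: pts_open_sub)
    have yD: "y \<in> D" using y by (simp add: D'_def)
    let ?s = "\<lambda>z. \<sigma> (inv_into V d z)"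
    have i: "inv_into V d (d (\<tau> y)) = \<tau> y" using inj y by (simp add: D'_def)
    have "eventually (\<lambda>z. smooth_at vec_atlas X ?s z) (nhds (d (\<tau> y)))"
      using smooth_at_near[OF sec[OF y(1), THEN conjunct1]] by (simp only: eventually_vec)
    with sec[OF y(1), THEN conjunct2]
    have "eventually (\<lambda>z. ?s z \<in> D' \<and> d (\<tau> (?s z)) = z \<and> smooth_at vec_atlas X ?s z) (nhds (d (\<tau> y)))"
      by eventually_elim simp
    then obtain T where T: "open T" "d (\<tau> y) \<in> T"
        "\<And>z. z \<in> T \<Longrightarrow> ?s z \<in> D' \<and> d (\<tau> (?s z)) = z \<and> smooth_at vec_atlas X ?s z"
      unfolding eventually_nhds by blast
    have \<sigma>D: "\<sigma> (\<tau> y) \<in> D'" using T(3)[OF T(2)] i by simp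
    have "\<tau> (\<sigma> (\<tau> y)) = \<tau> y"
      using eventually_nhdsin_self[OF B smooth_at_atlas(4)[OF \<tau>(1)[OF yD]] \<sigma>(3)[OF yD]] .
    then have "proj (\<sigma> (\<tau> y)) = proj y" using sep[of "\<sigma> (\<tau> y)" y] yD \<sigma>D by (simp add: D'_def)
    \<comment> \<open>A submersion needs a section through \<open>y\<close> itself, while
      \<open>\<sigma> (\<tau> y)\<close> is only some point of the orbit of \<open>y\<close>.
      Translating the section by \<open>g\<close> repairs this.\<close>
    then obtain g where g: "g \<in> carrier G" "y = act g (\<sigma> (\<tau> y))"
      using orbit_eq_iff[of "\<sigma> (\<tau> y)" y] \<sigma>D D'X y(2) by blast
    have TU: "T \<subseteq> c ` U" unfolding cU
    proof
      fix z assume "z \<in> T"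
      then show "z \<in> (\<lambda>y. d (\<tau> y)) ` D'" using T(3) by (intro image_eqI[of _ _ "?s z"]) simp_all
    qed
    let ?S = "\<lambda>z. act g (?s z)"
    have S: "?S z \<in> D'" "c (proj (?S z)) = z" if "z \<in> T" for z
      using T(3)[OF that] act_D'[OF g(1)] c \<tau>(2) g(1) by (auto simp: D'_def)
    have "smooth_map (open_sub vec_atlas T) (open_sub X (proj -` U)) ?S"
    proof (rule smooth_map_open_subI[OF _ vec_atlas_smooth])
      show "openin (mtop vec_atlas) (pts vec_atlas \<inter> T)" using T(1) by (simp add: openin_vec)
      show "?S z \<in> proj -` U" if "z \<in> T" for z using S(1)[OF that] proj_D' D'X by blast
      show "smooth_at vec_atlas X ?S z" if "z \<in> T" for z
        by (rule smooth_at_app[OF smooth_act[OF g(1)] atlas atlas]) (use T(3)[OF that] in blast)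
    qed
    moreover have "openin (mtop (open_sub vec_atlas (c ` U))) T"
      by (rule openin_open_sub_vec[OF \<open>open (c ` U)\<close> T(1) TU])
    moreover have "open_sub (open_sub vec_atlas (c ` U)) T = open_sub vec_atlas T"
      using TU by (simp add: open_sub_open_sub Int_absorb1)
    moreover have "(c \<circ> proj) y = d (\<tau> y)" using c y by simp
    moreover have "?S (d (\<tau> y)) = y" using g(2) i by simp
    ultimately show "\<exists>W s. openin (mtop (open_sub vec_atlas (c ` U))) W \<and> (c \<circ> proj) y \<in> W \<and>
        smooth_map (open_sub (open_sub vec_atlas (c ` U)) W) (open_sub X (proj -` U)) s \<and>
        s ((c \<circ> proj) y) = y \<and> (\<forall>z\<in>W. (c \<circ> proj) (s z) = z)"
      using T(2) S(2) by (intro exI[of _ T] exI[of _ ?S]) simp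
  qed
  ultimately have "(U, c) \<in> (quotient_atlas G X act :: ('x set, 'w) atlas)"
    unfolding quotient_atlas_def using open_D' pre by simp
  moreover have "proj x \<in> U" using x V(2) unfolding U_def D'_def by blast
  ultimately show ?thesis by (auto simp: pts_iff)
qed

end

section \<open>The discrete connection and the reduction map\<close>

context group
begin

lemma mult_inv_mult:
  assumes "x \<in> carrier G" "y \<in> carrier G"
  shows "x \<otimes> (inv x \<otimes> y) = y" "inv x \<otimes> (x \<otimes> y) = y"
  using assms m_assoc[of x "inv x" y] m_assoc[of "inv x" x y] by simp_all

text \<open>With \<open>a\<close> the group coordinate of the base point of \<open>e\<close>, this
  is the invariance of the last component of the map \<tau> in \<open>proj_EG_pts\<close>;
  \<open>conj_cancel\<close> serves to show that this component separates orbits.\<close>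

lemma conj_conj:
  assumes "g \<in> carrier G" "a \<in> carrier G" "w \<in> carrier G"
  shows "inv (g \<otimes> a) \<otimes> (g \<otimes> w \<otimes> inv g) \<otimes> (g \<otimes> a) = inv a \<otimes> w \<otimes> a"
  using assms by (simp add: m_assoc inv_mult_group mult_inv_mult)

lemma conj_cancel:
  assumes "a \<in> carrier G" "w \<in> carrier G" "w' \<in> carrier G"
    and "inv a \<otimes> w \<otimes> a = inv a \<otimes> w' \<otimes> a"
  shows "w = w'"
proof -
  have "inv a \<otimes> w = inv a \<otimes> w'" using assms right_cancel[of a "inv a \<otimes> w" "inv a \<otimes> w'"] by simp
  then show ?thesis using assms Units_l_cancel[of "inv a" w w'] by (simp add: Units_eq)
qed

end

lemma lie_group_smooth_action:
  assumes "lie_group G" "left_action G X act" "smooth_atlas X"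
  shows "smooth_action G X act"
proof -
  have G: "group G" "pts (grp_atlas G) = carrier G" using assms(1) unfolding lie_group_def by auto
  have "(\<lambda>(g, x). act g x) ` pts (prod_atlas (grp_atlas G) X) \<subseteq> pts X"
    using assms(2) unfolding left_action_def smooth_map_def by blast
  then have "act g x \<in> pts X" if "g \<in> carrier G" "x \<in> pts X" for g x
    using that G(2) unfolding pts_prod_atlas by (auto simp: image_subset_iff)
  then show ?thesis
    using assms(2,3) G(1) unfolding left_action_def
    by (intro smooth_action.intro orbit_action.intro orbit_action_axioms.intro smooth_action_axioms.intro) blast+
qed

text \<open>As a function of one entry the action is a constant plus one value of the Lagrangian, so
  its differential in that slot is that of the Lagrangian.\<close>

lemma discrete_action_update:
  assumes "k < length xs"
  shows "discrete_action S (xs[k := y]) = (\<Sum>j\<in>{..<length xs} - {k}. lagr S (xs ! j)) + lagr S y"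
proof -
  have "discrete_action S (xs[k := y]) =
      (\<Sum>j\<in>{..<length xs} - {k}. lagr S (xs[k := y] ! j)) + lagr S (xs[k := y] ! k)"
    unfolding discrete_action_def using assms by (simp add: sum.remove[of _ k])
  also have "(\<Sum>j\<in>{..<length xs} - {k}. lagr S (xs[k := y] ! j)) = (\<Sum>j\<in>{..<length xs} - {k}. lagr S (xs ! j))"
    by (intro sum.cong) auto
  finally show ?thesis using assms by simp
qed

section \<open>The symmetric system: structure maps and their smoothness\<close>

locale symmetric_system =
  fixes G :: "('g, 'gv::fd_inner) lie" (structure)
    and actE :: "'g \<Rightarrow> 'e \<Rightarrow> 'e" and actM :: "'g \<Rightarrow> 'm \<Rightarrow> 'm" and actF :: "'f \<Rightarrow> 'g \<Rightarrow> 'f"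
    and Q :: "('m set, 'qv::fd_inner) atlas"
    and S :: "('e, 'ev::fd_inner, 'm, 'mv::fd_inner, 'f, 'fv::fd_inner) dldps"
    and Hor :: "('m \<times> 'm) set"
  assumes dldps: "is_dldps S"
    and symmetry: "symmetry_group G actE actM actF Q S"
    and conn: "discrete_connection G (base_atlas S) actM Q Hor"
begin

abbreviation "E \<equiv> tot_atlas S"
abbreviation "M \<equiv> base_atlas S"
abbreviation "F \<equiv> fib_atlas S"
abbreviation "GA \<equiv> grp_atlas G"
abbreviation "\<phi> \<equiv> bproj S"
abbreviation "\<pi> \<equiv> orbit G actM"
abbreviation "C1 \<equiv> C1_atlas S"

lemma acts: "acts_on_bundle G actE actM actF Q S"
  using symmetry unfolding symmetry_group_def by (elim conjE)

lemma lie: "lie_group G"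
  using acts unfolding acts_on_bundle_def by (elim conjE)

lemma fbundle: "fiber_bundle S"
  using acts unfolding acts_on_bundle_def by (elim conjE)

lemma left_E: "left_action G E actE"
  using acts unfolding acts_on_bundle_def by (elim conjE)

lemma left_M: "left_action G M actM"
  using acts unfolding acts_on_bundle_def by (elim conjE)

lemma right_F: "right_action G F actF"
  using acts unfolding acts_on_bundle_def by (elim conjE)

lemma free_M: "free_action G M actM"
  using acts unfolding acts_on_bundle_def by (elim conjE)

lemma principal: "principal_bundle G M actM Q"
  using acts unfolding acts_on_bundle_def by (elim conjE)

lemma proj_equiv: "g \<in> carrier G \<Longrightarrow> e \<in> pts E \<Longrightarrow> \<phi> (actE g e) = actM g (\<phi> e)"
  using acts unfolding acts_on_bundle_def by simp

lemma manifold_Q: "manifold Q"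
  using principal unfolding principal_bundle_def by (elim conjE)

sublocale group G
  using lie unfolding lie_group_def by blast

lemma atlases: "smooth_atlas E" "smooth_atlas M" "smooth_atlas F" "smooth_atlas GA" "smooth_atlas Q"
  using fbundle lie manifold_Q unfolding fiber_bundle_def lie_group_def manifold_def by simp_all

lemma atlas_C1: "smooth_atlas C1"
  unfolding C1_atlas_def by (rule smooth_atlas_prod[OF atlases(1,2)])

lemma pts_C1: "pts C1 = pts E \<times> pts M"
  unfolding C1_atlas_def by (rule pts_prod_atlas)

lemma pts_GA: "pts GA = carrier G"
  using lie unfolding lie_group_def by blast

sublocale actE: smooth_action G E actE
  by (rule lie_group_smooth_action[OF lie left_E atlases(1)])

sublocale actM: smooth_action G M actM
  by (rule lie_group_smooth_action[OF lie left_M atlases(2)])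

lemma smooth_bproj: "smooth_map E M \<phi>"
  using fbundle unfolding fiber_bundle_def by (elim conjE)

lemma smooth_quot: "smooth_map M Q \<pi>"
  using principal unfolding principal_bundle_def by (elim conjE)

lemma pts_Q: "pts Q = orbits G (pts M) actM"
  using principal unfolding principal_bundle_def by (elim conjE)

lemma smooth_at_mult:
  assumes "smooth_at D GA g p" "smooth_at D GA h p"
  shows "smooth_at D GA (\<lambda>x. g x \<otimes> h x) p"
proof -
  have "smooth_map (prod_atlas GA GA) GA (\<lambda>(g, h). g \<otimes> h)" using lie unfolding lie_group_def by (elim conjE)
  from smooth_at_app2[OF this atlases(4) assms] show ?thesis .
qed

lemma smooth_at_inv:
  assumes "smooth_at D GA g p"
  shows "smooth_at D GA (\<lambda>x. inv (g x)) p"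
proof -
  have "smooth_map GA GA (\<lambda>g. inv g)" using lie unfolding lie_group_def by (elim conjE)
  from smooth_at_app[OF this atlases(4,4) assms] show ?thesis .
qed

lemma smooth_at_actE:
  assumes "smooth_at D GA g p" "smooth_at D E h p"
  shows "smooth_at D E (\<lambda>x. actE (g x) (h x)) p"
proof -
  have "smooth_map (prod_atlas GA E) E (\<lambda>(g, x). actE g x)" using left_E unfolding left_action_def by (elim conjE)
  from smooth_at_app2[OF this atlases(1) assms] show ?thesis .
qed

lemma smooth_at_actM:
  assumes "smooth_at D GA g p" "smooth_at D M h p"
  shows "smooth_at D M (\<lambda>x. actM (g x) (h x)) p"
proof -
  have "smooth_map (prod_atlas GA M) M (\<lambda>(g, x). actM g x)" using left_M unfolding left_action_def by (elim conjE)
  from smooth_at_app2[OF this atlases(2) assms] show ?thesis .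
qed

lemma smooth_at_actF:
  assumes "smooth_at D F h p" "smooth_at D GA g p"
  shows "smooth_at D F (\<lambda>x. actF (h x) (g x)) p"
proof -
  have "smooth_map (prod_atlas F GA) F (\<lambda>(x, g). actF x g)" using right_F unfolding right_action_def by (elim conjE)
  from smooth_at_app2[OF this atlases(3) assms] show ?thesis .
qed

lemma smooth_at_bproj: "smooth_at D E h p \<Longrightarrow> smooth_at D M (\<lambda>x. \<phi> (h x)) p"
  by (rule smooth_at_app[OF smooth_bproj atlases(1,2)])

lemma smooth_at_quot: "smooth_at D M h p \<Longrightarrow> smooth_at D Q (\<lambda>x. \<pi> (h x)) p"
  by (rule smooth_at_app[OF smooth_quot atlases(2,5)])

lemma smooth_at_group_const: "smooth_atlas D \<Longrightarrow> p \<in> pts D \<Longrightarrow> g \<in> carrier G \<Longrightarrow> smooth_at D GA (\<lambda>x. g) p"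
  by (rule smooth_at_const) (simp_all add: atlases pts_GA)

lemma smooth_map_actE: "g \<in> carrier G \<Longrightarrow> smooth_map E E (actE g)"
  unfolding smooth_map_iff[OF atlases(1,1)]
  by (auto intro!: smooth_at_actE smooth_at_group_const smooth_at_id atlases)

lemma bproj_closed: "e \<in> pts E \<Longrightarrow> \<phi> e \<in> pts M"
  using smooth_bproj unfolding smooth_map_def by blast

lemma quot_closed: "m \<in> pts M \<Longrightarrow> \<pi> m \<in> pts Q"
  using smooth_quot unfolding smooth_map_def by blast

lemma actF_closed: "f \<in> pts F \<Longrightarrow> g \<in> carrier G \<Longrightarrow> actF f g \<in> pts F"
  using right_F unfolding right_action_def smooth_map_def
  by (auto simp: pts_prod_atlas pts_GA image_subset_iff)

lemma actF_mult: "f \<in> pts F \<Longrightarrow> g \<in> carrier G \<Longrightarrow> h \<in> carrier G \<Longrightarrow> actF f (g \<otimes> h) = actF (actF f g) h"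
  and actF_one: "f \<in> pts F \<Longrightarrow> actF f \<one> = f"
  using right_F unfolding right_action_def by simp_all

lemma free_actM: "g \<in> carrier G \<Longrightarrow> m \<in> pts M \<Longrightarrow> actM g m = m \<Longrightarrow> g = \<one>"
  using free_M unfolding free_action_def by blast

lemma free_actM_eq:
  assumes "g \<in> carrier G" "h \<in> carrier G" "m \<in> pts M" "actM g m = actM h m"
  shows "g = h"
proof -
  have "actM (inv h \<otimes> g) m = m"
    using assms by (simp add: actM.act_mult actM.act_inv_cancel)
  then have "inv h \<otimes> g = \<one>" using free_actM assms by simp
  then show ?thesis using assms by (metis inv_closed inv_equality inv_inv)
qed

subsection \<open>Trivializations\<close>

text \<open>The trivialization is repackaged as an equivariant group coordinate \<gamma> and the
  local section \<open>t\<close> of \<pi> that runs through the points with \<gamma> = 1, the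
  preimages of \<open>(q', \<one>)\<close>. The later formulas involve only these two.\<close>

lemma principal_triv:
  assumes "q \<in> pts Q"
  obtains V \<gamma> t where "openin (mtop Q) V" "q \<in> V"
    "\<And>x. x \<in> pts M \<Longrightarrow> \<pi> x \<in> V \<Longrightarrow> smooth_at M GA \<gamma> x"
    "\<And>x g. x \<in> pts M \<Longrightarrow> \<pi> x \<in> V \<Longrightarrow> g \<in> carrier G \<Longrightarrow> \<gamma> (actM g x) = g \<otimes> \<gamma> x"
    "\<And>q'. q' \<in> V \<Longrightarrow> smooth_at Q M t q'" "\<And>q'. q' \<in> V \<Longrightarrow> \<pi> (t q') = q'" "\<And>q'. q' \<in> V \<Longrightarrow> \<gamma> (t q') = \<one>"
proof -
  obtain V \<psi> where V: "openin (mtop Q) V" "q \<in> V"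
    and diff: "diffeo (open_sub M (\<pi> -` V)) (prod_atlas (open_sub Q V) GA) \<psi>"
    and \<psi>: "\<And>x. x \<in> pts M \<Longrightarrow> \<pi> x \<in> V \<Longrightarrow> fst (\<psi> x) = \<pi> x"
      "\<And>x g. x \<in> pts M \<Longrightarrow> \<pi> x \<in> V \<Longrightarrow> g \<in> carrier G \<Longrightarrow> snd (\<psi> (actM g x)) = g \<otimes> snd (\<psi> x)"
    using principal assms unfolding principal_bundle_def by metis
  let ?P = "pts M \<inter> \<pi> -` V"
  let ?i = "inv_into ?P \<psi>"
  note QG = smooth_atlas_prod[OF atlases(5,4)]
  have VQ: "V \<subseteq> pts Q" using openin_subset[OF V(1)] topspace_mtop[OF atlases(5)] by simp
  have bij: "bij_betw \<psi> ?P (V \<times> carrier G)"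
    using diff VQ unfolding diffeo_def prod_atlas_open_sub pts_open_sub pts_prod_atlas pts_GA
    by (simp add: Int_absorb1 Times_Int_Times)
  have sm: "smooth_map (open_sub M (\<pi> -` V)) (open_sub (prod_atlas Q GA) (V \<times> UNIV)) \<psi>"
    and smi: "smooth_map (open_sub (prod_atlas Q GA) (V \<times> UNIV)) (open_sub M (\<pi> -` V)) ?i"
    using diff unfolding diffeo_def prod_atlas_open_sub pts_open_sub by blast+
  show ?thesis
  proof (rule that[of V "\<lambda>x. snd (\<psi> x)" "\<lambda>q'. ?i (q', \<one>)", OF V])
    show "smooth_at M GA (\<lambda>x. snd (\<psi> x)) x" if "x \<in> pts M" "\<pi> x \<in> V" for x
    proof -
      have s: "smooth_at M (prod_atlas Q GA) \<psi> x"
        using smooth_map_open_subD(2)[OF atlases(2) QG sm] that by simp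
      show ?thesis
        using smooth_at_compose[OF s smooth_at_snd[OF atlases(5,4) smooth_at_atlas(4)[OF s]]] by simp
    qed
    show "snd (\<psi> (actM g x)) = g \<otimes> snd (\<psi> x)" if "x \<in> pts M" "\<pi> x \<in> V" "g \<in> carrier G" for x g
      using \<psi>(2) that by blast
    fix q' assume q': "q' \<in> V"
    have mem: "(q', \<one>) \<in> \<psi> ` ?P"
      unfolding bij_betw_imp_surj_on[OF bij] using q' by simp
    then have i: "?i (q', \<one>) \<in> ?P" "\<psi> (?i (q', \<one>)) = (q', \<one>)"
      by (rule inv_into_into, rule f_inv_into_f)
    then show "\<pi> (?i (q', \<one>)) = q'" "snd (\<psi> (?i (q', \<one>))) = \<one>"
      using \<psi>(1)[of "?i (q', \<one>)"] by auto
    have "smooth_at Q (prod_atlas Q GA) (\<lambda>q'. (q', \<one>)) q'"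
      using q' VQ by (intro smooth_at_Pair smooth_at_id smooth_at_group_const atlases) auto
    moreover have "smooth_at (prod_atlas Q GA) M ?i (q', \<one>)"
      using q' VQ by (intro smooth_map_open_subD(2)[OF QG atlases(2) smi]) (auto simp: pts_prod_atlas pts_GA)
    ultimately show "smooth_at Q M (\<lambda>q'. ?i (q', \<one>)) q'" by (rule smooth_at_compose)
  qed
qed

text \<open>Here \<Phi> is the fibre coordinate alone, since the base coordinate of the
  trivialization is \<phi>; \<Psi> inverts the full trivialization. The invariance of
  \<open>U\<close> lets points be moved along orbits without leaving it.\<close>

lemma bundle_triv:
  assumes "m \<in> pts M"
  obtains U \<Phi> \<Psi> where "openin (mtop M) U" "m \<in> U" "\<And>g m. g \<in> carrier G \<Longrightarrow> m \<in> U \<Longrightarrow> actM g m \<in> U"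
    "\<And>e. e \<in> pts E \<Longrightarrow> \<phi> e \<in> U \<Longrightarrow> smooth_at E F \<Phi> e"
    "\<And>e g. e \<in> pts E \<Longrightarrow> \<phi> e \<in> U \<Longrightarrow> g \<in> carrier G \<Longrightarrow> \<Phi> (actE g e) = actF (\<Phi> e) (inv g)"
    "\<And>e e'. e \<in> pts E \<Longrightarrow> e' \<in> pts E \<Longrightarrow> \<phi> e \<in> U \<Longrightarrow> \<phi> e = \<phi> e' \<Longrightarrow> \<Phi> e = \<Phi> e' \<Longrightarrow> e = e'"
    "\<And>m f. m \<in> U \<Longrightarrow> f \<in> pts F \<Longrightarrow> smooth_at (prod_atlas M F) E \<Psi> (m, f)"
    "\<And>m f. m \<in> U \<Longrightarrow> f \<in> pts F \<Longrightarrow> \<phi> (\<Psi> (m, f)) = m \<and> \<Phi> (\<Psi> (m, f)) = f"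
proof -
  obtain U \<Phi> where mU: "m \<in> U" and lt: "local_trivialization S U \<Phi>"
    and inv: "\<And>g. g \<in> carrier G \<Longrightarrow> actM g ` U \<subseteq> U"
    and eq: "\<And>g x. g \<in> carrier G \<Longrightarrow> x \<in> pts E \<Longrightarrow> \<phi> x \<in> U \<Longrightarrow>
      \<Phi> (actE g x) = (actM g (fst (\<Phi> x)), actF (snd (\<Phi> x)) (inv g))"
    using acts assms unfolding acts_on_bundle_def by metis
  have U: "openin (mtop M) U" and fst: "\<And>x. x \<in> pts E \<Longrightarrow> \<phi> x \<in> U \<Longrightarrow> fst (\<Phi> x) = \<phi> x"
    and diff: "diffeo (open_sub E (\<phi> -` U)) (prod_atlas (open_sub M U) F) \<Phi>"
    using lt unfolding local_trivialization_def by blast+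
  let ?P = "pts E \<inter> \<phi> -` U"
  let ?i = "inv_into ?P \<Phi>"
  note MF = smooth_atlas_prod[OF atlases(2,3)]
  have UM: "U \<subseteq> pts M" using openin_subset[OF U] topspace_mtop[OF atlases(2)] by simp
  have bij: "bij_betw \<Phi> ?P (U \<times> pts F)"
    using diff UM unfolding diffeo_def prod_atlas_open_sub pts_open_sub pts_prod_atlas
    by (simp add: Int_absorb1 Times_Int_Times)
  have sm: "smooth_map (open_sub E (\<phi> -` U)) (open_sub (prod_atlas M F) (U \<times> UNIV)) \<Phi>"
    and smi: "smooth_map (open_sub (prod_atlas M F) (U \<times> UNIV)) (open_sub E (\<phi> -` U)) ?i"
    using diff unfolding diffeo_def prod_atlas_open_sub pts_open_sub by blast+
  show ?thesis
  proof (rule that[of U "\<lambda>e. snd (\<Phi> e)" ?i, OF U mU])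
    show "actM g m \<in> U" if "g \<in> carrier G" "m \<in> U" for g m using inv[OF that(1)] that(2) by blast
    show "smooth_at E F (\<lambda>e. snd (\<Phi> e)) e" if "e \<in> pts E" "\<phi> e \<in> U" for e
    proof -
      have s: "smooth_at E (prod_atlas M F) \<Phi> e"
        using smooth_map_open_subD(2)[OF atlases(1) MF sm] that by simp
      show ?thesis
        using smooth_at_compose[OF s smooth_at_snd[OF atlases(2,3) smooth_at_atlas(4)[OF s]]] by simp
    qed
    show "snd (\<Phi> (actE g e)) = actF (snd (\<Phi> e)) (inv g)" if "e \<in> pts E" "\<phi> e \<in> U" "g \<in> carrier G" for e g
      using eq that by simp
    show "e = e'" if "e \<in> pts E" "e' \<in> pts E" "\<phi> e \<in> U" "\<phi> e = \<phi> e'" "snd (\<Phi> e) = snd (\<Phi> e')" for e e'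
    proof -
      have "\<Phi> e = \<Phi> e'" using fst[of e] fst[of e'] that by (simp add: prod_eq_iff)
      then show ?thesis using bij that unfolding bij_betw_def by (auto dest: inj_onD)
    qed
    fix m f assume m: "m \<in> U" and f: "f \<in> pts F"
    then have mem: "(m, f) \<in> \<Phi> ` ?P"
      unfolding bij_betw_imp_surj_on[OF bij] by simp
    then have i: "?i (m, f) \<in> ?P" "\<Phi> (?i (m, f)) = (m, f)"
      by (rule inv_into_into, rule f_inv_into_f)
    then show "\<phi> (?i (m, f)) = m \<and> snd (\<Phi> (?i (m, f))) = f"
      using fst[of "?i (m, f)"] by auto
    show "smooth_at (prod_atlas M F) E ?i (m, f)"
      using m f UM by (intro smooth_map_open_subD(2)[OF MF atlases(1) smi]) (auto simp: pts_prod_atlas)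
  qed
qed

subsection \<open>The discrete connection form\<close>

text \<open>The horizontal lift: the point over \<open>q\<close> that forms a horizontal pair with
  \<open>m\<^sub>0\<close>. The connection form, its smoothness and the local sections of \<Upsilon>
  are all expressed through it.\<close>

definition hor :: "'m \<Rightarrow> 'm set \<Rightarrow> 'm" where
  "hor m\<^sub>0 q = snd (inv_into Hor (map_prod id \<pi>) (m\<^sub>0, q))"

lemma Hor_inj: "inj_on (map_prod id \<pi>) Hor"
  using conn unfolding discrete_connection_def by (elim conjE)

lemma Hor_inv: "g \<in> carrier G \<Longrightarrow> diag actM actM g ` Hor \<subseteq> Hor"
  using conn unfolding discrete_connection_def by (elim conjE) (rule bspec)

lemma Hor_local: "local_diffeo_on_sub (prod_atlas M M) Hor (prod_atlas M Q) (map_prod id \<pi>)"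
  using conn unfolding discrete_connection_def by (elim conjE)

lemma Hor_dom: "{(m\<^sub>0, actM g m\<^sub>1) | m\<^sub>0 m\<^sub>1 g. (m\<^sub>0, m\<^sub>1) \<in> Hor \<and> g \<in> carrier G} = pts M \<times> pts M"
  using conn unfolding discrete_connection_def by (elim conjE)

lemma Hor_subset: "Hor \<subseteq> pts M \<times> pts M"
  using conn unfolding discrete_connection_def embedded_submanifold_def pts_prod_atlas by (elim conjE)

lemma hor_eq:
  assumes "(m\<^sub>0, m\<^sub>1) \<in> Hor"
  shows "hor m\<^sub>0 (\<pi> m\<^sub>1) = m\<^sub>1"
  unfolding hor_def using inv_into_f_f[OF Hor_inj assms] by simp

text \<open>That the domain of the connection is all of \<open>M \<times> M\<close> makes each pair
  \<open>(m\<^sub>0, m)\<close> a horizontal pair with its second entry translated, so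
  \<open>map_prod id \<pi>\<close> maps \<open>Hor\<close> onto
  \<open>M \<times> M/G\<close>.\<close>

lemma hor_props:
  assumes "m\<^sub>0 \<in> pts M" "q \<in> pts Q"
  shows "(m\<^sub>0, hor m\<^sub>0 q) \<in> Hor" "\<pi> (hor m\<^sub>0 q) = q" "hor m\<^sub>0 q \<in> pts M"
proof -
  obtain m where m: "m \<in> pts M" "q = \<pi> m" 
    using assms(2) unfolding pts_Q actM.orbits_iff by (elim bexE) (rule that)
  have "(m\<^sub>0, m) \<in> pts M \<times> pts M" using assms(1) m(1) by simp
  then obtain m\<^sub>1 g where g: "(m\<^sub>0, m\<^sub>1) \<in> Hor" "g \<in> carrier G" "m = actM g m\<^sub>1"
    unfolding Hor_dom[symmetric] by blast
  have "m\<^sub>1 \<in> pts M" using g(1) Hor_subset by blast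
  then have q: "\<pi> m\<^sub>1 = q" using m(2) g actM.orbit_act by simp
  then have "hor m\<^sub>0 q = m\<^sub>1" using hor_eq[OF g(1)] by simp
  then show "(m\<^sub>0, hor m\<^sub>0 q) \<in> Hor" "\<pi> (hor m\<^sub>0 q) = q" "hor m\<^sub>0 q \<in> pts M"
    using g q \<open>m\<^sub>1 \<in> pts M\<close> by simp_all
qed

lemma hor_equiv:
  assumes "m\<^sub>0 \<in> pts M" "q \<in> pts Q" "g \<in> carrier G"
  shows "hor (actM g m\<^sub>0) q = actM g (hor m\<^sub>0 q)"
proof -
  note h = hor_props[OF assms(1,2)]
  have "diag actM actM g (m\<^sub>0, hor m\<^sub>0 q) \<in> Hor"
    using Hor_inv[OF assms(3)] h(1) by blast
  then have "(actM g m\<^sub>0, actM g (hor m\<^sub>0 q)) \<in> Hor" by (simp add: diag_def)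
  from hor_eq[OF this] show ?thesis using actM.orbit_act[OF assms(3) h(3)] h(2) by simp
qed

text \<open>\<open>Hor_local\<close> yields smooth inverses on small pieces of \<open>Hor\<close>
  only; injectivity on all of \<open>Hor\<close> identifies each of them with the global inverse
  behind \<open>hor\<close>.\<close>

lemma smooth_at_hor:
  assumes a: "smooth_at D M a p" and b: "smooth_at D Q b p"
  shows "smooth_at D M (\<lambda>x. hor (a x) (b x)) p"
proof -
  note MM = smooth_atlas_prod[OF atlases(2,2)] and MQ = smooth_atlas_prod[OF atlases(2,5)]
  let ?f = "map_prod id \<pi>"
  note ap = smooth_at_atlas[OF a] smooth_at_atlas[OF b]
  let ?x = "(a p, hor (a p) (b p))"
  note h = hor_props[OF ap(4,8)]
  obtain W where W: "?x \<in> W" and o: "openin (mtop (prod_atlas M Q)) (?f ` (Hor \<inter> W))"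
    and sm: "smooth_map (open_sub (prod_atlas M Q) (?f ` (Hor \<inter> W))) (prod_atlas M M) (inv_into (Hor \<inter> W) ?f)"
    using Hor_local[unfolded local_diffeo_on_sub_def, THEN conjunct2, THEN bspec, OF h(1)] by blast
  have x: "(a p, b p) \<in> ?f ` (Hor \<inter> W)"
    using W h by (intro image_eqI[of _ _ ?x]) auto
  have si: "smooth_at (prod_atlas M Q) (prod_atlas M M) (inv_into (Hor \<inter> W) ?f) (a p, b p)"
    using smooth_map_open_subD(2)[OF MQ MM, of "?f ` (Hor \<inter> W)" UNIV] sm x ap
    by (simp add: open_sub_UNIV pts_prod_atlas)
  have "smooth_at (prod_atlas M Q) M (\<lambda>z. snd (inv_into (Hor \<inter> W) ?f z)) (a p, b p)"
    by (rule smooth_at_compose[OF si smooth_at_snd[OF atlases(2,2) smooth_at_atlas(4)[OF si]]])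
  from smooth_at_compose[OF smooth_at_Pair[OF a b] this]
  have s: "smooth_at D M (\<lambda>x. snd (inv_into (Hor \<inter> W) ?f (a x, b x))) p" by simp
  have "eventually (\<lambda>x. (a x, b x) \<in> ?f ` (Hor \<inter> W)) (nhdsin (mtop D) p)"
    by (rule smooth_at_eventually[OF smooth_at_Pair[OF a b] eventually_in_open[OF o x]])
  then have "eventually (\<lambda>x. snd (inv_into (Hor \<inter> W) ?f (a x, b x)) = hor (a x) (b x)) (nhdsin (mtop D) p)"
  proof eventually_elim
    case (elim x)
    from elim obtain z where z: "(a x, b x) = ?f z" "z \<in> Hor \<inter> W" by (rule imageE)
    have "inj_on ?f (Hor \<inter> W)" using Hor_inj by (rule inj_on_subset) blast
    then have "inv_into (Hor \<inter> W) ?f (a x, b x) = z" "inv_into Hor ?f (a x, b x) = z"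
      unfolding z(1) using z(2) Hor_inj by (simp_all add: inv_into_f_f)
    then show ?case unfolding hor_def by simp
  qed
  with s show ?thesis by (rule smooth_at_cong)
qed

abbreviation "cform \<equiv> conn_form G actM Hor"

text \<open>Trades the definite description for an equation: the form is the group element that
  moves the horizontal point over \<open>\<pi> m\<^sub>1\<close> to \<open>m\<^sub>1\<close>. It
  exists because the two points share an orbit and is unique because \<open>G\<close> acts freely on
  \<open>M\<close>.\<close>

lemma cform_unique:
  assumes "m\<^sub>0 \<in> pts M" "m\<^sub>1 \<in> pts M"
  shows "cform m\<^sub>0 m\<^sub>1 \<in> carrier G" "actM (cform m\<^sub>0 m\<^sub>1) (hor m\<^sub>0 (\<pi> m\<^sub>1)) = m\<^sub>1"
    and "g \<in> carrier G \<Longrightarrow> actM g (hor m\<^sub>0 (\<pi> m\<^sub>1)) = m\<^sub>1 \<Longrightarrow> cform m\<^sub>0 m\<^sub>1 = g"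
proof -
  note h = hor_props[OF assms(1) quot_closed[OF assms(2)]]
  have iff: "(m\<^sub>0, actM (inv g) m\<^sub>1) \<in> Hor \<longleftrightarrow> actM g (hor m\<^sub>0 (\<pi> m\<^sub>1)) = m\<^sub>1" if g: "g \<in> carrier G" for g
  proof
    assume "(m\<^sub>0, actM (inv g) m\<^sub>1) \<in> Hor"
    from hor_eq[OF this] have "hor m\<^sub>0 (\<pi> m\<^sub>1) = actM (inv g) m\<^sub>1"
      using actM.orbit_act[of "inv g" m\<^sub>1] g assms(2) by simp
    then show "actM g (hor m\<^sub>0 (\<pi> m\<^sub>1)) = m\<^sub>1" using actM.act_inv_cancel(2)[OF g assms(2)] by simp
  next
    assume "actM g (hor m\<^sub>0 (\<pi> m\<^sub>1)) = m\<^sub>1"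
    then have "actM (inv g) m\<^sub>1 = hor m\<^sub>0 (\<pi> m\<^sub>1)" using actM.act_inv_cancel(1)[OF g h(3)] by simp
    then show "(m\<^sub>0, actM (inv g) m\<^sub>1) \<in> Hor" using h(1) by simp
  qed
  obtain g0 where g0: "g0 \<in> carrier G" "m\<^sub>1 = actM g0 (hor m\<^sub>0 (\<pi> m\<^sub>1))"
    using actM.orbit_eq_iff[OF h(3) assms(2)] h(2) by blast
  have "cform m\<^sub>0 m\<^sub>1 = g" if "g \<in> carrier G" "actM g (hor m\<^sub>0 (\<pi> m\<^sub>1)) = m\<^sub>1" for g
    unfolding conn_form_def
  proof (rule the_equality)
    show "g \<in> carrier G \<and> (m\<^sub>0, actM (inv g) m\<^sub>1) \<in> Hor" using that iff by blast
    fix g' assume "g' \<in> carrier G \<and> (m\<^sub>0, actM (inv g') m\<^sub>1) \<in> Hor"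
    then have g': "g' \<in> carrier G" "actM g' (hor m\<^sub>0 (\<pi> m\<^sub>1)) = m\<^sub>1" using iff by blast+
    show "g' = g" by (rule free_actM_eq[OF g'(1) that(1) h(3)]) (simp add: g'(2) that(2))
  qed
  then show "g \<in> carrier G \<Longrightarrow> actM g (hor m\<^sub>0 (\<pi> m\<^sub>1)) = m\<^sub>1 \<Longrightarrow> cform m\<^sub>0 m\<^sub>1 = g"
    "cform m\<^sub>0 m\<^sub>1 \<in> carrier G" "actM (cform m\<^sub>0 m\<^sub>1) (hor m\<^sub>0 (\<pi> m\<^sub>1)) = m\<^sub>1"
    using g0 by simp_all
qed

lemma cform_equiv:
  assumes "m\<^sub>0 \<in> pts M" "m\<^sub>1 \<in> pts M" "g \<in> carrier G"
  shows "cform (actM g m\<^sub>0) (actM g m\<^sub>1) = g \<otimes> cform m\<^sub>0 m\<^sub>1 \<otimes> inv g"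
proof (rule cform_unique(3))
  note c = cform_unique(1,2)[OF assms(1,2)]
  note h = hor_props[OF assms(1) quot_closed[OF assms(2)]]
  show "actM g m\<^sub>0 \<in> pts M" "actM g m\<^sub>1 \<in> pts M" "g \<otimes> cform m\<^sub>0 m\<^sub>1 \<otimes> inv g \<in> carrier G"
    using assms c by (simp_all add: actM.act_closed)
  show "actM (g \<otimes> cform m\<^sub>0 m\<^sub>1 \<otimes> inv g) (hor (actM g m\<^sub>0) (\<pi> (actM g m\<^sub>1))) = actM g m\<^sub>1"
    using assms c h quot_closed
    by (simp add: actM.orbit_act hor_equiv actM.act_mult actM.act_closed actM.act_inv_cancel)
qed

lemma cform_hor:
  assumes "m\<^sub>0 \<in> pts M" "q \<in> pts Q" "w \<in> carrier G"
  shows "cform m\<^sub>0 (actM w (hor m\<^sub>0 q)) = w"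
proof -
  note h = hor_props[OF assms(1,2)]
  show ?thesis
    using assms h by (intro cform_unique(3)) (simp_all add: actM.act_closed actM.orbit_act)
qed

text \<open>Since \<gamma> is equivariant, the element that moves the horizontal point to
  \<open>b x\<close> is the quotient of their group coordinates, an explicit smooth
  expression.\<close>

lemma smooth_at_cform:
  assumes a: "smooth_at D M a p" and b: "smooth_at D M b p"
  shows "smooth_at D GA (\<lambda>x. cform (a x) (b x)) p"
proof -
  note ap = smooth_at_atlas[OF a] smooth_at_atlas[OF b]
  have q: "\<pi> (b p) \<in> pts Q" using quot_closed ap by blast
  obtain V \<gamma> t where V: "openin (mtop Q) V" "\<pi> (b p) \<in> V"
    and \<gamma>: "\<And>x. x \<in> pts M \<Longrightarrow> \<pi> x \<in> V \<Longrightarrow> smooth_at M GA \<gamma> x"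
      "\<And>x g. x \<in> pts M \<Longrightarrow> \<pi> x \<in> V \<Longrightarrow> g \<in> carrier G \<Longrightarrow> \<gamma> (actM g x) = g \<otimes> \<gamma> x"
      "\<And>q'. q' \<in> V \<Longrightarrow> smooth_at Q M t q'" "\<And>q'. q' \<in> V \<Longrightarrow> \<pi> (t q') = q'" "\<And>q'. q' \<in> V \<Longrightarrow> \<gamma> (t q') = \<one>"
    by (rule principal_triv[OF q]) (rule that)
  note sh = smooth_at_hor[OF a smooth_at_quot[OF b]]
  note h = hor_props[OF ap(4) q]
  have s: "smooth_at D GA (\<lambda>x. \<gamma> (b x) \<otimes> inv (\<gamma> (hor (a x) (\<pi> (b x))))) p"
    using V(2) h ap
    by (intro smooth_at_mult smooth_at_inv smooth_at_compose[OF b] smooth_at_compose[OF sh] \<gamma>(1)) simp_all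
  have "eventually (\<lambda>x. \<pi> (b x) \<in> V) (nhdsin (mtop D) p)"
    by (rule smooth_at_eventually[OF smooth_at_quot[OF b] eventually_in_open[OF V]])
  moreover have "eventually (\<lambda>x. a x \<in> pts M) (nhdsin (mtop D) p)" "eventually (\<lambda>x. b x \<in> pts M) (nhdsin (mtop D) p)"
    by (rule smooth_at_eventually[OF a eventually_pts[OF atlases(2)]],
        rule smooth_at_eventually[OF b eventually_pts[OF atlases(2)]])
  ultimately have "eventually (\<lambda>x. \<gamma> (b x) \<otimes> inv (\<gamma> (hor (a x) (\<pi> (b x)))) = cform (a x) (b x)) (nhdsin (mtop D) p)"
  proof eventually_elim
    case (elim x)
    note hx = hor_props[OF elim(2) quot_closed[OF elim(3)]]
    note c = cform_unique(1,2)[OF elim(2,3)]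
    have "\<gamma> (hor (a x) (\<pi> (b x))) \<in> carrier G"
      using smooth_at_atlas(4)[OF \<gamma>(1)[OF hx(3)]] hx(2) elim(1) pts_GA by simp
    moreover have "\<gamma> (b x) = cform (a x) (b x) \<otimes> \<gamma> (hor (a x) (\<pi> (b x)))"
      using \<gamma>(2)[OF hx(3) _ c(1)] hx(2) elim(1) c(2) by simp
    ultimately show ?case using c(1) by (simp add: m_assoc)
  qed
  with s show ?thesis by (rule smooth_at_cong)
qed

section \<open>The quotient of \<open>E \<times> G\<close> and the reduction map\<close>

abbreviation "EG \<equiv> prod_atlas E GA"
abbreviation "actEG \<equiv> EG_action G actE"

lemma atlas_EG: "smooth_atlas EG"
  by (rule smooth_atlas_prod[OF atlases(1,4)])

lemma pts_EG: "pts EG = pts E \<times> carrier G"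
  by (simp add: pts_prod_atlas pts_GA)

lemma actEG_simp: "actEG g (e, w) = (actE g e, g \<otimes> w \<otimes> inv g)"
  by (simp add: EG_action_def)

sublocale EG: smooth_action G EG actEG
proof (intro smooth_action.intro orbit_action.intro orbit_action_axioms.intro smooth_action_axioms.intro)
  show "group G" by (rule group_axioms)
  show "smooth_atlas EG" by (rule atlas_EG)
  fix g z assume g: "g \<in> carrier G" and z: "z \<in> pts EG"
  obtain e w where z': "z = (e, w)" by (cases z)
  then have ew: "e \<in> pts E" "w \<in> carrier G" using z pts_EG by auto
  show "actEG g z \<in> pts EG" using g ew by (simp add: z' actEG_simp pts_EG actE.act_closed)
  show "actEG (g \<otimes> h) z = actEG g (actEG h z)" if "h \<in> carrier G" for h
    using g ew that by (simp add: z' actEG_simp actE.act_mult inv_mult_group m_assoc)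
next
  fix z assume "z \<in> pts EG"
  then show "actEG \<one> z = z" by (cases z) (simp add: pts_EG actEG_simp actE.act_one)
qed

abbreviation RT :: "(('e \<times> 'g) set, 'qv \<times> 'fv \<times> 'gv) atlas" where
  "RT \<equiv> quotient_atlas G EG actEG"
abbreviation "CR \<equiv> prod_atlas RT Q"
abbreviation "\<Upsilon> \<equiv> Upsilon G actE actM Hor S"

lemma smooth_at_EG_coords:
  assumes "z \<in> pts EG"
  shows "smooth_at EG E fst z" "smooth_at EG GA snd z"
  using smooth_at_fst[OF atlases(1,4) assms] smooth_at_snd[OF atlases(1,4) assms] .

text \<open>This is where the atlas of the reduced total space is shown to cover the quotient. The
  criterion \<open>pts_quotientI\<close> is applied with the model
  \<open>M/G \<times> F \<times> G\<close>, over the points where trivializations of both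
  \<open>E\<close> and \<open>M\<close> are available.\<close>

lemma proj_EG_pts:
  assumes e0: "e\<^sub>0 \<in> pts E" and w0: "w\<^sub>0 \<in> carrier G"
  shows "EG.proj (e\<^sub>0, w\<^sub>0) \<in> pts RT"
proof -
  obtain U \<Phi> \<Psi> where U: "openin (mtop M) U" "\<phi> e\<^sub>0 \<in> U" and invU: "\<And>g m. g \<in> carrier G \<Longrightarrow> m \<in> U \<Longrightarrow> actM g m \<in> U"
    and \<Phi>: "\<And>e. e \<in> pts E \<Longrightarrow> \<phi> e \<in> U \<Longrightarrow> smooth_at E F \<Phi> e"
      "\<And>e g. e \<in> pts E \<Longrightarrow> \<phi> e \<in> U \<Longrightarrow> g \<in> carrier G \<Longrightarrow> \<Phi> (actE g e) = actF (\<Phi> e) (inv g)"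
      "\<And>e e'. e \<in> pts E \<Longrightarrow> e' \<in> pts E \<Longrightarrow> \<phi> e \<in> U \<Longrightarrow> \<phi> e = \<phi> e' \<Longrightarrow> \<Phi> e = \<Phi> e' \<Longrightarrow> e = e'"
    and \<Psi>: "\<And>m f. m \<in> U \<Longrightarrow> f \<in> pts F \<Longrightarrow> smooth_at (prod_atlas M F) E \<Psi> (m, f)"
      "\<And>m f. m \<in> U \<Longrightarrow> f \<in> pts F \<Longrightarrow> \<phi> (\<Psi> (m, f)) = m \<and> \<Phi> (\<Psi> (m, f)) = f"
    by (rule bundle_triv[OF bproj_closed[OF e0]]) (rule that)
  obtain V \<gamma> t where V: "openin (mtop Q) V" "\<pi> (\<phi> e\<^sub>0) \<in> V"
    and \<gamma>: "\<And>x. x \<in> pts M \<Longrightarrow> \<pi> x \<in> V \<Longrightarrow> smooth_at M GA \<gamma> x"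
      "\<And>x g. x \<in> pts M \<Longrightarrow> \<pi> x \<in> V \<Longrightarrow> g \<in> carrier G \<Longrightarrow> \<gamma> (actM g x) = g \<otimes> \<gamma> x"
    and t: "\<And>q'. q' \<in> V \<Longrightarrow> smooth_at Q M t q'" "\<And>q'. q' \<in> V \<Longrightarrow> \<pi> (t q') = q'" "\<And>q'. q' \<in> V \<Longrightarrow> \<gamma> (t q') = \<one>"
    by (rule principal_triv[OF quot_closed[OF bproj_closed[OF e0]]]) (rule that)
  let ?B = "prod_atlas Q (prod_atlas F GA)"
  note FG = smooth_atlas_prod[OF atlases(3,4)]
  note B = smooth_atlas_prod[OF atlases(5) FG]
  define D where "D = {z \<in> pts EG. \<phi> (fst z) \<in> U \<and> \<pi> (\<phi> (fst z)) \<in> V}"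
  \<comment> \<open>Acting on \<open>(e, w)\<close> by the inverse of
    \<open>\<gamma> (\<phi> e)\<close> gives a representative of the orbit whose group coordinate is
    1; \<tau> lists the base orbit, the fibre coordinate and the group component of that
    representative, and \<sigma> rebuilds it from them.\<close>
  define \<tau> where "\<tau> = (\<lambda>z. (\<pi> (\<phi> (fst z)), actF (\<Phi> (fst z)) (\<gamma> (\<phi> (fst z))),
    inv (\<gamma> (\<phi> (fst z))) \<otimes> snd z \<otimes> \<gamma> (\<phi> (fst z))))"
  define \<sigma> :: "'m set \<times> 'f \<times> 'g \<Rightarrow> 'e \<times> 'g" where "\<sigma> = (\<lambda>b. (\<Psi> (t (fst b), fst (snd b)), snd (snd b)))"
  have Dz: "fst z \<in> pts E" "snd z \<in> carrier G" "\<phi> (fst z) \<in> pts M" "\<phi> (fst z) \<in> U" "\<pi> (\<phi> (fst z)) \<in> V"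
      "z \<in> pts EG" if "z \<in> D" for z
    using that bproj_closed unfolding D_def pts_EG by auto
  have \<gamma>z: "\<gamma> (\<phi> (fst z)) \<in> carrier G" if "z \<in> D" for z
    using smooth_at_atlas(4)[OF \<gamma>(1)] Dz[OF that] pts_GA by auto
  have \<Phi>z: "\<Phi> (fst z) \<in> pts F" if "z \<in> D" for z
    using smooth_at_atlas(4)[OF \<Phi>(1)] Dz[OF that] by auto
  have smM: "smooth_at EG M (\<lambda>z. \<phi> (fst z)) z" if "z \<in> D" for z
    by (rule smooth_at_bproj[OF smooth_at_EG_coords(1)[OF Dz(6)[OF that]]])
  have sm\<gamma>: "smooth_at EG GA (\<lambda>z. \<gamma> (\<phi> (fst z))) z" if "z \<in> D" for z
    using smooth_at_compose[OF smM[OF that] \<gamma>(1)] Dz[OF that] by simp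
  have sm\<Phi>: "smooth_at EG F (\<lambda>z. \<Phi> (fst z)) z" if "z \<in> D" for z
    using smooth_at_compose[OF smooth_at_EG_coords(1) \<Phi>(1)] Dz[OF that] by simp
  \<comment> \<open>The section \<open>t\<close> need not return \<open>m\<close>, but it stays in
    the orbit of \<open>m\<close>, and \<open>U\<close> is invariant.\<close>
  have tU: "t (\<pi> m) \<in> U" if m: "m \<in> pts M" "m \<in> U" "\<pi> m \<in> V" for m
  proof -
    have "t (\<pi> m) \<in> pts M" using smooth_at_atlas(4)[OF t(1)[OF m(3)]] .
    then obtain g where "g \<in> carrier G" "t (\<pi> m) = actM g m"
      using actM.orbit_eq_iff[OF m(1)] t(2)[OF m(3)] by metis
    then show ?thesis using invU m(2) by simp
  qed
  show ?thesis
  proof (rule EG.pts_quotientI[OF B, of "(e\<^sub>0, w\<^sub>0)" D \<tau> \<sigma>])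
    show "(e\<^sub>0, w\<^sub>0) \<in> D" using e0 w0 U V by (simp add: D_def pts_EG)
    show "D \<subseteq> pts EG" by (auto simp: D_def)
    show "openin (mtop EG) D"
    proof (rule openin_mtop_eventually[OF atlas_EG \<open>D \<subseteq> pts EG\<close>])
      fix z assume z: "z \<in> D"
      have "eventually (\<lambda>z. \<phi> (fst z) \<in> U) (nhdsin (mtop EG) z)"
        by (rule smooth_at_eventually[OF smM[OF z] eventually_in_open[OF U(1) Dz(4)[OF z]]])
      moreover have "eventually (\<lambda>z. \<pi> (\<phi> (fst z)) \<in> V) (nhdsin (mtop EG) z)"
        by (rule smooth_at_eventually[OF smooth_at_quot[OF smM[OF z]] eventually_in_open[OF V(1) Dz(5)[OF z]]])
      ultimately show "eventually (\<lambda>z. z \<in> D) (nhdsin (mtop EG) z)"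
        using eventually_pts[OF atlas_EG] by eventually_elim (simp add: D_def)
    qed
    show actD: "actEG g z \<in> D" if g: "g \<in> carrier G" and z: "z \<in> D" for g z
    proof -
      have "fst (actEG g z) = actE g (fst z)" by (cases z) (simp add: actEG_simp)
      then show ?thesis
        using g Dz[OF z] EG.act_closed[OF g Dz(6)[OF z]] invU
        by (simp add: D_def proj_equiv actM.orbit_act)
    qed
    show "smooth_at EG ?B \<tau> z" if z: "z \<in> D" for z
      unfolding \<tau>_def
      by (intro smooth_at_Pair smooth_at_quot smooth_at_actF smooth_at_mult smooth_at_inv
          smM[OF z] sm\<gamma>[OF z] sm\<Phi>[OF z] smooth_at_EG_coords(2)[OF Dz(6)[OF z]])
    show "\<tau> (actEG g z) = \<tau> z" if z: "z \<in> D" and g: "g \<in> carrier G" for z g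
    proof -
      obtain e w where z': "z = (e, w)" by (cases z)
      note d = Dz[OF z, unfolded z' fst_conv snd_conv] \<gamma>z[OF z, unfolded z' fst_conv] \<Phi>z[OF z, unfolded z' fst_conv]
      have "actF (actF (\<Phi> e) (inv g)) (g \<otimes> \<gamma> (\<phi> e)) = actF (\<Phi> e) (inv g \<otimes> (g \<otimes> \<gamma> (\<phi> e)))"
        using d g by (simp add: actF_mult)
      then have "actF (actF (\<Phi> e) (inv g)) (g \<otimes> \<gamma> (\<phi> e)) = actF (\<Phi> e) (\<gamma> (\<phi> e))"
        using d g by (simp add: mult_inv_mult)
      then show ?thesis
        using d g conj_conj[OF g d(7) d(2)]
        by (simp add: \<tau>_def z' actEG_simp proj_equiv actM.orbit_act \<gamma>(2) \<Phi>(2))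
    qed
    show "EG.proj y = EG.proj z" if y: "y \<in> D" and z: "z \<in> D" and eq: "\<tau> y = \<tau> z" for y z
    proof -
      obtain e w where y': "y = (e, w)" by (cases y)
      obtain e' w' where z': "z = (e', w')" by (cases z)
      note dy = Dz[OF y, unfolded y' fst_conv snd_conv] \<gamma>z[OF y, unfolded y' fst_conv] \<Phi>z[OF y, unfolded y' fst_conv]
      note dz = Dz[OF z, unfolded z' fst_conv snd_conv] \<gamma>z[OF z, unfolded z' fst_conv] \<Phi>z[OF z, unfolded z' fst_conv]
      have eqs: "\<pi> (\<phi> e) = \<pi> (\<phi> e')" "actF (\<Phi> e) (\<gamma> (\<phi> e)) = actF (\<Phi> e') (\<gamma> (\<phi> e'))"
          "inv (\<gamma> (\<phi> e)) \<otimes> w \<otimes> \<gamma> (\<phi> e) = inv (\<gamma> (\<phi> e')) \<otimes> w' \<otimes> \<gamma> (\<phi> e')"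
        using eq by (simp_all add: \<tau>_def y' z')
      \<comment> \<open>The first component of \<tau> determines \<open>g\<close>. As the group
        coordinates of the two base points differ by the factor \<open>g\<close>, undoing the
        normalization in the other components gives \<open>actE g e = e'\<close> and the matching
        conjugate of \<open>w\<close>.\<close>
      obtain g where g: "g \<in> carrier G" "\<phi> e' = actM g (\<phi> e)"
        using actM.orbit_eq_iff[OF dy(3) dz(3)] eqs(1) by blast
      have ge: "\<gamma> (\<phi> e') = g \<otimes> \<gamma> (\<phi> e)" using \<gamma>(2)[OF dy(3,5) g(1)] g(2) by simp
      have gec: "g \<otimes> \<gamma> (\<phi> e) \<in> carrier G" using g dy by simp
      have "\<Phi> e' = actF (actF (\<Phi> e') (g \<otimes> \<gamma> (\<phi> e))) (inv (g \<otimes> \<gamma> (\<phi> e)))"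
        using gec dz(8) by (simp add: actF_mult[symmetric] actF_one)
      also have "\<dots> = actF (actF (\<Phi> e) (\<gamma> (\<phi> e))) (inv (g \<otimes> \<gamma> (\<phi> e)))"
        using eqs(2) ge by simp
      also have "\<dots> = actF (\<Phi> e) (\<gamma> (\<phi> e) \<otimes> inv (g \<otimes> \<gamma> (\<phi> e)))"
        using dy gec by (simp add: actF_mult)
      also have "\<gamma> (\<phi> e) \<otimes> inv (g \<otimes> \<gamma> (\<phi> e)) = inv g"
        using dy(7) g(1) by (simp add: inv_mult_group mult_inv_mult)
      also have "actF (\<Phi> e) (inv g) = \<Phi> (actE g e)" using \<Phi>(2)[OF dy(1,4) g(1)] by simp
      finally have "\<Phi> (actE g e) = \<Phi> e'" by simp
      moreover have "\<phi> (actE g e) = \<phi> e'" using proj_equiv[OF g(1) dy(1)] g(2) by simp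
      ultimately have e': "actE g e = e'"
        using \<Phi>(3)[of "actE g e" e'] actE.act_closed[OF g(1) dy(1)] dz(1,4) by simp
      have "inv (g \<otimes> \<gamma> (\<phi> e)) \<otimes> (g \<otimes> w \<otimes> inv g) \<otimes> (g \<otimes> \<gamma> (\<phi> e)) = inv (g \<otimes> \<gamma> (\<phi> e)) \<otimes> w' \<otimes> (g \<otimes> \<gamma> (\<phi> e))"
        using conj_conj[OF g(1) dy(7) dy(2)] eqs(3) ge by simp
      then have "g \<otimes> w \<otimes> inv g = w'"
        using conj_cancel[OF gec _ dz(2)] g(1) dy(2) by simp
      then have "z = actEG g y" using e' by (simp add: y' z' actEG_simp)
      then show ?thesis using EG.orbit_eq_iff[OF dy(6)[folded y'] dz(6)[folded z']] g(1) by blast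
    qed
    fix y assume y: "y \<in> D"
    note d = Dz[OF y] and dg = \<gamma>z[OF y] and dF = \<Phi>z[OF y]
    have ty: "\<tau> y \<in> pts ?B" "fst (\<tau> y) = \<pi> (\<phi> (fst y))" "fst (snd (\<tau> y)) \<in> pts F" "snd (snd (\<tau> y)) \<in> carrier G"
      using d dg dF actF_closed quot_closed by (simp_all add: \<tau>_def pts_prod_atlas pts_GA)
    have c1: "smooth_at ?B Q fst (\<tau> y)" by (rule smooth_at_fst[OF atlases(5) FG ty(1)])
    have c: "smooth_at ?B (prod_atlas F GA) snd (\<tau> y)" by (rule smooth_at_snd[OF atlases(5) FG ty(1)])
    have c2: "smooth_at ?B F (\<lambda>b. fst (snd b)) (\<tau> y)"
      by (rule smooth_at_compose[OF c smooth_at_fst[OF atlases(3,4) smooth_at_atlas(4)[OF c]]])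
    have c3: "smooth_at ?B GA (\<lambda>b. snd (snd b)) (\<tau> y)"
      by (rule smooth_at_compose[OF c smooth_at_snd[OF atlases(3,4) smooth_at_atlas(4)[OF c]]])
    have ct: "smooth_at ?B M (\<lambda>b. t (fst b)) (\<tau> y)"
      using smooth_at_compose[OF c1 t(1)] d ty(2) by simp
    have tUy: "t (fst (\<tau> y)) \<in> U" using tU d ty(2) by simp
    show sm\<sigma>: "smooth_at ?B EG \<sigma> (\<tau> y)"
      unfolding \<sigma>_def
      by (intro smooth_at_Pair c3 smooth_at_compose[OF smooth_at_Pair[OF ct c2] \<Psi>(1)[OF tUy ty(3)]])
    have \<sigma>b: "\<tau> (\<sigma> b) = b \<and> \<sigma> b \<in> D" if b: "fst b \<in> V" "t (fst b) \<in> U" "fst (snd b) \<in> pts F" "snd (snd b) \<in> carrier G" for b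
    proof -
      note p = \<Psi>(2)[OF b(2,3)] and pE = smooth_at_atlas(4)[OF \<Psi>(1)[OF b(2,3)]]
      have "\<tau> (\<sigma> b) = b"
        using b p t(2,3)[OF b(1)] by (simp add: \<tau>_def \<sigma>_def actF_one)
      moreover have "\<sigma> b \<in> D" using b p pE t(2)[OF b(1)] by (simp add: D_def \<sigma>_def pts_EG)
      ultimately show ?thesis ..
    qed
    show "\<sigma> (\<tau> y) \<in> D" using \<sigma>b[of "\<tau> y"] tUy ty d(5) by simp
    have "eventually (\<lambda>b. fst b \<in> V) (nhdsin (mtop ?B) (\<tau> y))"
      by (rule smooth_at_eventually[OF c1 eventually_in_open[OF V(1)]]) (use d ty in simp)
    moreover have "eventually (\<lambda>b. t (fst b) \<in> U) (nhdsin (mtop ?B) (\<tau> y))"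
      by (rule smooth_at_eventually[OF ct eventually_in_open[OF U(1) tUy]])
    moreover have "eventually (\<lambda>b. b \<in> pts ?B) (nhdsin (mtop ?B) (\<tau> y))" by (rule eventually_pts[OF B])
    ultimately show "eventually (\<lambda>b. \<tau> (\<sigma> b) = b) (nhdsin (mtop ?B) (\<tau> y))"
    proof eventually_elim
      case (elim b)
      have "fst (snd b) \<in> pts F" "snd (snd b) \<in> carrier G"
        using elim(3) unfolding pts_prod_atlas pts_GA by auto
      with \<sigma>b[OF elim(1,2)] show ?case by simp
    qed
  next
    fix g assume g: "g \<in> carrier G"
    have "smooth_at EG EG (actEG g) z" if z: "z \<in> pts EG" for z
    proof -
      have "smooth_at EG EG (\<lambda>z. (actE g (fst z), g \<otimes> snd z \<otimes> inv g)) z"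
        using z g by (intro smooth_at_Pair smooth_at_actE smooth_at_mult smooth_at_group_const atlas_EG
            smooth_at_EG_coords) simp_all
      moreover have "(\<lambda>z. (actE g (fst z), g \<otimes> snd z \<otimes> inv g)) = actEG g"
        by (simp add: fun_eq_iff EG_action_def)
      ultimately show ?thesis by simp
    qed
    then show "smooth_map EG EG (actEG g)" unfolding smooth_map_iff[OF atlas_EG atlas_EG] by blast
  qed
qed

lemma atlas_RT: "smooth_atlas RT"
  by (rule EG.quotient_atlas_smooth)

lemma atlas_CR: "smooth_atlas CR"
  by (rule smooth_atlas_prod[OF atlas_RT atlases(5)])

lemma Upsilon_simp: "\<Upsilon> (e, m) = (EG.proj (e, cform (\<phi> e) m), \<pi> m)"
  by (simp add: Upsilon_def)

lemma smooth_Upsilon: "smooth_map C1 CR \<Upsilon>"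
  unfolding smooth_map_iff[OF atlas_C1 atlas_CR]
proof
  fix x assume x: "x \<in> pts C1"
  have c: "smooth_at C1 E fst x" "smooth_at C1 M snd x"
    using smooth_at_fst[OF atlases(1,2)] smooth_at_snd[OF atlases(1,2)] x unfolding C1_atlas_def by blast+
  have z: "smooth_at C1 EG (\<lambda>x. (fst x, cform (\<phi> (fst x)) (snd x))) x"
    by (intro smooth_at_Pair c smooth_at_cform smooth_at_bproj)
  have zp: "(fst x, cform (\<phi> (fst x)) (snd x)) \<in> pts EG" using smooth_at_atlas(4)[OF z] .
  have "smooth_at C1 CR (\<lambda>x. (EG.proj (fst x, cform (\<phi> (fst x)) (snd x)), \<pi> (snd x))) x"
  proof (intro smooth_at_Pair smooth_at_quot c smooth_at_compose[OF z])
    show "smooth_at EG RT EG.proj (fst x, cform (\<phi> (fst x)) (snd x))"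
      using zp proj_EG_pts by (intro EG.proj_smooth zp) (auto simp: pts_EG)
  qed
  moreover have "(\<lambda>x. (EG.proj (fst x, cform (\<phi> (fst x)) (snd x)), \<pi> (snd x))) = \<Upsilon>"
    by (simp add: fun_eq_iff Upsilon_simp)
  ultimately show "smooth_at C1 CR \<Upsilon> x" by simp
qed

text \<open>A local section of the quotient map supplies \<open>(e, w)\<close>. The missing point of
  \<open>M\<close> over \<open>r\<close> must have connection form \<open>w\<close> relative to
  \<open>\<phi> e\<close>, which makes it \<open>actM w (hor (\<phi> e) r)\<close>.\<close>

lemma Upsilon_section:
  assumes z: "z \<in> pts CR"
  obtains \<sigma> where "smooth_at CR C1 \<sigma> z" "eventually (\<lambda>z. \<Upsilon> (\<sigma> z) = z) (nhdsin (mtop CR) z)"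
proof -
  obtain v r where vr: "z = (v, r)" "v \<in> pts RT" "r \<in> pts Q" using z by (cases z) (auto simp: pts_prod_atlas)
  have "v \<in> orbits G (pts EG) actEG" using EG.pts_quotient_subset vr(2) by blast
  then obtain x where x: "x \<in> pts EG" "v = EG.proj x" unfolding EG.orbits_iff by (elim bexE) (rule that)
  obtain s where s: "smooth_at RT EG s v" "s v = x" "eventually (\<lambda>v. EG.proj (s v) = v) (nhdsin (mtop RT) v)"
    by (rule EG.quotient_section[OF x(1) vr(2)[unfolded x(2)], folded x(2)]) (rule that)
  have c: "smooth_at CR RT fst z" "smooth_at CR Q snd z"
    using smooth_at_fst[OF atlas_RT atlases(5) z] smooth_at_snd[OF atlas_RT atlases(5) z] .
  have sz: "smooth_at CR EG (\<lambda>z. s (fst z)) z"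
    using smooth_at_compose[OF c(1)] s(1) vr(1) by simp
  have sE: "smooth_at CR E (\<lambda>z. fst (s (fst z))) z" and sG: "smooth_at CR GA (\<lambda>z. snd (s (fst z))) z"
    using smooth_at_compose[OF sz smooth_at_EG_coords(1)[OF smooth_at_atlas(4)[OF sz]]]
      smooth_at_compose[OF sz smooth_at_EG_coords(2)[OF smooth_at_atlas(4)[OF sz]]] by simp_all
  let ?\<sigma> = "\<lambda>z. (fst (s (fst z)), actM (snd (s (fst z))) (hor (\<phi> (fst (s (fst z)))) (snd z)))"
  have sm: "smooth_at CR C1 ?\<sigma> z"
    unfolding C1_atlas_def by (intro smooth_at_Pair smooth_at_actM smooth_at_hor smooth_at_bproj sE sG c)
  have "eventually (\<lambda>z. EG.proj (s (fst z)) = fst z) (nhdsin (mtop CR) z)"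
    by (rule smooth_at_eventually[OF c(1)]) (use s(3) vr in simp)
  moreover have "eventually (\<lambda>z. s (fst z) \<in> pts EG) (nhdsin (mtop CR) z)"
    by (rule smooth_at_eventually[OF sz eventually_pts[OF atlas_EG]])
  ultimately have "eventually (\<lambda>z. \<Upsilon> (?\<sigma> z) = z) (nhdsin (mtop CR) z)"
    using eventually_pts[OF atlas_CR, of z]
  proof eventually_elim
    case (elim z')
    obtain e w where ew: "s (fst z') = (e, w)" by (cases "s (fst z')")
    have p: "e \<in> pts E" "w \<in> carrier G" "snd z' \<in> pts Q"
      using elim(2,3) ew by (auto simp: pts_GA pts_prod_atlas)
    note h = hor_props[OF bproj_closed[OF p(1)] p(3)]
    show ?case
      using elim(1) p h cform_hor[OF bproj_closed[OF p(1)] p(3,2)]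
      by (simp add: ew Upsilon_simp actM.orbit_act prod_eq_iff)
  qed
  with sm show ?thesis by (rule that)
qed

text \<open>Locally \<open>f'\<close> is \<open>f\<close> along a smooth section of
  \<Upsilon>.\<close>

lemma descent:
  fixes f :: "'e \<times> 'm \<Rightarrow> real"
  assumes f: "f \<in> Cinf C1" and f': "\<And>x. x \<in> pts C1 \<Longrightarrow> f' (\<Upsilon> x) = f x"
  shows "f' \<in> Cinf CR"
  unfolding Cinf_iff[OF atlas_CR]
proof
  fix z assume z: "z \<in> pts CR"
  obtain \<sigma> where \<sigma>: "smooth_at CR C1 \<sigma> z" "eventually (\<lambda>z. \<Upsilon> (\<sigma> z) = z) (nhdsin (mtop CR) z)"
    by (rule Upsilon_section[OF z]) (rule that)
  have "smooth_at CR vec_atlas (\<lambda>z. f (\<sigma> z)) z"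
    using f smooth_at_atlas(4)[OF \<sigma>(1)] unfolding Cinf_iff[OF atlas_C1]
    by (intro smooth_at_compose[OF \<sigma>(1)]) blast
  moreover have "eventually (\<lambda>z. f (\<sigma> z) = f' z) (nhdsin (mtop CR) z)"
    using \<sigma>(2) smooth_at_eventually[OF \<sigma>(1) eventually_pts[OF atlas_C1]]
    by eventually_elim (metis f')
  ultimately show "smooth_at CR vec_atlas f' z" by (rule smooth_at_cong)
qed

section \<open>The fibres of the reduction map\<close>

abbreviation "diagC \<equiv> diag actE actM"

lemma Upsilon_diag:
  assumes "g \<in> carrier G" "x \<in> pts C1"
  shows "\<Upsilon> (diagC g x) = \<Upsilon> x" "diagC g x \<in> pts C1"
proof -
  obtain e m where x: "x = (e, m)" by (cases x)
  then have em: "e \<in> pts E" "m \<in> pts M" using assms(2) pts_C1 by auto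
  show "diagC g x \<in> pts C1" using assms(1) em by (simp add: x diag_def pts_C1 actE.act_closed actM.act_closed)
  have "EG.proj (actEG g (e, cform (\<phi> e) m)) = EG.proj (e, cform (\<phi> e) m)"
    using em bproj_closed cform_unique(1) by (intro EG.orbit_act assms(1)) (simp add: pts_EG)
  then show "\<Upsilon> (diagC g x) = \<Upsilon> x"
    using assms(1) em bproj_closed
    by (simp add: x diag_def Upsilon_simp proj_equiv cform_equiv actEG_simp actM.orbit_act)
qed

text \<open>The first components give \<open>g\<close> with \<open>e' = actE g e\<close> and
  conjugate connection forms. A point of \<open>M\<close> is recovered from its orbit, the point
  \<open>\<phi> e\<close> and the form by moving the horizontal lift, and every ingredient of this
  formula is equivariant, so the same \<open>g\<close> moves \<open>m\<close> to
  \<open>m'\<close>.\<close>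

lemma Upsilon_eqD:
  assumes "x \<in> pts C1" "y \<in> pts C1" "\<Upsilon> x = \<Upsilon> y"
  obtains g where "g \<in> carrier G" "y = diagC g x"
proof -
  obtain e m where x: "x = (e, m)" by (cases x)
  obtain e' m' where y: "y = (e', m')" by (cases y)
  have em: "e \<in> pts E" "m \<in> pts M" "e' \<in> pts E" "m' \<in> pts M" using assms(1,2) pts_C1 x y by auto
  note p = bproj_closed[OF em(1)] bproj_closed[OF em(3)]
  note c = cform_unique(1,2)[OF p(1) em(2)] and c' = cform_unique(1,2)[OF p(2) em(4)]
  have eq: "EG.proj (e, cform (\<phi> e) m) = EG.proj (e', cform (\<phi> e') m')" "\<pi> m = \<pi> m'"
    using assms(3) by (simp_all add: x y Upsilon_simp)
  have "\<exists>g\<in>carrier G. (e', cform (\<phi> e') m') = actEG g (e, cform (\<phi> e) m)"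
    using EG.orbit_eq_iff[THEN iffD1, OF _ _ eq(1)] em c(1) c'(1) by (simp add: pts_EG)
  then obtain g where g: "g \<in> carrier G" "e' = actE g e" "cform (\<phi> e') m' = g \<otimes> cform (\<phi> e) m \<otimes> inv g"
    by (auto simp: actEG_simp)
  note h = hor_props[OF p(1) quot_closed[OF em(2)]]
  have "m' = actM (g \<otimes> cform (\<phi> e) m \<otimes> inv g) (hor (actM g (\<phi> e)) (\<pi> m))"
    using c'(2) g eq(2) em proj_equiv by simp
  also have "\<dots> = actM g m"
    using g(1) c h p(1) quot_closed[OF em(2)]
    by (simp add: hor_equiv actM.act_mult actM.act_closed actM.act_inv_cancel)
  finally show ?thesis using that[OF g(1)] g(2) by (simp add: x y diag_def)
qed

subsection \<open>The reduced system\<close>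

abbreviation "R \<equiv> reduced_system G actE actM Q Hor S"

lemma R_sel: "tot_atlas R = RT" "base_atlas R = Q"
    "bproj R = (\<lambda>v. the_elem ((\<lambda>(e, w). \<pi> (\<phi> e)) ` v))"
    "lagr R = (\<lambda>x'. lagr S (inv_into (pts C1) \<Upsilon> x'))" "kin R = \<Upsilon> ` kin S" "C1_atlas R = CR"
  unfolding reduced_system_def Let_def reduced_bundle_def fbundle.extend_def C1_atlas_def by simp_all

lemma var_R: "var R x' = {\<delta>v. \<exists>x\<in>pts C1. \<exists>\<delta>\<epsilon>\<in>var S x. \<Upsilon> x = x' \<and> \<delta>v \<in> tangent RT (fst x') \<and>
    tpair RT Q x' \<delta>v tzero = tmap CR \<Upsilon> (C1_pair S x \<delta>\<epsilon> tzero)}"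
  unfolding reduced_system_def Let_def reduced_bundle_def fbundle.extend_def C1_atlas_def by simp

lemma corr_R_def: "corr R x' y' \<delta>v = (THE \<delta>u. \<exists>x y \<delta>\<epsilon>. (x, y) \<in> C2_set S \<and> \<Upsilon> x = x' \<and> \<Upsilon> y = y' \<and>
    \<delta>\<epsilon> \<in> var S y \<and> tmap CR \<Upsilon> (C1_pair S y \<delta>\<epsilon> tzero) = tpair RT Q y' \<delta>v tzero \<and>
    \<delta>u = tmap RT (fst \<circ> \<Upsilon>) (C1_pair S x (corr S x y \<delta>\<epsilon>) (tmap M \<phi> \<delta>\<epsilon>)))"
  unfolding reduced_system_def Let_def reduced_bundle_def fbundle.extend_def C1_atlas_def by simp

text \<open>Equivariance of \<phi> makes the image of an orbit a singleton, which gives the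
  \<open>the_elem\<close> in the definition of the projection its meaning.\<close>

lemma bproj_R:
  assumes "z \<in> pts EG"
  shows "bproj R (EG.proj z) = \<pi> (\<phi> (fst z))"
proof -
  obtain e w where z: "z = (e, w)" by (cases z)
  then have e: "e \<in> pts E" using assms by (simp add: pts_EG)
  have "(\<lambda>(e, w). \<pi> (\<phi> e)) ` EG.proj z = {\<pi> (\<phi> e)}"
  proof (intro equalityI subsetI)
    fix q assume "q \<in> (\<lambda>(e, w). \<pi> (\<phi> e)) ` EG.proj z"
    then obtain g where "g \<in> carrier G" "q = \<pi> (\<phi> (actE g e))"
      by (auto simp: EG.mem_orbit_iff z actEG_simp)
    then show "q \<in> {\<pi> (\<phi> e)}" using e by (simp add: proj_equiv actM.orbit_act bproj_closed)
  next
    fix q assume "q \<in> {\<pi> (\<phi> e)}"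
    then show "q \<in> (\<lambda>(e, w). \<pi> (\<phi> e)) ` EG.proj z"
      using EG.mem_orbit_self[OF assms] by (intro image_eqI[of _ _ z]) (simp_all add: z)
  qed
  then show ?thesis by (simp add: R_sel z)
qed

lemma smooth_bproj_R: "smooth_map RT Q (bproj R)"
  unfolding smooth_map_iff[OF atlas_RT atlases(5)]
proof
  fix v assume v: "v \<in> pts RT"
  then have "v \<in> orbits G (pts EG) actEG" using EG.pts_quotient_subset by blast
  then obtain x where x: "x \<in> pts EG" "v = EG.proj x" unfolding EG.orbits_iff by (elim bexE) (rule that)
  obtain s where s: "smooth_at RT EG s v" "s v = x" "eventually (\<lambda>v. EG.proj (s v) = v) (nhdsin (mtop RT) v)"
    by (rule EG.quotient_section[OF x(1) v[unfolded x(2)], folded x(2)]) (rule that)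
  have "smooth_at RT Q (\<lambda>v. \<pi> (\<phi> (fst (s v)))) v"
    by (intro smooth_at_quot smooth_at_bproj
        smooth_at_compose[OF s(1) smooth_at_EG_coords(1)[OF smooth_at_atlas(4)[OF s(1)]]])
  moreover have "eventually (\<lambda>v. \<pi> (\<phi> (fst (s v))) = bproj R v) (nhdsin (mtop RT) v)"
    using s(3) smooth_at_eventually[OF s(1) eventually_pts[OF atlas_EG]]
    by eventually_elim (metis bproj_R)
  ultimately show "smooth_at RT Q (bproj R) v" by (rule smooth_at_cong)
qed

lemma bproj_R_Upsilon:
  assumes "x \<in> pts C1"
  shows "bproj R (fst (\<Upsilon> x)) = \<pi> (\<phi> (fst x))"
proof -
  obtain e m where x: "x = (e, m)" by (cases x)
  then have "(e, cform (\<phi> e) m) \<in> pts EG"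
    using assms by (simp add: pts_C1 pts_EG bproj_closed cform_unique(1))
  from bproj_R[OF this] show ?thesis by (simp add: x Upsilon_simp)
qed

lemma snd_Upsilon: "snd (\<Upsilon> x) = \<pi> (snd x)"
  by (cases x) (simp add: Upsilon_simp)

lemma smooth_Upsilon1: "smooth_map C1 RT (fst \<circ> \<Upsilon>)"
  unfolding smooth_map_iff[OF atlas_C1 atlas_RT]
proof
  fix x assume "x \<in> pts C1"
  then have s: "smooth_at C1 CR \<Upsilon> x" using smooth_Upsilon unfolding smooth_map_iff[OF atlas_C1 atlas_CR] by blast
  show "smooth_at C1 RT (fst \<circ> \<Upsilon>) x"
    using smooth_at_compose[OF s smooth_at_fst[OF atlas_RT atlases(5) smooth_at_atlas(4)[OF s]]]
    by (simp add: comp_def)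
qed

lemma kin_pts: "kin S \<subseteq> pts C1"
  using dldps unfolding is_dldps_def embedded_submanifold_def by (elim conjE)

lemma kin_diag: "g \<in> carrier G \<Longrightarrow> x \<in> kin S \<Longrightarrow> diagC g x \<in> kin S"
  and lagr_diag: "g \<in> carrier G \<Longrightarrow> x \<in> pts C1 \<Longrightarrow> lagr S (diagC g x) = lagr S x"
  and var_diag: "g \<in> carrier G \<Longrightarrow> x \<in> pts C1 \<Longrightarrow> tmap E (actE g) ` var S x = var S (diagC g x)"
  using symmetry unfolding symmetry_group_def by fast+

lemma corr_diag:
  assumes "g \<in> carrier G" "(x, y) \<in> C2_set S" "u \<in> var S y"
  shows "corr S (diagC g x) (diagC g y) (tmap E (actE g) u) = tmap E (actE g) (corr S x y u)"
  using symmetry assms unfolding symmetry_group_def by fast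

text \<open>The subbundle is given by local frames of tangent vectors, so this rests on the closure
  of tangent vectors under linear combinations.\<close>

lemma var_tangent:
  assumes "x \<in> pts C1" "\<delta> \<in> var S x"
  shows "\<delta> \<in> tangent E (fst x)"
proof -
  have "vector_subbundle_pTE S (var S)" using dldps unfolding is_dldps_def by (elim conjE)
  from bspec[OF this[unfolded vector_subbundle_pTE_def] assms(1)]
  obtain W r X where W: "x \<in> W" and X: "\<forall>i<(r::nat). smooth_section_pTE S W (X i)"
    and D: "\<forall>x\<in>W. var S x = {\<lambda>f. \<Sum>i<r. a i * X i x f | a. True} \<and>
           (\<forall>a. (\<lambda>f. \<Sum>i<r. a i * X i x f) = tzero \<longrightarrow> (\<forall>i<r. a i = 0))"
    by (elim exE conjE) (rule that)
  obtain a where a: "\<delta> = (\<lambda>f. \<Sum>i<r. a i * X i x f)" using D[THEN bspec, OF W] assms(2) by blast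
  have "X i x \<in> tangent E (fst x)" if "i < r" for i
    using X W that unfolding smooth_section_pTE_def by blast
  then show ?thesis
    unfolding a using assms(1) pts_C1 by (intro tangent_sum[OF atlases(1)]) auto
qed

lemma corr_tangent:
  assumes "(x, y) \<in> C2_set S" "u \<in> var S y"
  shows "corr S x y u \<in> tangent E (fst x)" "tmap M \<phi> (corr S x y u) = tzero"
proof -
  have "\<forall>(x, y)\<in>C2_set S.
        (\<forall>u\<in>var S y. corr S x y u \<in> tangent E (fst x) \<and> tmap M \<phi> (corr S x y u) = tzero) \<and>
        (\<forall>u\<in>var S y. \<forall>w\<in>var S y. \<forall>a b. corr S x y (tadd (tscale a u) (tscale b w)) =
           tadd (tscale a (corr S x y u)) (tscale b (corr S x y w)))"
    using dldps unfolding is_dldps_def by (elim conjE)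
  from bspec[OF this assms(1)] assms(2)
  show "corr S x y u \<in> tangent E (fst x)" "tmap M \<phi> (corr S x y u) = tzero" by auto
qed

section \<open>Pushing tangent vectors forward along the reduction map\<close>

lemma C1_pair_velocity:
  assumes "X \<in> tangent E (fst x)" "Y \<in> tangent M (snd x)"
  obtains \<gamma> \<delta> where "smooth_at (vec_atlas :: (real, real) atlas) E \<gamma> 0"
    "smooth_at (vec_atlas :: (real, real) atlas) M \<delta> 0" "x = (\<gamma> 0, \<delta> 0)"
    "X = velocity E \<gamma>" "Y = velocity M \<delta>" "C1_pair S x X Y = velocity C1 (\<lambda>s. (\<gamma> s, \<delta> s))"
    "smooth_at (vec_atlas :: (real, real) atlas) C1 (\<lambda>s. (\<gamma> s, \<delta> s)) 0"
proof -
  obtain \<gamma> where g: "smooth_at (vec_atlas :: (real, real) atlas) E \<gamma> 0" "\<gamma> 0 = fst x" "X = velocity E \<gamma>"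
    using assms(1) unfolding tangent_iff[OF atlases(1)] by blast
  obtain \<delta> where d: "smooth_at (vec_atlas :: (real, real) atlas) M \<delta> 0" "\<delta> 0 = snd x" "Y = velocity M \<delta>"
    using assms(2) unfolding tangent_iff[OF atlases(2)] by blast
  have x: "x = (\<gamma> 0, \<delta> 0)" using g d by simp
  show ?thesis
    by (rule that[OF g(1) d(1) x g(3) d(3)])
      (unfold g(3) d(3) C1_atlas_def, subst x, rule tpair_velocity[OF g(1) d(1)], rule smooth_at_Pair[OF g(1) d(1)])
qed

definition push :: "'e \<times> 'm \<Rightarrow> 'e tvec \<Rightarrow> 'm tvec \<Rightarrow> ('e \<times> 'g) set tvec" where
  "push x X Y = tmap RT (fst \<circ> \<Upsilon>) (C1_pair S x X Y)"

lemma push_tangent: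
  assumes "X \<in> tangent E (fst x)" "Y \<in> tangent M (snd x)"
  shows "push x X Y \<in> tangent RT (fst (\<Upsilon> x))"
  using tmap_tangent[OF smooth_Upsilon1 atlas_C1 atlas_RT, of _ x]
    tpair_tangent[OF atlases(1,2) assms] unfolding push_def C1_atlas_def by simp

text \<open>All of \<open>Y\<close> goes to the second summand. In a variation the first summand is
  the vector \<open>\<eta> k\<close> of the subbundle and the second is the correction term; the
  definition of the reduced homomorphism pairs exactly the correction with the base vector.\<close>

lemma push_tadd: "push x (tadd X X') Y = tadd (push x X tzero) (push x X' Y)"
  unfolding push_def tpair_tadd tmap_tadd ..

text \<open>The differential of \<Upsilon> in components: the second component of \<Upsilon> is
  \<pi>, and \<open>push\<close> carries the rest. For \<open>Y = tzero\<close> it is the equation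
  by which \<open>var R\<close> and \<open>corr R\<close> refer to lifts of vectors.\<close>

lemma push_pair:
  assumes "X \<in> tangent E (fst x)" "Y \<in> tangent M (snd x)"
  shows "tpair RT Q (\<Upsilon> x) (push x X Y) (tmap Q \<pi> Y) = tmap CR \<Upsilon> (C1_pair S x X Y)"
proof -
  obtain \<gamma> \<delta> where c: "smooth_at (vec_atlas :: (real, real) atlas) E \<gamma> 0"
    "smooth_at (vec_atlas :: (real, real) atlas) M \<delta> 0" "x = (\<gamma> 0, \<delta> 0)"
    "X = velocity E \<gamma>" "Y = velocity M \<delta>" "C1_pair S x X Y = velocity C1 (\<lambda>s. (\<gamma> s, \<delta> s))"
    "smooth_at (vec_atlas :: (real, real) atlas) C1 (\<lambda>s. (\<gamma> s, \<delta> s)) 0"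
    by (rule C1_pair_velocity[OF assms]) (rule that)
  have p: "push x X Y = velocity RT (\<lambda>s. fst (\<Upsilon> (\<gamma> s, \<delta> s)))"
    unfolding push_def c(6) tmap_velocity[OF smooth_Upsilon1 atlas_C1 atlas_RT] by (simp add: comp_def)
  have q: "tmap Q \<pi> Y = velocity Q (\<lambda>s. \<pi> (\<delta> s))"
    unfolding c(5) by (rule tmap_velocity[OF smooth_quot atlases(2,5)])
  have sp: "smooth_at vec_atlas RT (\<lambda>s. fst (\<Upsilon> (\<gamma> s, \<delta> s))) (0::real)"
    using smooth_at_app[OF smooth_Upsilon1 atlas_C1 atlas_RT c(7)] by (simp add: comp_def)
  have eq: "(\<lambda>s. (fst (\<Upsilon> (\<gamma> s, \<delta> s)), \<pi> (\<delta> s))) = (\<lambda>s. \<Upsilon> (\<gamma> s, \<delta> s))"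
    by (rule ext) (simp add: prod_eq_iff snd_Upsilon)
  have "\<Upsilon> x = (fst (\<Upsilon> (\<gamma> 0, \<delta> 0)), \<pi> (\<delta> 0))" by (simp add: c(3) prod_eq_iff snd_Upsilon)
  then have "tpair RT Q (\<Upsilon> x) (push x X Y) (tmap Q \<pi> Y) = velocity CR (\<lambda>s. \<Upsilon> (\<gamma> s, \<delta> s))"
    using tpair_velocity[OF sp smooth_at_quot[OF c(2)]] unfolding p q eq by simp
  also have "\<dots> = tmap CR \<Upsilon> (C1_pair S x X Y)"
    unfolding c(6) by (rule tmap_velocity[OF smooth_Upsilon atlas_C1 atlas_CR, symmetric])
  finally show ?thesis .
qed

lemma bproj_push:
  assumes "X \<in> tangent E (fst x)" "Y \<in> tangent M (snd x)"
  shows "tmap Q (bproj R) (push x X Y) = tmap Q \<pi> (tmap M \<phi> X)"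
proof -
  obtain \<gamma> \<delta> where c: "smooth_at (vec_atlas :: (real, real) atlas) E \<gamma> 0"
    "smooth_at (vec_atlas :: (real, real) atlas) M \<delta> 0" "x = (\<gamma> 0, \<delta> 0)"
    "X = velocity E \<gamma>" "Y = velocity M \<delta>" "C1_pair S x X Y = velocity C1 (\<lambda>s. (\<gamma> s, \<delta> s))"
    "smooth_at (vec_atlas :: (real, real) atlas) C1 (\<lambda>s. (\<gamma> s, \<delta> s)) 0"
    by (rule C1_pair_velocity[OF assms]) (rule that)
  have p: "push x X Y = velocity RT (\<lambda>s. fst (\<Upsilon> (\<gamma> s, \<delta> s)))"
    unfolding push_def c(6) tmap_velocity[OF smooth_Upsilon1 atlas_C1 atlas_RT] by (simp add: comp_def)
  have "eventually (\<lambda>s. (\<gamma> s, \<delta> s) \<in> pts C1) (nhds 0)"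
    using smooth_at_eventually[OF c(7) eventually_pts[OF atlas_C1]] by (simp only: eventually_vec)
  then have "eventually (\<lambda>s. bproj R (fst (\<Upsilon> (\<gamma> s, \<delta> s))) = \<pi> (\<phi> (\<gamma> s))) (nhds 0)"
    by eventually_elim (simp add: bproj_R_Upsilon)
  then have "velocity Q (\<lambda>s. bproj R (fst (\<Upsilon> (\<gamma> s, \<delta> s)))) = velocity Q (\<lambda>s. \<pi> (\<phi> (\<gamma> s)))"
    by (rule velocity_cong)
  moreover have "tmap Q \<pi> (tmap M \<phi> X) = velocity Q (\<lambda>s. \<pi> (\<phi> (\<gamma> s)))"
    unfolding c(4) tmap_velocity[OF smooth_bproj atlases(1,2)] tmap_velocity[OF smooth_quot atlases(2,5)] ..
  ultimately show ?thesis
    unfolding p tmap_velocity[OF smooth_bproj_R atlas_RT atlases(5)] by (rule trans[OF _ sym])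
qed

text \<open>The invariance of \<open>H\<close> is differentiated along a curve through
  \<open>x\<close>. Applied to \<Upsilon> and to its first component, it compares different lifts of
  one reduced vector.\<close>

lemma tmap_diag:
  assumes H: "smooth_map C1 B H" "smooth_atlas B" "\<And>x. x \<in> pts C1 \<Longrightarrow> H (diagC g x) = H x"
    and g: "g \<in> carrier G" and XY: "X \<in> tangent E (fst x)" "Y \<in> tangent M (snd x)"
  shows "tmap B H (C1_pair S (diagC g x) (tmap E (actE g) X) (tmap M (actM g) Y)) = tmap B H (C1_pair S x X Y)"
proof -
  obtain \<gamma> \<delta> where c: "smooth_at (vec_atlas :: (real, real) atlas) E \<gamma> 0"
    "smooth_at (vec_atlas :: (real, real) atlas) M \<delta> 0" "x = (\<gamma> 0, \<delta> 0)"
    "X = velocity E \<gamma>" "Y = velocity M \<delta>" "C1_pair S x X Y = velocity C1 (\<lambda>s. (\<gamma> s, \<delta> s))"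
    "smooth_at (vec_atlas :: (real, real) atlas) C1 (\<lambda>s. (\<gamma> s, \<delta> s)) 0"
    by (rule C1_pair_velocity[OF XY]) (rule that)
  have actM_map: "smooth_map M M (actM g)"
    unfolding smooth_map_iff[OF atlases(2,2)] using g
    by (auto intro!: smooth_at_actM smooth_at_group_const smooth_at_id atlases)
  have "C1_pair S (actE g (\<gamma> 0), actM g (\<delta> 0)) (tmap E (actE g) X) (tmap M (actM g) Y) =
      velocity C1 (\<lambda>s. (actE g (\<gamma> s), actM g (\<delta> s)))"
    unfolding c(4,5) tmap_velocity[OF smooth_map_actE[OF g] atlases(1,1)] tmap_velocity[OF actM_map atlases(2,2)] C1_atlas_def
    by (rule tpair_velocity[OF smooth_at_app[OF smooth_map_actE[OF g] atlases(1,1) c(1)]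
          smooth_at_app[OF actM_map atlases(2,2) c(2)]])
  then have l: "tmap B H (C1_pair S (diagC g x) (tmap E (actE g) X) (tmap M (actM g) Y)) =
      velocity B (\<lambda>s. H (diagC g (\<gamma> s, \<delta> s)))"
    using tmap_velocity[OF H(1) atlas_C1 H(2)] by (simp add: c(3) diag_def)
  have "eventually (\<lambda>s. (\<gamma> s, \<delta> s) \<in> pts C1) (nhds 0)"
    using smooth_at_eventually[OF c(7) eventually_pts[OF atlas_C1]] by (simp only: eventually_vec)
  then have "eventually (\<lambda>s. H (diagC g (\<gamma> s, \<delta> s)) = H (\<gamma> s, \<delta> s)) (nhds 0)"
    by eventually_elim (rule H(3))
  then show ?thesis
    unfolding l c(6) tmap_velocity[OF H(1) atlas_C1 H(2)] by (rule velocity_cong)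
qed

lemma tmap_bproj_actE:
  assumes "g \<in> carrier G" "X \<in> tangent E e"
  shows "tmap M \<phi> (tmap E (actE g) X) = tmap M (actM g) (tmap M \<phi> X)"
proof -
  obtain \<gamma> where c: "smooth_at (vec_atlas :: (real, real) atlas) E \<gamma> 0" "\<gamma> 0 = e" "X = velocity E \<gamma>"
    using assms(2) unfolding tangent_iff[OF atlases(1)] by blast
  have actM_map: "smooth_map M M (actM g)"
    unfolding smooth_map_iff[OF atlases(2,2)] using assms(1)
    by (auto intro!: smooth_at_actM smooth_at_group_const smooth_at_id atlases)
  have "eventually (\<lambda>s. \<gamma> s \<in> pts E) (nhds 0)"
    using smooth_at_eventually[OF c(1) eventually_pts[OF atlases(1)]] by (simp only: eventually_vec)
  then have "eventually (\<lambda>s. \<phi> (actE g (\<gamma> s)) = actM g (\<phi> (\<gamma> s))) (nhds 0)"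
    by eventually_elim (rule proj_equiv[OF assms(1)])
  then show ?thesis
    unfolding c(3) tmap_velocity[OF smooth_map_actE[OF assms(1)] atlases(1,1)]
      tmap_velocity[OF smooth_bproj atlases(1,2)] tmap_velocity[OF actM_map atlases(2,2)]
    by (rule velocity_cong)
qed

text \<open>A smooth function \<open>f\<close> on \<open>E\<close> is recovered, along the slice of fixed \<open>m\<close>, from the invariant function
  \<open>(e', m') \<mapsto> b(\<pi> m') f(\<gamma>(m) \<gamma>(m')\<^sup>-\<^sup>1 e')\<close>, where \<open>\<gamma>\<close> is the group coordinate of a local trivialization of
  \<open>M \<rightarrow> M/G\<close> and \<open>b\<close> is a bump function on \<open>M/G\<close>; only the quotient \<open>M/G\<close> needs bump functions.\<close>

lemma slice_extension:
  fixes f :: "'e \<Rightarrow> real"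
  assumes f: "f \<in> Cinf E" and m: "m \<in> pts M"
  obtains h where "h \<in> Cinf CR" "\<And>e. e \<in> pts E \<Longrightarrow> h (\<Upsilon> (e, m)) = f e"
proof -
  obtain V \<gamma> t where V: "openin (mtop Q) V" "\<pi> m \<in> V"
    and \<gamma>: "\<And>x. x \<in> pts M \<Longrightarrow> \<pi> x \<in> V \<Longrightarrow> smooth_at M GA \<gamma> x"
      "\<And>x g. x \<in> pts M \<Longrightarrow> \<pi> x \<in> V \<Longrightarrow> g \<in> carrier G \<Longrightarrow> \<gamma> (actM g x) = g \<otimes> \<gamma> x"
      "\<And>q'. q' \<in> V \<Longrightarrow> smooth_at Q M t q'" "\<And>q'. q' \<in> V \<Longrightarrow> \<pi> (t q') = q'" "\<And>q'. q' \<in> V \<Longrightarrow> \<gamma> (t q') = \<one>"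
    by (rule principal_triv[OF quot_closed[OF m]]) (rule that)
  obtain b :: "'m set \<Rightarrow> real" and K where b: "b \<in> Cinf Q" "b (\<pi> m) = 1" "closedin (mtop Q) K" "K \<subseteq> V"
    "\<And>q. q \<in> pts Q \<Longrightarrow> q \<notin> K \<Longrightarrow> b q = 0"
    by (rule manifold_bump[OF manifold_Q V]) (rule that)
  have \<gamma>c: "\<gamma> x \<in> carrier G" if "x \<in> pts M" "\<pi> x \<in> V" for x
    using smooth_at_atlas(4)[OF \<gamma>(1)[OF that]] by (simp add: pts_GA)
  \<comment> \<open>The trivialization controls \<gamma> over \<open>V\<close> only. Since
    \<open>b\<close> vanishes off a closed set \<open>K\<close> inside \<open>V\<close>, the
    extension by 0 is smooth across the boundary of \<open>V\<close> too.\<close>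
  define k where "k = (\<lambda>x. if \<pi> (snd x) \<in> V then b (\<pi> (snd x)) * f (actE (\<gamma> m \<otimes> inv (\<gamma> (snd x))) (fst x)) else 0)"
  have k0: "k x = 0" if "x \<in> pts C1" "\<pi> (snd x) \<notin> K" for x
    using that b(5) quot_closed by (auto simp: k_def pts_C1)
  have "smooth_at C1 vec_atlas k x" if x: "x \<in> pts C1" for x
  proof -
    have c: "smooth_at C1 E fst x" "smooth_at C1 M snd x"
      using smooth_at_fst[OF atlases(1,2)] smooth_at_snd[OF atlases(1,2)] x unfolding C1_atlas_def by blast+
    note q = smooth_at_quot[OF c(2)]
    show ?thesis
    proof (cases "\<pi> (snd x) \<in> K")
      case True
      then have xV: "\<pi> (snd x) \<in> V" using b(4) by blast
      have xM: "snd x \<in> pts M" using x by (auto simp: pts_C1)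
      have e: "smooth_at C1 E (\<lambda>x. actE (\<gamma> m \<otimes> inv (\<gamma> (snd x))) (fst x)) x"
        by (intro smooth_at_actE smooth_at_mult smooth_at_inv smooth_at_group_const atlas_C1 x
            \<gamma>c[OF m V(2)] c(1) smooth_at_compose[OF c(2) \<gamma>(1)[OF xM xV]])
      have "smooth_at C1 vec_atlas (\<lambda>x. f (actE (\<gamma> m \<otimes> inv (\<gamma> (snd x))) (fst x))) x"
        using f smooth_at_atlas(4)[OF e] unfolding Cinf_iff[OF atlases(1)] by (intro smooth_at_compose[OF e]) blast
      moreover have "smooth_at C1 vec_atlas (\<lambda>x. b (\<pi> (snd x))) x"
        using b(1) smooth_at_atlas(4)[OF q] unfolding Cinf_iff[OF atlases(5)] by (intro smooth_at_compose[OF q]) blast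
      ultimately have "smooth_at C1 vec_atlas (\<lambda>x. b (\<pi> (snd x)) * f (actE (\<gamma> m \<otimes> inv (\<gamma> (snd x))) (fst x))) x"
        by (intro smooth_at_times)
      moreover have "eventually (\<lambda>x. \<pi> (snd x) \<in> V) (nhdsin (mtop C1) x)"
        by (rule smooth_at_eventually[OF q eventually_in_open[OF V(1) xV]])
      then have "eventually (\<lambda>x. b (\<pi> (snd x)) * f (actE (\<gamma> m \<otimes> inv (\<gamma> (snd x))) (fst x)) = k x) (nhdsin (mtop C1) x)"
        by eventually_elim (simp add: k_def)
      ultimately show ?thesis by (rule smooth_at_cong)
    next
      case False
      have "openin (mtop Q) (pts Q - K)" using b(3) unfolding closedin_def topspace_mtop[OF atlases(5)] by blast
      moreover have "\<pi> (snd x) \<in> pts Q - K" using False smooth_at_atlas(4)[OF q] by blast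
      ultimately have "eventually (\<lambda>q. q \<in> pts Q - K) (nhdsin (mtop Q) (\<pi> (snd x)))" by (rule eventually_in_open)
      then have "eventually (\<lambda>x. \<pi> (snd x) \<in> pts Q - K) (nhdsin (mtop C1) x)" by (rule smooth_at_eventually[OF q])
      then have "eventually (\<lambda>x. 0 = k x) (nhdsin (mtop C1) x)"
        using eventually_pts[OF atlas_C1] by eventually_elim (simp add: k0)
      moreover have "smooth_at C1 vec_atlas (\<lambda>x. 0) x"
        by (rule smooth_at_const[OF atlas_C1 vec_atlas_smooth x]) simp
      ultimately show ?thesis by (rule smooth_at_cong[rotated])
    qed
  qed
  then have k: "k \<in> Cinf C1" by (simp add: Cinf_iff[OF atlas_C1])
  have k_diag: "k (diagC g x) = k x" if g: "g \<in> carrier G" and x: "x \<in> pts C1" for g x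
  proof -
    obtain e' m' where x': "x = (e', m')" by (cases x)
    have em: "e' \<in> pts E" "m' \<in> pts M" using x by (auto simp: x' pts_C1)
    have q: "\<pi> (actM g m') = \<pi> m'" by (rule actM.orbit_act[OF g em(2)])
    show ?thesis
    proof (cases "\<pi> m' \<in> V")
      case True
      note gc = \<gamma>c[OF em(2) True] \<gamma>c[OF m V(2)]
      have "actE (\<gamma> m \<otimes> inv (\<gamma> (actM g m'))) (actE g e') = actE (\<gamma> m \<otimes> inv (g \<otimes> \<gamma> m') \<otimes> g) e'"
        using \<gamma>(2)[OF em(2) True g] g gc em by (simp add: actE.act_mult)
      also have "\<gamma> m \<otimes> inv (g \<otimes> \<gamma> m') \<otimes> g = \<gamma> m \<otimes> inv (\<gamma> m')"
        using g gc by (simp add: inv_mult_group m_assoc)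
      finally show ?thesis using True q by (simp add: k_def x' diag_def)
    qed (simp add: k_def x' diag_def q)
  qed
  let ?h = "\<lambda>z. k (inv_into (pts C1) \<Upsilon> z)"
  have h: "?h (\<Upsilon> x) = k x" if x: "x \<in> pts C1" for x
  proof -
    have "inv_into (pts C1) \<Upsilon> (\<Upsilon> x) \<in> pts C1" "\<Upsilon> x = \<Upsilon> (inv_into (pts C1) \<Upsilon> (\<Upsilon> x))"
      using inv_into_into[of "\<Upsilon> x" \<Upsilon> "pts C1"] f_inv_into_f[of "\<Upsilon> x" \<Upsilon> "pts C1"] x by auto
    then obtain g where "g \<in> carrier G" "inv_into (pts C1) \<Upsilon> (\<Upsilon> x) = diagC g x"
      using Upsilon_eqD[OF x] by metis
    then show ?thesis using k_diag x by simp
  qed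
  show ?thesis
  proof (rule that[of ?h])
    show "?h \<in> Cinf CR" by (rule descent[OF k h])
    fix e assume e: "e \<in> pts E"
    have "k (e, m) = f e"
      using V(2) b(2) e \<gamma>c[OF m V(2)] by (simp add: k_def actE.act_one)
    then show "?h (\<Upsilon> (e, m)) = f e" using h[of "(e, m)"] e m by (simp add: pts_C1)
  qed
qed

text \<open>The zero second component means that a test function is differentiated along the slice
  through \<open>y\<close> only. Testing with the extension \<open>h\<close> of \<open>f\<close>
  therefore returns the value of the vector on \<open>f\<close>.\<close>

lemma dUpsilon_inj:
  assumes y: "y \<in> pts C1" and X: "X \<in> tangent E (fst y)" "X' \<in> tangent E (fst y)"
    and eq: "tmap CR \<Upsilon> (C1_pair S y X tzero) = tmap CR \<Upsilon> (C1_pair S y X' tzero)"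
  shows "X = X'"
proof
  fix f
  show "X f = X' f"
  proof (cases "f \<in> Cinf E")
    case False
    then show ?thesis using tangent_not_Cinf[OF X(1)] tangent_not_Cinf[OF X(2)] by simp
  next
    case True
    have m: "snd y \<in> pts M" using y by (auto simp: pts_C1)
    obtain h where h: "h \<in> Cinf CR" "\<And>e. e \<in> pts E \<Longrightarrow> h (\<Upsilon> (e, snd y)) = f e"
      by (rule slice_extension[OF True m]) (rule that)
    have hC: "h \<circ> \<Upsilon> \<in> Cinf (prod_atlas E M)"
      using Cinf_compose[OF h(1) smooth_Upsilon atlas_C1 atlas_CR] by (simp add: C1_atlas_def comp_def)
    have "tmap CR \<Upsilon> (C1_pair S y Z tzero) h = Z f" if Z: "Z \<in> tangent E (fst y)" for Z
    proof -
      have "tmap CR \<Upsilon> (C1_pair S y Z tzero) h = Z (\<lambda>e. h (\<Upsilon> (e, snd y)))"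
        using h(1) hC by (simp add: tmap_def tpair_def tzero_def)
      also have "\<dots> = Z f" by (rule tangent_cong[OF atlases(1) Z h(2)])
      finally show ?thesis .
    qed
    then show ?thesis using X eq by metis
  qed
qed

lemma C2_pts:
  assumes "(x, y) \<in> C2_set S"
  shows "x \<in> pts C1" "y \<in> pts C1" "\<phi> (fst y) = snd x" "snd x \<in> pts M" "fst x \<in> pts E" "snd y \<in> pts M" "fst y \<in> pts E"
  using assms unfolding C2_set_def by (auto simp: pts_C1)

text \<open>\<open>corr R\<close> is a definite description over all lifts, so every lift must be
  shown to give the same vector. Two lifts of the pair of points turn out to differ by one group
  element \<open>g\<close>; injectivity of the differential then forces the lifted vectors to differ
  by \<open>g\<close> as well, and the equivariance of \<open>corr S\<close> finishes.\<close>

lemma corr_R: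
  assumes xy: "(x, y) \<in> C2_set S" and \<delta>: "\<delta> \<in> var S y"
  shows "corr R (\<Upsilon> x) (\<Upsilon> y) (push y \<delta> tzero) = push x (corr S x y \<delta>) (tmap M \<phi> \<delta>)"
  unfolding corr_R_def push_def[symmetric]
proof (rule the_equality)
  note p = C2_pts[OF xy]
  have t\<delta>: "\<delta> \<in> tangent E (fst y)" by (rule var_tangent[OF p(2) \<delta>])
  have t0: "tzero \<in> tangent M (snd y)" by (rule tzero_tangent[OF atlases(2) p(6)])
  have pp: "tpair RT Q (\<Upsilon> y) (push y \<delta> tzero) tzero = tmap CR \<Upsilon> (C1_pair S y \<delta> tzero)"
    using push_pair[OF t\<delta> t0] by (simp add: tmap_tzero)
  show "\<exists>x' y' \<delta>'. (x', y') \<in> C2_set S \<and> \<Upsilon> x' = \<Upsilon> x \<and> \<Upsilon> y' = \<Upsilon> y \<and> \<delta>' \<in> var S y' \<and>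
      tmap CR \<Upsilon> (C1_pair S y' \<delta>' tzero) = tpair RT Q (\<Upsilon> y) (push y \<delta> tzero) tzero \<and>
      push x (corr S x y \<delta>) (tmap M \<phi> \<delta>) = push x' (corr S x' y' \<delta>') (tmap M \<phi> \<delta>')"
    using xy \<delta> pp by (intro exI[of _ x] exI[of _ y] exI[of _ \<delta>]) simp
  fix u
  assume "\<exists>x' y' \<delta>'. (x', y') \<in> C2_set S \<and> \<Upsilon> x' = \<Upsilon> x \<and> \<Upsilon> y' = \<Upsilon> y \<and> \<delta>' \<in> var S y' \<and>
      tmap CR \<Upsilon> (C1_pair S y' \<delta>' tzero) = tpair RT Q (\<Upsilon> y) (push y \<delta> tzero) tzero \<and>
      u = push x' (corr S x' y' \<delta>') (tmap M \<phi> \<delta>')"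
  then obtain x' y' \<delta>' where x'y': "(x', y') \<in> C2_set S" "\<Upsilon> x' = \<Upsilon> x" "\<Upsilon> y' = \<Upsilon> y" and \<delta>': "\<delta>' \<in> var S y'"
    and eq: "tmap CR \<Upsilon> (C1_pair S y' \<delta>' tzero) = tmap CR \<Upsilon> (C1_pair S y \<delta> tzero)"
    and u: "u = push x' (corr S x' y' \<delta>') (tmap M \<phi> \<delta>')"
    unfolding pp by (elim exE conjE) (rule that)
  note p' = C2_pts[OF x'y'(1)]
  obtain h where h: "h \<in> carrier G" "x' = diagC h x" by (rule Upsilon_eqD[OF p(1) p'(1) x'y'(2)[symmetric]])
  obtain g where g: "g \<in> carrier G" "y' = diagC g y" by (rule Upsilon_eqD[OF p(2) p'(2) x'y'(3)[symmetric]])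
  \<comment> \<open>So far \<open>x\<close> is moved by \<open>h\<close> and \<open>y\<close> by
    \<open>g\<close>. Both pairs satisfy the matching condition of \<open>C2_set\<close>, so
    \<open>g\<close> and \<open>h\<close> agree on the point \<open>snd x\<close>, and freeness on
    \<open>M\<close> gives \<open>h = g\<close>.\<close>
  have "actM g (snd x) = \<phi> (fst y')" using g p proj_equiv by (cases y) (simp add: diag_def)
  also have "\<dots> = actM h (snd x)" using p'(3) h(2) by (cases x) (simp add: diag_def)
  finally have gh: "h = g" using free_actM_eq[OF g(1) h(1) p(4)] by simp
  let ?g = "tmap E (actE g)"
  have g\<delta>: "?g \<delta> \<in> var S y'" using var_diag[OF g(1) p(2)] \<delta> g(2) by blast
  have "tmap CR \<Upsilon> (C1_pair S y' (?g \<delta>) tzero) = tmap CR \<Upsilon> (C1_pair S y \<delta> tzero)"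
    using tmap_diag[OF smooth_Upsilon atlas_CR Upsilon_diag(1)[OF g(1)] g(1) t\<delta> t0] g(2)
    by (simp add: tmap_tzero)
  then have \<delta>'_eq: "\<delta>' = ?g \<delta>"
    using dUpsilon_inj[OF p'(2) var_tangent[OF p'(2) \<delta>'] var_tangent[OF p'(2) g\<delta>]] eq by simp
  have inv: "(fst \<circ> \<Upsilon>) (diagC g x) = (fst \<circ> \<Upsilon>) x" if "x \<in> pts C1" for x
    using Upsilon_diag(1)[OF g(1) that] by simp
  have t\<phi>: "tmap M \<phi> \<delta> \<in> tangent M (snd x)"
    using tmap_tangent[OF smooth_bproj atlases(1,2) t\<delta>] p(3) by simp
  have "u = push (diagC g x) (?g (corr S x y \<delta>)) (tmap M (actM g) (tmap M \<phi> \<delta>))"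
    unfolding u \<delta>'_eq h(2) gh g(2) corr_diag[OF g(1) xy \<delta>] tmap_bproj_actE[OF g(1) t\<delta>] ..
  also have "\<dots> = push x (corr S x y \<delta>) (tmap M \<phi> \<delta>)"
    unfolding push_def
    by (rule tmap_diag[OF smooth_Upsilon1 atlas_RT inv g(1) corr_tangent(1)[OF xy \<delta>] t\<phi>])
  finally show "u = push x (corr S x y \<delta>) (tmap M \<phi> \<delta>)" .
qed

section \<open>The reduced Lagrangian, actions and variations\<close>

lemma lagr_Cinf: "lagr S \<in> Cinf C1"
  using dldps unfolding is_dldps_def Cinf_def by simp

lemma lagr_R:
  assumes "x \<in> pts C1"
  shows "lagr R (\<Upsilon> x) = lagr S x"
proof -
  have "inv_into (pts C1) \<Upsilon> (\<Upsilon> x) \<in> pts C1" "\<Upsilon> x = \<Upsilon> (inv_into (pts C1) \<Upsilon> (\<Upsilon> x))"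
    using inv_into_into[of "\<Upsilon> x" \<Upsilon> "pts C1"] f_inv_into_f[of "\<Upsilon> x" \<Upsilon> "pts C1"] assms by auto
  then obtain g where "g \<in> carrier G" "inv_into (pts C1) \<Upsilon> (\<Upsilon> x) = diagC g x"
    using Upsilon_eqD[OF assms] by metis
  then show ?thesis using lagr_diag assms by (simp add: R_sel)
qed

lemma lagr_R_Cinf: "lagr R \<in> Cinf CR"
  by (rule descent[OF lagr_Cinf lagr_R])

text \<open>In slot \<open>k\<close> both actions are the same constant plus one Lagrangian, and the
  reduced Lagrangian pulls back to the original one on \<open>C1\<close>. Slot \<open>k\<close>
  takes \<open>\<delta>m (k + 1)\<close> because its second entry is
  \<open>m\<^sub>k\<^sub>+\<^sub>1\<close>.\<close>

lemma d_action_R: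
  assumes len: "length xs = length vs" and \<Upsilon>: "\<And>k. k < length vs \<Longrightarrow> xs ! k \<in> pts C1 \<and> \<Upsilon> (xs ! k) = vs ! k"
    and t: "\<And>k. k < length xs \<Longrightarrow> \<delta>\<epsilon> k \<in> tangent E (fst (xs ! k)) \<and> \<delta>m (k + 1) \<in> tangent M (snd (xs ! k))"
  shows "d_action R vs (\<lambda>k. push (xs ! k) (\<delta>\<epsilon> k) (\<delta>m (k + 1))) (\<lambda>k. tmap Q \<pi> (\<delta>m k)) = d_action S xs \<delta>\<epsilon> \<delta>m"
  unfolding d_action_def R_sel(1,2) len
proof (rule sum.cong[OF refl])
  fix k assume "k \<in> {..<length vs}"
  then have k: "k < length vs" "k < length xs" using len by auto
  let ?x = "xs ! k"
  let ?Z = "C1_pair S ?x (\<delta>\<epsilon> k) (\<delta>m (k + 1))"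
  define a where "a = (\<Sum>j\<in>{..<length xs} - {k}. lagr S (xs ! j))"
  have a': "a = (\<Sum>j\<in>{..<length vs} - {k}. lagr R (vs ! j))"
    unfolding a_def len
  proof (rule sum.cong[OF refl])
    fix j assume "j \<in> {..<length vs} - {k}"
    then show "lagr S (xs ! j) = lagr R (vs ! j)" using \<Upsilon>[of j] lagr_R[of "xs ! j"] by simp
  qed
  have tx: "\<delta>\<epsilon> k \<in> tangent E (fst ?x)" "\<delta>m (k + 1) \<in> tangent M (snd ?x)" using t[OF k(2)] by auto
  have Z: "?Z \<in> tangent C1 ?x" unfolding C1_atlas_def by (rule tpair_tangent[OF atlases(1,2) tx])
  have xC: "?x \<in> pts C1" "\<Upsilon> ?x = vs ! k" using \<Upsilon>[OF k(1)] by auto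
  have "\<Upsilon> ` pts C1 \<subseteq> pts CR" using smooth_Upsilon unfolding smooth_map_def by (elim conjE)
  then have vC: "vs ! k \<in> pts CR" using xC(1) unfolding xC(2)[symmetric] by blast
  \<comment> \<open>The zero vector at \<open>vs ! k\<close> is a convenient witness; what is wanted
    is the smoothness of the shifted Lagrangian, without which \<open>tmap\<close> would return its
    default value 0.\<close>
  have aC: "(\<lambda>y. a + lagr R y) \<in> Cinf CR"
    by (rule tangent_add_const(2)[OF atlas_CR tzero_tangent[OF atlas_CR vC] lagr_R_Cinf])
  have "tpair RT Q (vs ! k) (push ?x (\<delta>\<epsilon> k) (\<delta>m (k + 1))) (tmap Q \<pi> (\<delta>m (k + 1))) (\<lambda>y. discrete_action R (vs[k := y]))
      = tmap CR \<Upsilon> ?Z (\<lambda>y. a + lagr R y)"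
    unfolding discrete_action_update[OF k(1)] a'[symmetric] push_pair[OF tx, unfolded xC(2)] ..
  also have "\<dots> = ?Z (\<lambda>y. a + lagr R (\<Upsilon> y))" unfolding tmap_def by (simp only: aC if_True comp_def)
  also have "\<dots> = ?Z (\<lambda>y. a + lagr S y)" by (rule tangent_cong[OF atlas_C1 Z]) (simp add: lagr_R)
  also have "\<dots> = ?Z (\<lambda>y. discrete_action S (xs[k := y]))"
    unfolding discrete_action_update[OF k(2)] a_def ..
  finally show "tpair RT Q (vs ! k) (push ?x (\<delta>\<epsilon> k) (\<delta>m (k + 1))) (tmap Q \<pi> (\<delta>m (k + 1))) (\<lambda>y. discrete_action R (vs[k := y]))
      = ?Z (\<lambda>y. discrete_action S (xs[k := y]))" .
qed

text \<open>The auxiliary vectors of the pushed variation are the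
  \<open>push (xs ! k) (\<eta> k) tzero\<close>. It remains to see that the push of each correction
  term, taken together with \<open>\<delta>m (k + 1)\<close>, is the reduced correction of the next
  auxiliary vector.\<close>

lemma inf_variation_R:
  assumes path: "discrete_path S xs" and len: "length xs = length vs"
    and \<Upsilon>: "\<And>k. k < length vs \<Longrightarrow> \<Upsilon> (xs ! k) = vs ! k"
    and var: "inf_variation S xs \<delta>\<epsilon> \<delta>m"
  shows "inf_variation R vs (\<lambda>k. push (xs ! k) (\<delta>\<epsilon> k) (\<delta>m (k + 1))) (\<lambda>k. tmap Q \<pi> (\<delta>m k))"
proof -
  let ?N = "length xs"
  have t: "\<And>k. k < ?N \<Longrightarrow> \<delta>\<epsilon> k \<in> tangent E (fst (xs ! k)) \<and> \<delta>m (k + 1) \<in> tangent M (snd (xs ! k))"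
    and \<delta>m: "\<And>k. k \<in> {1..?N - 1} \<Longrightarrow> \<delta>m k = tmap M \<phi> (\<delta>\<epsilon> k)" and \<delta>mN: "\<delta>m ?N = tzero"
    using var unfolding inf_variation_def Let_def by simp_all
  obtain \<eta> where "(\<forall>k\<in>{1..?N - 1}. \<eta> k \<in> var S (xs ! k)) \<and> \<delta>\<epsilon> (?N - 1) = \<eta> (?N - 1) \<and>
      (\<forall>k\<in>{1..?N - 2}. \<delta>\<epsilon> k = tadd (\<eta> k) (corr S (xs ! k) (xs ! (k + 1)) (\<eta> (k + 1)))) \<and>
      \<delta>\<epsilon> 0 = corr S (xs ! 0) (xs ! 1) (\<eta> 1)"
    using var unfolding inf_variation_def Let_def by (elim conjE exE) (rule that, intro conjI)
  then have \<eta>: "\<And>k. k \<in> {1..?N - 1} \<Longrightarrow> \<eta> k \<in> var S (xs ! k)" and \<delta>\<epsilon>N: "\<delta>\<epsilon> (?N - 1) = \<eta> (?N - 1)"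
    and \<delta>\<epsilon>: "\<And>k. k \<in> {1..?N - 2} \<Longrightarrow> \<delta>\<epsilon> k = tadd (\<eta> k) (corr S (xs ! k) (xs ! (k + 1)) (\<eta> (k + 1)))"
    and \<delta>\<epsilon>0: "\<delta>\<epsilon> 0 = corr S (xs ! 0) (xs ! 1) (\<eta> 1)"
    by blast+
  have N: "2 \<le> ?N" using path unfolding discrete_path_def by blast
  have pts: "xs ! k \<in> pts C1" if "k < ?N" for k
    using path that nth_mem[of k xs] unfolding discrete_path_def by blast
  have C2: "(xs ! k, xs ! (k + 1)) \<in> C2_set S" if "k + 1 < ?N" for k
  proof -
    have "\<phi> (fst (xs ! (k + 1))) = snd (xs ! (k + 1 - 1))"
      using path that unfolding discrete_path_def by (elim conjE) (rule bspec, auto)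
    then show ?thesis using pts[of k] pts[of "k + 1"] that unfolding C2_set_def by simp
  qed
  \<comment> \<open>Correction terms lie in the kernel of the differential of \<phi>, so
    \<open>\<delta>m k\<close> depends on \<open>\<eta> k\<close> alone. It is thus the base vector
    that the reduced homomorphism attaches to the correction in slot \<open>k - 1\<close>.\<close>
  have \<delta>m\<eta>: "\<delta>m k = tmap M \<phi> (\<eta> k)" if k: "k \<in> {1..?N - 1}" for k
  proof (cases "k = ?N - 1")
    case True
    then show ?thesis using \<delta>m[OF k] \<delta>\<epsilon>N by simp
  next
    case False
    then have k2: "k \<in> {1..?N - 2}" "k + 1 < ?N" "k + 1 \<in> {1..?N - 1}" using k by auto
    show ?thesis
      unfolding \<delta>m[OF k] \<delta>\<epsilon>[OF k2(1)] tmap_tadd corr_tangent(2)[OF C2[OF k2(2)] \<eta>[OF k2(3)]] tadd_tzero ..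
  qed
  have snd_vs: "\<pi> (snd (xs ! k)) = snd (vs ! k)" if "k < ?N" for k
    using \<Upsilon>[of k] that len snd_Upsilon[of "xs ! k"] by simp
  have corr_eq: "push (xs ! k) (corr S (xs ! k) (xs ! (k + 1)) (\<eta> (k + 1))) (\<delta>m (k + 1)) =
      corr R (vs ! k) (vs ! (k + 1)) (push (xs ! (k + 1)) (\<eta> (k + 1)) tzero)" if k: "k + 1 < ?N" for k
  proof -
    have k1: "k + 1 \<in> {1..?N - 1}" using k by auto
    have "\<Upsilon> (xs ! k) = vs ! k" "\<Upsilon> (xs ! (k + 1)) = vs ! (k + 1)" using \<Upsilon> k len by auto
    then show ?thesis
      using corr_R[OF C2[OF k] \<eta>[OF k1]] \<delta>m\<eta>[OF k1] by simp
  qed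
  show ?thesis
    unfolding inf_variation_def Let_def R_sel(1,2) len[symmetric]
  proof (intro conjI ballI allI impI exI[of _ "\<lambda>k. push (xs ! k) (\<eta> k) tzero"])
    fix k assume k: "k < ?N"
    show "push (xs ! k) (\<delta>\<epsilon> k) (\<delta>m (k + 1)) \<in> tangent RT (fst (vs ! k))"
      using push_tangent[of "\<delta>\<epsilon> k" "xs ! k" "\<delta>m (k + 1)"] t[OF k] \<Upsilon>[of k] k len by simp
    show "tmap Q \<pi> (\<delta>m (k + 1)) \<in> tangent Q (snd (vs ! k))"
      using tmap_tangent[OF smooth_quot atlases(2,5), of "\<delta>m (k + 1)" "snd (xs ! k)"] t[OF k] snd_vs[OF k] by simp
  next
    fix k assume k: "k \<in> {1..?N - 1}"
    then have kN: "k < ?N" by auto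
    show "tmap Q \<pi> (\<delta>m k) = tmap Q (bproj R) (push (xs ! k) (\<delta>\<epsilon> k) (\<delta>m (k + 1)))"
      using bproj_push[of "\<delta>\<epsilon> k" "xs ! k" "\<delta>m (k + 1)"] t[OF kN] \<delta>m[OF k] by simp
    have tm: "snd (xs ! k) \<in> pts M" using pts[OF kN] by (auto simp: pts_C1)
    note te = var_tangent[OF pts[OF kN] \<eta>[OF k]] and t0 = tzero_tangent[OF atlases(2) tm]
    have \<Upsilon>k: "\<Upsilon> (xs ! k) = vs ! k" using \<Upsilon> kN len by simp
    show "push (xs ! k) (\<eta> k) tzero \<in> var R (vs ! k)"
      unfolding var_R
    proof (intro CollectI bexI[of _ "xs ! k"] bexI[of _ "\<eta> k"] conjI \<Upsilon>k pts[OF kN] \<eta>[OF k])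
      show "push (xs ! k) (\<eta> k) tzero \<in> tangent RT (fst (vs ! k))"
        using push_tangent[OF te t0] \<Upsilon>k by simp
      show "tpair RT Q (vs ! k) (push (xs ! k) (\<eta> k) tzero) tzero = tmap CR \<Upsilon> (C1_pair S (xs ! k) (\<eta> k) tzero)"
        using push_pair[OF te t0] \<Upsilon>k by (simp add: tmap_tzero)
    qed
  next
    show "tmap Q \<pi> (\<delta>m ?N) = tzero" by (simp add: \<delta>mN tmap_tzero)
    show "push (xs ! (?N - 1)) (\<delta>\<epsilon> (?N - 1)) (\<delta>m (?N - 1 + 1)) = push (xs ! (?N - 1)) (\<eta> (?N - 1)) tzero"
    proof -
      \<comment> \<open>In the last slot the base vector is \<open>\<delta>m ?N\<close>, which the
        fixed endpoint makes zero; the push of \<open>\<eta> (?N - 1)\<close> is left.\<close>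
      have "?N - 1 + 1 = ?N" using N by simp
      then show ?thesis unfolding \<delta>\<epsilon>N by (simp only: \<delta>mN)
    qed
    show "push (xs ! 0) (\<delta>\<epsilon> 0) (\<delta>m (0 + 1)) = corr R (vs ! 0) (vs ! 1) (push (xs ! 1) (\<eta> 1) tzero)"
      using corr_eq[of 0] N \<delta>\<epsilon>0 by simp
    fix k assume k: "k \<in> {1..?N - 2}"
    then have "k + 1 < ?N" by auto
    from corr_eq[OF this]
    show "push (xs ! k) (\<delta>\<epsilon> k) (\<delta>m (k + 1)) = tadd (push (xs ! k) (\<eta> k) tzero)
        (corr R (vs ! k) (vs ! (k + 1)) (push (xs ! (k + 1)) (\<eta> (k + 1)) tzero))"
      unfolding \<delta>\<epsilon>[OF k] push_tadd by simp
  qed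
qed

section \<open>Lifting trajectories\<close>

text \<open>Built by induction on the length of the lifted prefix, starting from
  \<open>[x\<^sub>0]\<close>. An arbitrary preimage in \<open>kin S\<close> of the next entry is
  translated to fit the previous one; the translation changes neither its image under \<Upsilon> nor
  its membership in \<open>kin S\<close>.\<close>

lemma lift_path:
  assumes path: "discrete_path R vs" and kin: "set vs \<subseteq> kin R"
    and x0: "x\<^sub>0 \<in> kin S" "\<Upsilon> x\<^sub>0 = vs ! 0"
  shows "\<exists>xs. xs ! 0 = x\<^sub>0 \<and> length xs = length vs \<and> set xs \<subseteq> kin S \<and> discrete_path S xs \<and>
    (\<forall>k<length vs. \<Upsilon> (xs ! k) = vs ! k)"
proof -
  have N: "2 \<le> length vs"
    and link: "\<And>k. k \<in> {1..<length vs} \<Longrightarrow> bproj R (fst (vs ! k)) = snd (vs ! (k - 1))"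
    using path unfolding discrete_path_def by blast+
  have "\<exists>xs. xs ! 0 = x\<^sub>0 \<and> length xs = n \<and> set xs \<subseteq> kin S \<and>
      (\<forall>k\<in>{1..<n}. \<phi> (fst (xs ! k)) = snd (xs ! (k - 1))) \<and> (\<forall>k<n. \<Upsilon> (xs ! k) = vs ! k)"
    if "1 \<le> n" "n \<le> length vs" for n
    using that
  proof (induction n rule: dec_induct)
    case base
    show ?case using x0 by (intro exI[of _ "[x\<^sub>0]"]) auto
  next
    case (step n)
    then obtain xs where xs: "xs ! 0 = x\<^sub>0" "length xs = n" "set xs \<subseteq> kin S"
        "\<forall>k\<in>{1..<n}. \<phi> (fst (xs ! k)) = snd (xs ! (k - 1))" "\<forall>k<n. \<Upsilon> (xs ! k) = vs ! k"
      by auto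
    have n: "1 \<le> n" "n < length vs" using step by auto
    let ?x = "xs ! (n - 1)"
    have "?x \<in> set xs" using xs(2) n by (intro nth_mem) simp
    then have x: "?x \<in> pts C1" "\<Upsilon> ?x = vs ! (n - 1)"
      using xs(3,5) n kin_pts by auto
    have "vs ! n \<in> \<Upsilon> ` kin S" using kin n(2) nth_mem[of n vs] unfolding R_sel by blast
    then obtain y where y: "y \<in> kin S" "vs ! n = \<Upsilon> y" by blast
    have yC: "y \<in> pts C1" using y(1) kin_pts by blast
    \<comment> \<open>The matching condition of the reduced path, read through \<Upsilon>, is the
      matching of the lifts up to an element of \<open>G\<close>.\<close>
    have "\<pi> (\<phi> (fst y)) = \<pi> (snd ?x)"
      using link[of n] n bproj_R_Upsilon[OF yC] y(2) x(2) snd_Upsilon[of ?x] by simp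
    moreover have "\<phi> (fst y) \<in> pts M" "snd ?x \<in> pts M" using yC x(1) bproj_closed by (auto simp: pts_C1)
    ultimately obtain g where g: "g \<in> carrier G" "snd ?x = actM g (\<phi> (fst y))"
      using actM.orbit_eq_iff by blast
    let ?y = "diagC g y"
    have y': "?y \<in> kin S" "\<Upsilon> ?y = vs ! n" "\<phi> (fst ?y) = snd ?x"
      using kin_diag[OF g(1) y(1)] Upsilon_diag(1)[OF g(1) yC] y(2) g yC proj_equiv
      by (auto simp: diag_def pts_C1)
    show ?case
    proof (intro exI[of _ "xs @ [?y]"] conjI ballI allI impI)
      show "(xs @ [?y]) ! 0 = x\<^sub>0" using xs n by (simp add: nth_append)
      show "length (xs @ [?y]) = Suc n" "set (xs @ [?y]) \<subseteq> kin S" using xs y' by auto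
      show "\<phi> (fst ((xs @ [?y]) ! k)) = snd ((xs @ [?y]) ! (k - 1))" if "k \<in> {1..<Suc n}" for k
      proof (cases "k = n")
        case True
        then show ?thesis using xs(2) y'(3) n by (simp add: nth_append)
      next
        case False
        then have "k \<in> {1..<n}" using that by auto
        then show ?thesis using xs(2,4) by (auto simp: nth_append)
      qed
      show "\<Upsilon> ((xs @ [?y]) ! k) = vs ! k" if "k < Suc n" for k
        using that xs(2,5) y'(2) by (cases "k = n") (auto simp: nth_append)
    qed
  qed
  from this[of "length vs"] N obtain xs where xs: "xs ! 0 = x\<^sub>0" "length xs = length vs" "set xs \<subseteq> kin S"
      "\<forall>k\<in>{1..<length vs}. \<phi> (fst (xs ! k)) = snd (xs ! (k - 1))" "\<forall>k<length vs. \<Upsilon> (xs ! k) = vs ! k"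
    by auto
  moreover have "discrete_path S xs"
    unfolding discrete_path_def using xs N kin_pts by auto
  ultimately show ?thesis by blast
qed

text \<open>The group element relating the next two entries fixes the base point that the common
  previous entry prescribes, so freeness on \<open>M\<close> makes it trivial.\<close>

lemma lift_unique:
  assumes xs: "discrete_path S xs" and ys: "discrete_path S ys" and len: "length xs = length ys"
    and 0: "xs ! 0 = ys ! 0" and \<Upsilon>: "\<And>k. k < length xs \<Longrightarrow> \<Upsilon> (xs ! k) = \<Upsilon> (ys ! k)"
  shows "xs = ys"
proof (rule nth_equalityI[OF len])
  have pts: "xs ! k \<in> pts C1" "ys ! k \<in> pts C1" if "k < length xs" for k
    using xs ys that len nth_mem[of k xs] nth_mem[of k ys] unfolding discrete_path_def by auto
  fix k assume "k < length xs"
  then show "xs ! k = ys ! k"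
  proof (induction k)
    case 0
    show ?case by (rule \<open>xs ! 0 = ys ! 0\<close>)
  next
    case (Suc k)
    then have eq: "xs ! k = ys ! k" by simp
    have link: "\<phi> (fst (xs ! Suc k)) = snd (xs ! k)" "\<phi> (fst (ys ! Suc k)) = snd (ys ! k)"
      using xs ys Suc.prems len unfolding discrete_path_def by (auto dest!: bspec[of _ _ "Suc k"])
    note p = pts[OF Suc.prems]
    obtain g where g: "g \<in> carrier G" "ys ! Suc k = diagC g (xs ! Suc k)"
      by (rule Upsilon_eqD[OF p \<Upsilon>[OF Suc.prems]])
    have fp: "fst (xs ! Suc k) \<in> pts E" "snd (xs ! Suc k) \<in> pts M" using p(1) by (auto simp: pts_C1)
    have "actM g (\<phi> (fst (xs ! Suc k))) = \<phi> (fst (xs ! Suc k))"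
      using link eq g(2) proj_equiv[OF g(1) fp(1)] by (simp add: diag_def)
    then have "g = \<one>" using free_actM[OF g(1) bproj_closed[OF fp(1)]] by simp
    then show ?case using g(2) fp by (simp add: diag_def actE.act_one actM.act_one prod_eq_iff)
  qed
qed

text \<open>A variation of the lift is pushed to a variation of the reduced trajectory, where the
  differential of the action vanishes; \<open>d_action_R\<close> carries this value back. Uniqueness
  is that of the discrete path over \<open>vs\<close> starting at \<open>x\<^sub>0\<close>.\<close>

lemma trajectory_lift:
  assumes traj: "trajectory R vs" and x0: "x\<^sub>0 \<in> kin S" "\<Upsilon> x\<^sub>0 = vs ! 0"
  shows "\<exists>!xs. trajectory S xs \<and> xs ! 0 = x\<^sub>0 \<and> length xs = length vs \<and> (\<forall>k<length vs. \<Upsilon> (xs ! k) = vs ! k)"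
proof -
  have path: "discrete_path R vs" and kin: "set vs \<subseteq> kin R"
    and crit: "\<And>\<delta>v \<delta>r. inf_variation R vs \<delta>v \<delta>r \<Longrightarrow> d_action R vs \<delta>v \<delta>r = 0"
    using traj unfolding trajectory_def by auto
  obtain xs where xs: "xs ! 0 = x\<^sub>0" "length xs = length vs" "set xs \<subseteq> kin S" "discrete_path S xs"
      "\<forall>k<length vs. \<Upsilon> (xs ! k) = vs ! k"
    using lift_path[OF path kin x0] by (elim exE conjE) (rule that)
  have "d_action S xs \<delta>\<epsilon> \<delta>m = 0" if v: "inf_variation S xs \<delta>\<epsilon> \<delta>m" for \<delta>\<epsilon> \<delta>m
  proof -
    have "d_action R vs (\<lambda>k. push (xs ! k) (\<delta>\<epsilon> k) (\<delta>m (k + 1))) (\<lambda>k. tmap Q \<pi> (\<delta>m k)) = 0"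
      using xs(5) by (intro crit inf_variation_R[OF xs(4,2) _ v]) simp
    moreover have "xs ! k \<in> pts C1" if "k < length vs" for k
    proof -
      have "xs ! k \<in> set xs" using that xs(2) by (intro nth_mem) simp
      then show ?thesis using xs(3) kin_pts by blast
    qed
    ultimately show ?thesis
      using d_action_R[OF xs(2), of \<delta>\<epsilon> \<delta>m] xs(5) v unfolding inf_variation_def Let_def by simp
  qed
  then have "trajectory S xs" unfolding trajectory_def using xs(3,4) by simp
  moreover have "ys = xs"
    if "trajectory S ys \<and> ys ! 0 = x\<^sub>0 \<and> length ys = length vs \<and> (\<forall>k<length vs. \<Upsilon> (ys ! k) = vs ! k)" for ys
    using that xs by (intro lift_unique) (auto simp: trajectory_def)
  ultimately show ?thesis using xs(1,2,5) by blast
qed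

end

theorem theorem5p17:
  fixes G :: "('g, 'gv::fd_inner) lie"
    and actE :: "'g \<Rightarrow> 'e \<Rightarrow> 'e" and actM :: "'g \<Rightarrow> 'm \<Rightarrow> 'm" and actF :: "'f \<Rightarrow> 'g \<Rightarrow> 'f"
    and Q :: "('m set, 'qv::fd_inner) atlas"
    and S :: "('e, 'ev::fd_inner, 'm, 'mv::fd_inner, 'f, 'fv::fd_inner) dldps"
    and Hor :: "('m \<times> 'm) set"
    and vs :: "(('e \<times> 'g) set \<times> 'm set) list"
    and x\<^sub>0 :: "'e \<times> 'm"
  assumes "is_dldps S"
    and "symmetry_group G actE actM actF Q S"
    and "discrete_connection G (base_atlas S) actM Q Hor"
    and "trajectory (reduced_system G actE actM Q Hor S) vs"
    and "x\<^sub>0 \<in> kin S"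
    and "Upsilon G actE actM Hor S x\<^sub>0 = vs ! 0"
  shows "\<exists>!xs. trajectory S xs \<and> xs ! 0 = x\<^sub>0 \<and> length xs = length vs \<and>
           (\<forall>k<length vs. Upsilon G actE actM Hor S (xs ! k) = vs ! k)"
proof -
  interpret symmetric_system G actE actM actF Q S Hor
    by (rule symmetric_system.intro[OF assms(1-3)])
  show ?thesis by (rule trajectory_lift[OF assms(4-6)])
qed

end
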